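(* The category $\mathbf{fpSeq}$ of sequential cartesian multicategories is equivalent to the category $\mathbf{preAdd}$ of preadditive categories and additive functors.
   Context: A cartesian structure on a multicategory $\mathcal M$ assigns, to every mapping $\sigma:\{1,\dots,n\}\to\{1,\dots,m\}$ and sequences of objects $A_1,\dots,A_n$ and $B_1,\dots,B_m$ with $B_{\sigma i}=A_i$, and every object $C$, a mapping $f\mapsto\sigma f$, $\mathcal M(A_1,\dots,A_n;C)\to\mathcal M(B_1,\dots,B_m;C)$, functorially ($\mathrm{id}f=f$, $\rho(\sigma f)=(\rho\sigma)f$) and compatibly with composition: (i) $f(\sigma_1f_1,\dots,\sigma_nf_n)=(\sigma_1+\cdots+\sigma_n)f(f_1,\dots,f_n)$, where $+$ is juxtaposition of mappings; (ii) $(\sigma f)(f_1,\dots,f_m)=\sigma'\big(f(f_{\sigma1},\dots,f_{\sigma n})\big)$, where $\sigma'$ maps the $k$-th place of the $i$-th block (the domain of $f_{\sigma i}$) to the $k$-th place of the $(\sigma i)$-th block of the concatenated domains of $f_1,\dots,f_m$. A cartesian multicategory is a multicategory with a cartesian structure; $\mathbf{fpMlt}$ is the category of cartesian multicategories and functors preserving the actions, $F(\sigma f)=\sigma(Ff)$. For a category $\mathcal C$, $\mathcal C_\blacktriangleright$ is the multicategory with the objects of $\mathcal C$ and $\mathcal C_\blacktriangleright(X_1,\dots,X_n;X)=\mathcal C(X_1;X)\times\cdots\times\mathcal C(X_n;X)$, with composition $\langle f_1,\dots,f_n\rangle(\langle g_{11},\dots,g_{1m_1}\rangle,\dots,\langle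 g_{n1},\dots,g_{nm_n}\rangle)=\langle f_1g_{11},\dots,f_1g_{1m_1},\dots,f_ng_{n1},\dots,f_ng_{nm_n}\rangle$. A multicategory is sequential if it is isomorphic to some $\mathcal C_\blacktriangleright$; $\mathbf{fpSeq}$ is the full subcategory of $\mathbf{fpMlt}$ on the sequential ones. Preadditive category here means a category enriched in commutative monoids (not necessarily abelian groups); additive functors are the enriched functors. *)

theory Defs
  imports "HOL-Library.FuncSet" "HOL-Algebra.Group"
begin

section \<open>Categories, functors, equivalence\<close>

text \<open>
  Hom-sets are indexed by their endpoints and need not be disjoint, so composition takes
  the objects as arguments: \<open>Comp C X Y Z g f\<close> is \<open>g\<close> after \<open>f\<close>, for
  \<open>f\<close> from \<open>X\<close> to \<open>Y\<close> and \<open>g\<close> from \<open>Y\<close> to \<open>Z\<close>.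
  Values of the operations outside the objects and hom-sets are irrelevant. The same record serves
  for small categories and for the categories \<open>fpMlt\<close>, \<open>fpSeq\<close>, \<open>preAdd\<close> of structured ones.
\<close>

record ('o, 'a) category =
  Obj :: "'o set"
  Hom :: "'o \<Rightarrow> 'o \<Rightarrow> 'a set"
  Ident :: "'o \<Rightarrow> 'a"
  Comp :: "'o \<Rightarrow> 'o \<Rightarrow> 'o \<Rightarrow> 'a \<Rightarrow> 'a \<Rightarrow> 'a"

locale category =
  fixes C :: "('o, 'a, 'z) category_scheme"
  assumes Ident_closed: "X \<in> Obj C \<Longrightarrow> Ident C X \<in> Hom C X X"
    and Comp_closed:
      "\<lbrakk>X \<in> Obj C; Y \<in> Obj C; Z \<in> Obj C; f \<in> Hom C X Y; g \<in> Hom C Y Z\<rbrakk>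
        \<Longrightarrow> Comp C X Y Z g f \<in> Hom C X Z"
    and Comp_Ident_left:
      "\<lbrakk>X \<in> Obj C; Y \<in> Obj C; f \<in> Hom C X Y\<rbrakk> \<Longrightarrow> Comp C X Y Y (Ident C Y) f = f"
    and Comp_Ident_right:
      "\<lbrakk>X \<in> Obj C; Y \<in> Obj C; f \<in> Hom C X Y\<rbrakk> \<Longrightarrow> Comp C X X Y f (Ident C X) = f"
    and Comp_assoc:
      "\<lbrakk>W \<in> Obj C; X \<in> Obj C; Y \<in> Obj C; Z \<in> Obj C;
        f \<in> Hom C W X; g \<in> Hom C X Y; h \<in> Hom C Y Z\<rbrakk>
        \<Longrightarrow> Comp C W Y Z h (Comp C W X Y g f) = Comp C W X Z (Comp C X Y Z h g) f"

record ('o, 'a, 'p, 'b) functor_data =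
  FObj :: "'o \<Rightarrow> 'p"
  FArr :: "'o \<Rightarrow> 'o \<Rightarrow> 'a \<Rightarrow> 'b"

definition is_functor ::
  "('o, 'a, 'y) category_scheme \<Rightarrow> ('p, 'b, 'z) category_scheme
    \<Rightarrow> ('o, 'a, 'p, 'b) functor_data \<Rightarrow> bool" where
  "is_functor C D F \<longleftrightarrow>
    (\<forall>X \<in> Obj C. FObj F X \<in> Obj D) \<and>
    (\<forall>X \<in> Obj C. \<forall>Y \<in> Obj C. \<forall>f \<in> Hom C X Y. FArr F X Y f \<in> Hom D (FObj F X) (FObj F Y)) \<and>
    (\<forall>X \<in> Obj C. FArr F X X (Ident C X) = Ident D (FObj F X)) \<and>
    (\<forall>X \<in> Obj C. \<forall>Y \<in> Obj C. \<forall>Z \<in> Obj C. \<forall>f \<in> Hom C X Y. \<forall>g \<in> Hom C Y Z.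
      FArr F X Z (Comp C X Y Z g f) =
        Comp D (FObj F X) (FObj F Y) (FObj F Z) (FArr F Y Z g) (FArr F X Y f))"

definition id_functor :: "('o, 'a, 'o, 'a) functor_data" where
  "id_functor = \<lparr>FObj = (\<lambda>X. X), FArr = (\<lambda>X Y f. f)\<rparr>"

definition comp_functor ::
  "('p, 'b, 'q, 'c) functor_data \<Rightarrow> ('o, 'a, 'p, 'b) functor_data
    \<Rightarrow> ('o, 'a, 'q, 'c) functor_data" where
  "comp_functor G F =
    \<lparr>FObj = (\<lambda>X. FObj G (FObj F X)),
     FArr = (\<lambda>X Y f. FArr G (FObj F X) (FObj F Y) (FArr F X Y f))\<rparr>"

text \<open>
  A functor is determined by its values on objects and hom-sets; \<open>restrict_functor\<close> selects the
  canonical representative, so that HOL equality of restricted data is equality of functors.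
\<close>

definition restrict_functor ::
  "('o, 'a, 'z) category_scheme \<Rightarrow> ('o, 'a, 'p, 'b) functor_data
    \<Rightarrow> ('o, 'a, 'p, 'b) functor_data" where
  "restrict_functor C F =
    \<lparr>FObj = restrict (FObj F) (Obj C),
     FArr = (\<lambda>X Y f. if X \<in> Obj C \<and> Y \<in> Obj C \<and> f \<in> Hom C X Y
                      then FArr F X Y f else undefined)\<rparr>"

definition is_iso :: "('o, 'a, 'z) category_scheme \<Rightarrow> 'o \<Rightarrow> 'o \<Rightarrow> 'a \<Rightarrow> bool" where
  "is_iso C X Y f \<longleftrightarrow>
    f \<in> Hom C X Y \<and>
    (\<exists>g \<in> Hom C Y X. Comp C X Y X g f = Ident C X \<and> Comp C Y X Y f g = Ident C Y)"

definition naturally_isomorphic ::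
  "('o, 'a, 'y) category_scheme \<Rightarrow> ('p, 'b, 'z) category_scheme
    \<Rightarrow> ('o, 'a, 'p, 'b) functor_data \<Rightarrow> ('o, 'a, 'p, 'b) functor_data \<Rightarrow> bool" where
  "naturally_isomorphic C D F G \<longleftrightarrow>
    (\<exists>\<eta>. (\<forall>X \<in> Obj C. is_iso D (FObj F X) (FObj G X) (\<eta> X)) \<and>
         (\<forall>X \<in> Obj C. \<forall>Y \<in> Obj C. \<forall>f \<in> Hom C X Y.
            Comp D (FObj F X) (FObj F Y) (FObj G Y) (\<eta> Y) (FArr F X Y f) =
            Comp D (FObj F X) (FObj G X) (FObj G Y) (FArr G X Y f) (\<eta> X)))"

definition equivalent_categories ::
  "('o, 'a, 'y) category_scheme \<Rightarrow> ('p, 'b, 'z) category_scheme \<Rightarrow> bool" where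
  "equivalent_categories C D \<longleftrightarrow>
    category C \<and> category D \<and>
    (\<exists>F G. is_functor C D F \<and> is_functor D C G \<and>
           naturally_isomorphic C C (comp_functor G F) id_functor \<and>
           naturally_isomorphic D D (comp_functor F G) id_functor)"

definition full_subcategory :: "('o, 'a) category \<Rightarrow> ('o \<Rightarrow> bool) \<Rightarrow> ('o, 'a) category" where
  "full_subcategory C P = C\<lparr>Obj := {X \<in> Obj C. P X}\<rparr>"


section \<open>Preadditive categories\<close>

record ('o, 'a) preadditive_category = "('o, 'a) category" +
  Add :: "'o \<Rightarrow> 'o \<Rightarrow> 'a \<Rightarrow> 'a \<Rightarrow> 'a"
  Zero :: "'o \<Rightarrow> 'o \<Rightarrow> 'a"

definition hom_monoid ::
  "('o, 'a, 'z) preadditive_category_scheme \<Rightarrow> 'o \<Rightarrow> 'o \<Rightarrow> 'a monoid" where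
  "hom_monoid C X Y = \<lparr>carrier = Hom C X Y, mult = Add C X Y, one = Zero C X Y\<rparr>"

locale preadditive_category = category C
  for C :: "('o, 'a, 'z) preadditive_category_scheme" +
  assumes comm_monoid_hom:
      "\<lbrakk>X \<in> Obj C; Y \<in> Obj C\<rbrakk> \<Longrightarrow> comm_monoid (hom_monoid C X Y)"
    and Comp_Add_left:
      "\<lbrakk>X \<in> Obj C; Y \<in> Obj C; Z \<in> Obj C; f \<in> Hom C X Y; g \<in> Hom C Y Z; g' \<in> Hom C Y Z\<rbrakk>
        \<Longrightarrow> Comp C X Y Z (Add C Y Z g g') f = Add C X Z (Comp C X Y Z g f) (Comp C X Y Z g' f)"
    and Comp_Zero_left:
      "\<lbrakk>X \<in> Obj C; Y \<in> Obj C; Z \<in> Obj C; f \<in> Hom C X Y\<rbrakk>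
        \<Longrightarrow> Comp C X Y Z (Zero C Y Z) f = Zero C X Z"
    and Comp_Add_right:
      "\<lbrakk>X \<in> Obj C; Y \<in> Obj C; Z \<in> Obj C; f \<in> Hom C X Y; f' \<in> Hom C X Y; g \<in> Hom C Y Z\<rbrakk>
        \<Longrightarrow> Comp C X Y Z g (Add C X Y f f') = Add C X Z (Comp C X Y Z g f) (Comp C X Y Z g f')"
    and Comp_Zero_right:
      "\<lbrakk>X \<in> Obj C; Y \<in> Obj C; Z \<in> Obj C; g \<in> Hom C Y Z\<rbrakk>
        \<Longrightarrow> Comp C X Y Z g (Zero C X Y) = Zero C X Z"

definition additive_functor ::
  "('o, 'a, 'y) preadditive_category_scheme \<Rightarrow> ('p, 'b, 'z) preadditive_category_scheme
    \<Rightarrow> ('o, 'a, 'p, 'b) functor_data \<Rightarrow> bool" where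
  "additive_functor C D F \<longleftrightarrow>
    is_functor C D F \<and>
    (\<forall>X \<in> Obj C. \<forall>Y \<in> Obj C.
      FArr F X Y (Zero C X Y) = Zero D (FObj F X) (FObj F Y) \<and>
      (\<forall>f \<in> Hom C X Y. \<forall>g \<in> Hom C X Y.
        FArr F X Y (Add C X Y f g) =
          Add D (FObj F X) (FObj F Y) (FArr F X Y f) (FArr F X Y g)))"

definition preAdd ::
  "(('o, 'a) preadditive_category, ('o, 'a, 'o, 'a) functor_data) category" where
  "preAdd =
    \<lparr>Obj = {C. preadditive_category C},
     Hom = (\<lambda>C D. {F. additive_functor C D F \<and> restrict_functor C F = F}),
     Ident = (\<lambda>C. restrict_functor C id_functor),
     Comp = (\<lambda>C D E G F. restrict_functor C (comp_functor G F))\<rparr>"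


section \<open>Multicategories\<close>

text \<open>
  \<open>MComp M \<Gamma>s As B f fs\<close> is \<open>f(f\<^sub>1,\<dots>,f\<^sub>n)\<close>, where \<open>f\<close> goes from the list \<open>As\<close> to \<open>B\<close> and
  \<open>f\<^sub>i\<close> goes from the \<open>i\<close>-th list in \<open>\<Gamma>s\<close> to the \<open>i\<close>-th object in \<open>As\<close>.
\<close>

record ('o, 'm) multicategory =
  MObj :: "'o set"
  MHom :: "'o list \<Rightarrow> 'o \<Rightarrow> 'm set"
  MIdent :: "'o \<Rightarrow> 'm"
  MComp :: "'o list list \<Rightarrow> 'o list \<Rightarrow> 'o \<Rightarrow> 'm \<Rightarrow> 'm list \<Rightarrow> 'm"

definition MHoms ::
  "('o, 'm, 'z) multicategory_scheme \<Rightarrow> 'o list list \<Rightarrow> 'o list \<Rightarrow> 'm list set" where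
  "MHoms M \<Gamma>s As =
    {fs. length \<Gamma>s = length As \<and> length fs = length As \<and>
         (\<forall>i < length As. fs ! i \<in> MHom M (\<Gamma>s ! i) (As ! i))}"

locale multicategory =
  fixes M :: "('o, 'm, 'z) multicategory_scheme"
  assumes MIdent_closed: "A \<in> MObj M \<Longrightarrow> MIdent M A \<in> MHom M [A] A"
    and MComp_closed:
      "\<lbrakk>\<Gamma>s \<in> lists (lists (MObj M)); As \<in> lists (MObj M); B \<in> MObj M;
        f \<in> MHom M As B; fs \<in> MHoms M \<Gamma>s As\<rbrakk>
        \<Longrightarrow> MComp M \<Gamma>s As B f fs \<in> MHom M (concat \<Gamma>s) B"
    and MComp_MIdent_left:
      "\<lbrakk>As \<in> lists (MObj M); B \<in> MObj M; f \<in> MHom M As B\<rbrakk>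
        \<Longrightarrow> MComp M [As] [B] B (MIdent M B) [f] = f"
    and MComp_MIdent_right:
      "\<lbrakk>As \<in> lists (MObj M); B \<in> MObj M; f \<in> MHom M As B\<rbrakk>
        \<Longrightarrow> MComp M (map (\<lambda>A. [A]) As) As B f (map (MIdent M) As) = f"
    and MComp_assoc:
      "\<lbrakk>\<Gamma>ss \<in> lists (lists (lists (MObj M))); Ass \<in> lists (lists (MObj M));
        Bs \<in> lists (MObj M); D \<in> MObj M;
        length \<Gamma>ss = length Bs; length gss = length Bs;
        f \<in> MHom M Bs D; fs \<in> MHoms M Ass Bs;
        \<And>i. i < length Bs \<Longrightarrow> gss ! i \<in> MHoms M (\<Gamma>ss ! i) (Ass ! i)\<rbrakk>
        \<Longrightarrow> MComp M (map concat \<Gamma>ss) Bs D f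
              (map (\<lambda>i. MComp M (\<Gamma>ss ! i) (Ass ! i) (Bs ! i) (fs ! i) (gss ! i)) [0..<length Bs])
            = MComp M (concat \<Gamma>ss) (concat Ass) D (MComp M Ass Bs D f fs) (concat gss)"

record ('o, 'm, 'p, 'n) multifunctor_data =
  MFObj :: "'o \<Rightarrow> 'p"
  MFArr :: "'o list \<Rightarrow> 'o \<Rightarrow> 'm \<Rightarrow> 'n"

definition is_multifunctor ::
  "('o, 'm, 'y) multicategory_scheme \<Rightarrow> ('p, 'n, 'z) multicategory_scheme
    \<Rightarrow> ('o, 'm, 'p, 'n) multifunctor_data \<Rightarrow> bool" where
  "is_multifunctor M N F \<longleftrightarrow>
    (\<forall>A \<in> MObj M. MFObj F A \<in> MObj N) \<and>
    (\<forall>As \<in> lists (MObj M). \<forall>B \<in> MObj M. \<forall>f \<in> MHom M As B.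
      MFArr F As B f \<in> MHom N (map (MFObj F) As) (MFObj F B)) \<and>
    (\<forall>A \<in> MObj M. MFArr F [A] A (MIdent M A) = MIdent N (MFObj F A)) \<and>
    (\<forall>\<Gamma>s \<in> lists (lists (MObj M)). \<forall>As \<in> lists (MObj M). \<forall>B \<in> MObj M.
      \<forall>f \<in> MHom M As B. \<forall>fs \<in> MHoms M \<Gamma>s As.
        MFArr F (concat \<Gamma>s) B (MComp M \<Gamma>s As B f fs) =
          MComp N (map (map (MFObj F)) \<Gamma>s) (map (MFObj F) As) (MFObj F B) (MFArr F As B f)
            (map (\<lambda>i. MFArr F (\<Gamma>s ! i) (As ! i) (fs ! i)) [0..<length As]))"

definition id_multifunctor :: "('o, 'm, 'o, 'm) multifunctor_data" where
  "id_multifunctor = \<lparr>MFObj = (\<lambda>A. A), MFArr = (\<lambda>As B f. f)\<rparr>"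

definition comp_multifunctor ::
  "('p, 'n, 'q, 'k) multifunctor_data \<Rightarrow> ('o, 'm, 'p, 'n) multifunctor_data
    \<Rightarrow> ('o, 'm, 'q, 'k) multifunctor_data" where
  "comp_multifunctor G F =
    \<lparr>MFObj = (\<lambda>A. MFObj G (MFObj F A)),
     MFArr = (\<lambda>As B f. MFArr G (map (MFObj F) As) (MFObj F B) (MFArr F As B f))\<rparr>"

definition restrict_multifunctor ::
  "('o, 'm, 'z) multicategory_scheme \<Rightarrow> ('o, 'm, 'p, 'n) multifunctor_data
    \<Rightarrow> ('o, 'm, 'p, 'n) multifunctor_data" where
  "restrict_multifunctor M F =
    \<lparr>MFObj = restrict (MFObj F) (MObj M),
     MFArr = (\<lambda>As B f. if As \<in> lists (MObj M) \<and> B \<in> MObj M \<and> f \<in> MHom M As B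
                        then MFArr F As B f else undefined)\<rparr>"

definition isomorphic_multicategories ::
  "('o, 'm, 'y) multicategory_scheme \<Rightarrow> ('p, 'n, 'z) multicategory_scheme \<Rightarrow> bool" where
  "isomorphic_multicategories M N \<longleftrightarrow>
    (\<exists>F G. is_multifunctor M N F \<and> is_multifunctor N M G \<and>
      restrict_multifunctor M (comp_multifunctor G F) = restrict_multifunctor M id_multifunctor \<and>
      restrict_multifunctor N (comp_multifunctor F G) = restrict_multifunctor N id_multifunctor)"


section \<open>Cartesian multicategories\<close>

text \<open>
  A mapping from an \<open>n\<close>-element to an \<open>m\<close>-element index set is represented, with indices counted
  from \<open>0\<close>, as the list \<open>\<sigma>\<close> of its \<open>n\<close> values; the number \<open>m\<close> is supplied by the context, as
  the length of the target list of objects. The condition that the object at place \<open>\<sigma> i\<close> of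
  \<open>Bs\<close> is the object at place \<open>i\<close> of \<open>As\<close> says that \<open>As = reindex Bs \<sigma>\<close>. The composite \<open>\<rho>\<sigma>\<close> is
  \<open>reindex \<rho> \<sigma>\<close>, and \<open>Act M Bs D \<sigma> f\<close> is \<open>\<sigma>f\<close>, for \<open>f\<close> from \<open>reindex Bs \<sigma>\<close> to \<open>D\<close>.
\<close>

definition reindex :: "'b list \<Rightarrow> nat list \<Rightarrow> 'b list" where
  "reindex xs \<sigma> = map (\<lambda>i. xs ! i) \<sigma>"

definition is_mapping :: "nat \<Rightarrow> nat list \<Rightarrow> bool" where
  "is_mapping m \<sigma> \<longleftrightarrow> set \<sigma> \<subseteq> {..<m}"

text \<open>
  \<open>juxtapose ms \<sigma>s\<close> is \<open>\<sigma>\<^sub>1 + \<dots> + \<sigma>\<^sub>n\<close>, where the codomain of \<open>\<sigma>\<^sub>i\<close> has \<open>m\<^sub>i\<close> elements;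
  \<open>block_mapping ks \<sigma>\<close> is \<open>\<sigma>'\<close>, where the \<open>j\<close>-th block of the codomain has \<open>k\<^sub>j\<close> elements.
\<close>

definition juxtapose :: "nat list \<Rightarrow> nat list list \<Rightarrow> nat list" where
  "juxtapose ms \<sigma>s =
    concat (map (\<lambda>i. map (\<lambda>k. sum_list (take i ms) + k) (\<sigma>s ! i)) [0..<length \<sigma>s])"

definition block_mapping :: "nat list \<Rightarrow> nat list \<Rightarrow> nat list" where
  "block_mapping ks \<sigma> =
    concat (map (\<lambda>j. map (\<lambda>k. sum_list (take j ks) + k) [0..<ks ! j]) \<sigma>)"

record ('o, 'm) cartesian_multicategory = "('o, 'm) multicategory" +
  Act :: "'o list \<Rightarrow> 'o \<Rightarrow> nat list \<Rightarrow> 'm \<Rightarrow> 'm"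

locale cartesian_multicategory = multicategory M
  for M :: "('o, 'm, 'z) cartesian_multicategory_scheme" +
  assumes Act_closed:
      "\<lbrakk>Bs \<in> lists (MObj M); D \<in> MObj M; is_mapping (length Bs) \<sigma>;
        f \<in> MHom M (reindex Bs \<sigma>) D\<rbrakk>
        \<Longrightarrow> Act M Bs D \<sigma> f \<in> MHom M Bs D"
    and Act_id:
      "\<lbrakk>As \<in> lists (MObj M); D \<in> MObj M; f \<in> MHom M As D\<rbrakk>
        \<Longrightarrow> Act M As D [0..<length As] f = f"
    and Act_comp:
      "\<lbrakk>Cs \<in> lists (MObj M); D \<in> MObj M; is_mapping (length Cs) \<rho>; is_mapping (length \<rho>) \<sigma>;
        f \<in> MHom M (reindex (reindex Cs \<rho>) \<sigma>) D\<rbrakk>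
        \<Longrightarrow> Act M Cs D \<rho> (Act M (reindex Cs \<rho>) D \<sigma> f) = Act M Cs D (reindex \<rho> \<sigma>) f"
    and MComp_Act_inner:
      "\<lbrakk>\<Delta>s \<in> lists (lists (MObj M)); As \<in> lists (MObj M); D \<in> MObj M;
        length \<Delta>s = length As; length \<sigma>s = length As;
        \<And>i. i < length As \<Longrightarrow> is_mapping (length (\<Delta>s ! i)) (\<sigma>s ! i);
        f \<in> MHom M As D; fs \<in> MHoms M (map2 reindex \<Delta>s \<sigma>s) As\<rbrakk>
        \<Longrightarrow> MComp M \<Delta>s As D f
              (map (\<lambda>i. Act M (\<Delta>s ! i) (As ! i) (\<sigma>s ! i) (fs ! i)) [0..<length As])
            = Act M (concat \<Delta>s) D (juxtapose (map length \<Delta>s) \<sigma>s)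
                (MComp M (map2 reindex \<Delta>s \<sigma>s) As D f fs)"
    and MComp_Act_outer:
      "\<lbrakk>\<Gamma>s \<in> lists (lists (MObj M)); Bs \<in> lists (MObj M); D \<in> MObj M;
        is_mapping (length Bs) \<sigma>;
        f \<in> MHom M (reindex Bs \<sigma>) D; fs \<in> MHoms M \<Gamma>s Bs\<rbrakk>
        \<Longrightarrow> MComp M \<Gamma>s Bs D (Act M Bs D \<sigma> f) fs
            = Act M (concat \<Gamma>s) D (block_mapping (map length \<Gamma>s) \<sigma>)
                (MComp M (reindex \<Gamma>s \<sigma>) (reindex Bs \<sigma>) D f (reindex fs \<sigma>))"

definition cartesian_multifunctor ::
  "('o, 'm, 'y) cartesian_multicategory_scheme \<Rightarrow> ('p, 'n, 'z) cartesian_multicategory_scheme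
    \<Rightarrow> ('o, 'm, 'p, 'n) multifunctor_data \<Rightarrow> bool" where
  "cartesian_multifunctor M N F \<longleftrightarrow>
    is_multifunctor M N F \<and>
    (\<forall>Bs \<in> lists (MObj M). \<forall>D \<in> MObj M. \<forall>\<sigma>. is_mapping (length Bs) \<sigma> \<longrightarrow>
      (\<forall>f \<in> MHom M (reindex Bs \<sigma>) D.
        MFArr F Bs D (Act M Bs D \<sigma> f) =
          Act N (map (MFObj F) Bs) (MFObj F D) \<sigma> (MFArr F (reindex Bs \<sigma>) D f)))"

definition fpMlt ::
  "(('o, 'm) cartesian_multicategory, ('o, 'm, 'o, 'm) multifunctor_data) category" where
  "fpMlt =
    \<lparr>Obj = {M. cartesian_multicategory M},
     Hom = (\<lambda>M N. {F. cartesian_multifunctor M N F \<and> restrict_multifunctor M F = F}),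
     Ident = (\<lambda>M. restrict_multifunctor M id_multifunctor),
     Comp = (\<lambda>M N P G F. restrict_multifunctor M (comp_multifunctor G F))\<rparr>"


section \<open>Sequential multicategories\<close>

text \<open>The multicategory \<open>\<C>\<close> with subscript black triangle; its arrows are lists of arrows of \<open>\<C>\<close>.\<close>

definition seq_multicategory ::
  "('o, 'a, 'z) category_scheme \<Rightarrow> ('o, 'a list) multicategory" where
  "seq_multicategory C =
    \<lparr>MObj = Obj C,
     MHom = (\<lambda>Xs X. {fs. length fs = length Xs \<and> (\<forall>i < length Xs. fs ! i \<in> Hom C (Xs ! i) X)}),
     MIdent = (\<lambda>X. [Ident C X]),
     MComp = (\<lambda>\<Gamma>s Xs X fs gss.
       concat (map (\<lambda>i. map (\<lambda>j. Comp C (\<Gamma>s ! i ! j) (Xs ! i) X (fs ! i) (gss ! i ! j))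
                            [0..<length (\<Gamma>s ! i)])
                   [0..<length Xs]))\<rparr>"

text \<open>
  Taking \<open>C\<close> over the object and arrow types of \<open>M\<close> is no restriction: if \<open>M\<close> is isomorphic to
  \<open>seq_multicategory C\<close>, then \<open>C\<close> is isomorphic to the category of unary arrows of \<open>M\<close>.
\<close>

definition sequential :: "('o, 'm, 'z) multicategory_scheme \<Rightarrow> bool" where
  "sequential M \<longleftrightarrow>
    (\<exists>C :: ('o, 'm) category. category C \<and> isomorphic_multicategories M (seq_multicategory C))"

text \<open>
  The types \<open>'o\<close> and \<open>'m\<close> of \<open>fpSeq\<close> (and \<open>'o\<close> and \<open>'a\<close> of \<open>preAdd\<close>) play the role of the universe
  of sets of objects and arrows. As finite tuples of arrows are again arrows, the universe of
  arrows has to be closed under finite lists up to bijection, that is, has to be infinite.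
\<close>

definition fpSeq ::
  "(('o, 'm) cartesian_multicategory, ('o, 'm, 'o, 'm) multifunctor_data) category" where
  "fpSeq = full_subcategory fpMlt sequential"

end

theory Submission
  imports Defs "HOL-Algebra.FiniteProduct"
begin

text \<open>
  A preadditive category \<open>C\<close> makes the multicategory of tuples of arrows cartesian: the \<open>j\<close>-th
  component of \<open>\<sigma>f\<close> is the sum of the \<open>f\<^sub>i\<close> with \<open>\<sigma> i = j\<close>. After coding tuples by single arrows this
  is a functor to \<open>fpSeq\<close>, and it is fully faithful and essentially surjective. It is full because
  composing with empty tuples in all places but one extracts a component of a tuple, so that a
  multifunctor acts on tuples componentwise. It is essentially surjective because the same trick
  reduces an arbitrary cartesian structure on tuples to the maps induced by \<open>n \<rightarrow> 1\<close>, that is,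
  to \<open>n\<close>-ary sums on hom-sets; functoriality of the action makes these sums
  associative, commutative and unital, and compatibility with composition makes them bilinear.
\<close>


section \<open>Equivalences from fully faithful, essentially surjective functors\<close>

text \<open>Tuples over \<open>'a\<close> have type \<open>'a list\<close>, so
  \<open>seq_cartesian C\<close> is not itself an object of \<open>fpSeq\<close> over
  \<open>'a\<close>. An infinite \<open>'a\<close> admits an injection \<open>e\<close> from lists
  to arrows; \<open>e\<close> need not be surjective, so the coded hom-sets are images under
  \<open>e\<close>, and a sequential multicategory is recovered only up to isomorphism. Empty tuples
  can isolate a component because each hom-set from \<open>[]\<close> in the multicategory of tuples
  is the singleton of the empty tuple: a multifunctor between such multicategories has to preserve
  it, just as it preserves identities. The predicate \<open>sequential\<close> speaks of the
  underlying multicategory alone and says nothing about the action. The action of a given object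
  therefore has to be carried over to tuples before sums can be read off, which is why the axioms
  are transported to data not yet known to satisfy them. The remaining labour is arithmetic of
  positions: composition concatenates, and \<open>juxtapose\<close> and \<open>block_mapping\<close>
  are defined through offsets, so every law is checked at the \<open>k\<close>-th place of the
  \<open>i\<close>-th block.\<close>

text \<open>The quasi-inverse chooses for every \<open>A\<close> an object \<open>S A\<close> with
  an isomorphism \<open>e A\<close> from \<open>A\<close> to its image under \<open>G\<close>. An
  arrow is conjugated with these isomorphisms (\<open>T\<close>) and pulled back along the bijection
  on hom-sets (\<open>L\<close>). Equations in \<open>D\<close> are verified after applying
  \<open>G\<close>, by faithfulness.\<close>

lemma equivalent_categories_if_fully_faithful:
  fixes C :: "('p, 'b, 'z) category_scheme" and D :: "('o, 'a, 'y) category_scheme"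
    and G :: "('o, 'a, 'p, 'b) functor_data"
  assumes C: "category C" and D: "category D" and G: "is_functor D C G"
    and ff: "\<And>X Y. \<lbrakk>X \<in> Obj D; Y \<in> Obj D\<rbrakk>
      \<Longrightarrow> bij_betw (FArr G X Y) (Hom D X Y) (Hom C (FObj G X) (FObj G Y))"
    and es: "\<And>A. A \<in> Obj C \<Longrightarrow> \<exists>X \<in> Obj D. \<exists>f. is_iso C A (FObj G X) f"
  shows "equivalent_categories C D"
proof -
  interpret C: category C by (rule C)
  interpret D: category D by (rule D)
  define g where "g = FObj G"
  have gO [simp]: "X \<in> Obj D \<Longrightarrow> g X \<in> Obj C" for X
    using G by (simp add: is_functor_def g_def)
  have gA [simp]: "FArr G X Y f \<in> Hom C (g X) (g Y)"
    if "X \<in> Obj D" "Y \<in> Obj D" "f \<in> Hom D X Y" for X Y f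
    using G that by (simp add: is_functor_def g_def)
  have gI [simp]: "FArr G X X (Ident D X) = Ident C (g X)" if "X \<in> Obj D" for X
    using G that by (simp add: is_functor_def g_def)
  have gC: "FArr G X Z (Comp D X Y Z k f) = Comp C (g X) (g Y) (g Z) (FArr G Y Z k) (FArr G X Y f)"
    if "X \<in> Obj D" "Y \<in> Obj D" "Z \<in> Obj D" "f \<in> Hom D X Y" "k \<in> Hom D Y Z" for X Y Z f k
    using G that by (simp add: is_functor_def g_def)
  have inj: "f = f'" if "X \<in> Obj D" "Y \<in> Obj D" "f \<in> Hom D X Y" "f' \<in> Hom D X Y"
    "FArr G X Y f = FArr G X Y f'" for X Y f f'
    using ff[OF that(1,2)] that by (meson bij_betw_def inj_onD)
  define L where "L X Y = inv_into (Hom D X Y) (FArr G X Y)" for X Y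
  have L [simp]: "L X Y h \<in> Hom D X Y" "FArr G X Y (L X Y h) = h"
    if "X \<in> Obj D" "Y \<in> Obj D" "h \<in> Hom C (g X) (g Y)" for X Y h
  proof -
    have im: "FArr G X Y ` Hom D X Y = Hom C (g X) (g Y)"
      using ff[OF that(1,2)] by (simp add: bij_betw_def g_def)
    show "L X Y h \<in> Hom D X Y"
      unfolding L_def using that(3) im by (metis inv_into_into)
    show "FArr G X Y (L X Y h) = h"
      unfolding L_def using that(3) im by (metis f_inv_into_f)
  qed
  have "\<forall>A. \<exists>X f f'. A \<in> Obj C \<longrightarrow> X \<in> Obj D \<and> f \<in> Hom C A (g X) \<and> f' \<in> Hom C (g X) A \<and>
      Comp C A (g X) A f' f = Ident C A \<and> Comp C (g X) A (g X) f f' = Ident C (g X)"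
    using es unfolding is_iso_def g_def by blast
  then obtain S e e' where *: "\<And>A. A \<in> Obj C \<Longrightarrow> S A \<in> Obj D \<and> e A \<in> Hom C A (g (S A)) \<and>
      e' A \<in> Hom C (g (S A)) A \<and> Comp C A (g (S A)) A (e' A) (e A) = Ident C A \<and>
      Comp C (g (S A)) A (g (S A)) (e A) (e' A) = Ident C (g (S A))"
    by metis
  note [simp] = *[THEN conjunct1] *[THEN conjunct2, THEN conjunct1]
    *[THEN conjunct2, THEN conjunct2, THEN conjunct1]
    *[THEN conjunct2, THEN conjunct2, THEN conjunct2, THEN conjunct1]
    *[THEN conjunct2, THEN conjunct2, THEN conjunct2, THEN conjunct2]
  note [simp] = C.Ident_closed C.Comp_closed D.Ident_closed D.Comp_closed
    C.Comp_Ident_left C.Comp_Ident_right D.Comp_Ident_left D.Comp_Ident_right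
  define T where "T A B f = Comp C (g (S A)) B (g (S B)) (e B) (Comp C (g (S A)) A B f (e' A))"
    for A B f
  have T [simp]: "T A B f \<in> Hom C (g (S A)) (g (S B))"
    if "A \<in> Obj C" "B \<in> Obj C" "f \<in> Hom C A B" for A B f
    using that by (simp add: T_def)
  \<comment> \<open>This is the naturality square of \<open>e'\<close>. It gives functoriality of
    \<open>F\<close> and the naturality of both isomorphisms below.\<close>
  have e'T: "Comp C (g (S A)) (g (S B)) B (e' B) (T A B f) = Comp C (g (S A)) A B f (e' A)"
    if "A \<in> Obj C" "B \<in> Obj C" "f \<in> Hom C A B" for A B f
    using that
    by (simp add: T_def C.Comp_assoc[of "g (S A)" B "g (S B)" B "Comp C (g (S A)) A B f (e' A)"])
  define F where "F = \<lparr>FObj = S, FArr = (\<lambda>A B f. L (S A) (S B) (T A B f))\<rparr>"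
  have F: "is_functor C D F"
    unfolding is_functor_def
  proof (intro conjI ballI)
    fix A assume A: "A \<in> Obj C"
    show "FObj F A \<in> Obj D" using A by (simp add: F_def)
    have "T A A (Ident C A) = Ident C (g (S A))"
      using A by (simp add: T_def)
    then show "FArr F A A (Ident C A) = Ident D (FObj F A)"
      using A by (auto simp: F_def intro!: inj[of "S A" "S A"])
  next
    fix A B f assume "A \<in> Obj C" "B \<in> Obj C" "f \<in> Hom C A B"
    then show "FArr F A B f \<in> Hom D (FObj F A) (FObj F B)"
      by (simp add: F_def)
  next
    fix A B E f k assume A: "A \<in> Obj C" "B \<in> Obj C" "E \<in> Obj C" "f \<in> Hom C A B" "k \<in> Hom C B E"
    have "Comp C (g (S A)) (g (S B)) (g (S E)) (T B E k) (T A B f) = T A E (Comp C A B E k f)"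
    proof -
      have "Comp C (g (S A)) (g (S B)) (g (S E)) (T B E k) (T A B f)
          = Comp C (g (S A)) E (g (S E)) (e E) (Comp C (g (S A)) (g (S B)) E
              (Comp C (g (S B)) B E k (e' B)) (T A B f))"
        using A unfolding T_def[of B] by (intro C.Comp_assoc[symmetric]) auto
      also have "Comp C (g (S A)) (g (S B)) E (Comp C (g (S B)) B E k (e' B)) (T A B f) =
          Comp C (g (S A)) B E k (Comp C (g (S A)) (g (S B)) B (e' B) (T A B f))"
        using A by (intro C.Comp_assoc[symmetric]) auto
      also have "\<dots> = Comp C (g (S A)) A E (Comp C A B E k f) (e' A)"
        using A by (simp add: e'T C.Comp_assoc[of "g (S A)" A B E])
      finally show ?thesis by (simp add: T_def)
    qed
    then show "FArr F A E (Comp C A B E k f) =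
       Comp D (FObj F A) (FObj F B) (FObj F E) (FArr F B E k) (FArr F A B f)"
      using A by (auto simp: F_def gC intro!: inj[of "S A" "S E"])
  qed
  have n1: "naturally_isomorphic C C (comp_functor G F) id_functor"
    unfolding naturally_isomorphic_def
  proof (intro exI[of _ e'] conjI ballI)
    fix A assume "A \<in> Obj C"
    then show "is_iso C (FObj (comp_functor G F) A) (FObj id_functor A) (e' A)"
      unfolding is_iso_def by (auto simp: comp_functor_def id_functor_def F_def g_def[symmetric]
          intro!: bexI[of _ "e A"])
  next
    fix A B f assume "A \<in> Obj C" "B \<in> Obj C" "f \<in> Hom C A B"
    then show "Comp C (FObj (comp_functor G F) A) (FObj (comp_functor G F) B) (FObj id_functor B) (e' B)
         (FArr (comp_functor G F) A B f) =
        Comp C (FObj (comp_functor G F) A) (FObj id_functor A) (FObj id_functor B)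
         (FArr id_functor A B f) (e' A)"
      by (simp add: comp_functor_def id_functor_def F_def g_def[symmetric] e'T)
  qed
  \<comment> \<open>The component at \<open>X\<close> is the preimage under \<open>G\<close> of the
    chosen isomorphism \<open>e' (g X)\<close>; the preimage of \<open>e (g X)\<close> inverts
    it.\<close>
  have n2: "naturally_isomorphic D D (comp_functor F G) id_functor"
    unfolding naturally_isomorphic_def
  proof (intro exI[of _ "\<lambda>X. L (S (g X)) X (e' (g X))"] conjI ballI)
    fix X assume X: "X \<in> Obj D"
    have 1: "Comp D (S (g X)) X (S (g X)) (L X (S (g X)) (e (g X))) (L (S (g X)) X (e' (g X))) =
        Ident D (S (g X))"
      using X by (auto intro!: inj[of "S (g X)" "S (g X)"] simp: gC)
    have 2: "Comp D X (S (g X)) X (L (S (g X)) X (e' (g X))) (L X (S (g X)) (e (g X))) = Ident D X"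
      using X by (auto intro!: inj[of X X] simp: gC)
    show "is_iso D (FObj (comp_functor F G) X) (FObj id_functor X) (L (S (g X)) X (e' (g X)))"
      using X 1 2 unfolding is_iso_def
      by (auto simp: comp_functor_def id_functor_def F_def g_def[symmetric]
          intro!: bexI[of _ "L X (S (g X)) (e (g X))"])
  next
    fix X Y f assume X: "X \<in> Obj D" "Y \<in> Obj D" "f \<in> Hom D X Y"
    then have "Comp D (S (g X)) (S (g Y)) Y (L (S (g Y)) Y (e' (g Y)))
        (L (S (g X)) (S (g Y)) (T (g X) (g Y) (FArr G X Y f))) =
        Comp D (S (g X)) X Y f (L (S (g X)) X (e' (g X)))"
      by (auto intro!: inj[of "S (g X)" Y] simp: gC e'T)
    then show "Comp D (FObj (comp_functor F G) X) (FObj (comp_functor F G) Y) (FObj id_functor Y)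
         (L (S (g Y)) Y (e' (g Y))) (FArr (comp_functor F G) X Y f) =
        Comp D (FObj (comp_functor F G) X) (FObj id_functor X) (FObj id_functor Y)
         (FArr id_functor X Y f) (L (S (g X)) X (e' (g X)))"
      using X by (simp add: comp_functor_def id_functor_def F_def g_def[symmetric])
  qed
  show ?thesis
    unfolding equivalent_categories_def using C D F G n1 n2 by blast
qed

section \<open>Restricted functor data and the category of preadditive categories\<close>

lemma restrict_functor_eqI:
  assumes "restrict_functor C F = F" "restrict_functor C F' = F'"
    and "\<And>X. X \<in> Obj C \<Longrightarrow> FObj F X = FObj F' X"
    and "\<And>X Y f. \<lbrakk>X \<in> Obj C; Y \<in> Obj C; f \<in> Hom C X Y\<rbrakk> \<Longrightarrow> FArr F X Y f = FArr F' X Y f"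
  shows "F = F'"
proof -
  have "restrict_functor C F = restrict_functor C F'"
    using assms(3,4) by (auto simp: restrict_functor_def restrict_def fun_eq_iff)
  then show ?thesis using assms(1,2) by simp
qed

lemma FObj_restrict_functor [simp]: "X \<in> Obj C \<Longrightarrow> FObj (restrict_functor C F) X = FObj F X"
  by (simp add: restrict_functor_def)

lemma FArr_restrict_functor [simp]:
  "\<lbrakk>X \<in> Obj C; Y \<in> Obj C; f \<in> Hom C X Y\<rbrakk> \<Longrightarrow> FArr (restrict_functor C F) X Y f = FArr F X Y f"
  by (simp add: restrict_functor_def)

lemma restrict_functor_idem [simp]:
  "restrict_functor C (restrict_functor C F) = restrict_functor C F"
  by (auto simp: restrict_functor_def fun_eq_iff)

lemma FObj_id_functor [simp]: "FObj id_functor X = X"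
  and FArr_id_functor [simp]: "FArr id_functor X Y f = f"
  by (simp_all add: id_functor_def)

lemma FObj_comp_functor [simp]: "FObj (comp_functor G F) X = FObj G (FObj F X)"
  and FArr_comp_functor [simp]: "FArr (comp_functor G F) X Y f =
    FArr G (FObj F X) (FObj F Y) (FArr F X Y f)"
  by (simp_all add: comp_functor_def)

lemma MFObj_id_multifunctor [simp]: "MFObj id_multifunctor = (\<lambda>X. X)"
  and MFArr_id_multifunctor [simp]: "MFArr id_multifunctor Xs Y f = f"
  by (simp_all add: id_multifunctor_def)

lemma MFObj_comp_multifunctor [simp]: "MFObj (comp_multifunctor G F) = MFObj G \<circ> MFObj F"
  and MFArr_comp_multifunctor [simp]: "MFArr (comp_multifunctor G F) Xs Y f =
    MFArr G (map (MFObj F) Xs) (MFObj F Y) (MFArr F Xs Y f)"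
  by (simp_all add: comp_multifunctor_def fun_eq_iff)

lemma restrict_multifunctor_idem [simp]:
  "restrict_multifunctor M (restrict_multifunctor M F) = restrict_multifunctor M F"
  by (auto simp: restrict_multifunctor_def fun_eq_iff)

lemma MFObj_restrict_multifunctor [simp]:
  "X \<in> MObj M \<Longrightarrow> MFObj (restrict_multifunctor M F) X = MFObj F X"
  by (simp add: restrict_multifunctor_def)

lemma MFArr_restrict_multifunctor [simp]:
  "\<lbrakk>Xs \<in> lists (MObj M); Y \<in> MObj M; f \<in> MHom M Xs Y\<rbrakk>
    \<Longrightarrow> MFArr (restrict_multifunctor M F) Xs Y f = MFArr F Xs Y f"
  by (simp add: restrict_multifunctor_def)

lemma map_MFObj_restrict_multifunctor [simp]:
  "Xs \<in> lists (MObj M) \<Longrightarrow> map (MFObj (restrict_multifunctor M F)) Xs = map (MFObj F) Xs"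
  by auto

text \<open>Converts the equations between restricted data that express "mutually inverse" into
  equations on objects and arrows, the form in which they are proved and used below.\<close>

lemma restrict_multifunctor_cong_iff:
  "restrict_multifunctor M F = restrict_multifunctor M F' \<longleftrightarrow>
    (\<forall>X \<in> MObj M. MFObj F X = MFObj F' X) \<and>
    (\<forall>Xs \<in> lists (MObj M). \<forall>Y \<in> MObj M. \<forall>f \<in> MHom M Xs Y. MFArr F Xs Y f = MFArr F' Xs Y f)"
  (is "?l \<longleftrightarrow> ?r")
proof
  assume l: ?l
  show ?r
    using MFObj_restrict_multifunctor[of _ M F] MFObj_restrict_multifunctor[of _ M F']
      MFArr_restrict_multifunctor[of _ M _ _ F] MFArr_restrict_multifunctor[of _ M _ _ F']
    unfolding l by auto
next
  assume ?r
  then show ?l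
    by (auto simp: restrict_multifunctor_def restrict_def fun_eq_iff)
qed

lemma restrict_multifunctor_eqI:
  assumes "restrict_multifunctor M F = F" "restrict_multifunctor M F' = F'"
    and "\<And>X. X \<in> MObj M \<Longrightarrow> MFObj F X = MFObj F' X"
    and "\<And>Xs Y f. \<lbrakk>Xs \<in> lists (MObj M); Y \<in> MObj M; f \<in> MHom M Xs Y\<rbrakk>
      \<Longrightarrow> MFArr F Xs Y f = MFArr F' Xs Y f"
  shows "F = F'"
  using assms restrict_multifunctor_cong_iff[of M F F'] by simp

text \<open>Identities, composites, zeros and sums lie in hom-sets, and that is where
  \<open>F\<close> and \<open>F'\<close> are known to agree.\<close>

lemma additive_functor_cong:
  assumes C: "preadditive_category C" and F: "additive_functor C D F"
    and FF': "\<And>X. X \<in> Obj C \<Longrightarrow> FObj F X = FObj F' X"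
      "\<And>X Y f. \<lbrakk>X \<in> Obj C; Y \<in> Obj C; f \<in> Hom C X Y\<rbrakk> \<Longrightarrow> FArr F X Y f = FArr F' X Y f"
  shows "additive_functor C D F'"
proof -
  interpret preadditive_category C by (rule C)
  have "Zero C X Y \<in> Hom C X Y" "\<And>f g. f \<in> Hom C X Y \<Longrightarrow> g \<in> Hom C X Y \<Longrightarrow> Add C X Y f g \<in> Hom C X Y"
    if "X \<in> Obj C" "Y \<in> Obj C" for X Y
    using comm_monoid.axioms(1)[OF comm_monoid_hom[OF that]]
    by (auto simp: hom_monoid_def monoid_def)
  then show ?thesis
    using F by (simp add: additive_functor_def is_functor_def Ident_closed Comp_closed flip: FF')
qed

lemma additive_functor_restrict:
  "preadditive_category C \<Longrightarrow> additive_functor C D F \<Longrightarrow> additive_functor C D (restrict_functor C F)"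
  by (erule additive_functor_cong) auto

lemma additive_functor_id: "additive_functor C C id_functor"
  by (simp add: additive_functor_def is_functor_def)

lemma additive_functor_comp:
  "additive_functor C D F \<Longrightarrow> additive_functor D E G \<Longrightarrow> additive_functor C E (comp_functor G F)"
  by (simp add: additive_functor_def is_functor_def)

lemma category_preAdd: "category preAdd"
proof (unfold_locales, goal_cases)
  case (1 X)
  then show ?case by (simp add: preAdd_def additive_functor_restrict additive_functor_id)
next
  case (2 X Y Z f g)
  then show ?case
    by (simp add: preAdd_def additive_functor_restrict additive_functor_comp[of X Y f Z g])
next
  case (3 X Y f)
  then show ?case
    by - (rule restrict_functor_eqI[of X], simp_all add: preAdd_def additive_functor_def is_functor_def)
next
  case (4 X Y f)
  then show ?case
    by - (rule restrict_functor_eqI[of X], simp_all add: preAdd_def additive_functor_def is_functor_def)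
next
  case (5 W X Y Z f g h)
  then show ?case
    by - (rule restrict_functor_eqI[of W], simp_all add: preAdd_def additive_functor_def is_functor_def)
qed


section \<open>Multifunctors\<close>

lemma length_reindex [simp]: "length (reindex xs \<sigma>) = length \<sigma>"
  by (simp add: reindex_def)

lemma nth_reindex [simp]: "i < length \<sigma> \<Longrightarrow> reindex xs \<sigma> ! i = xs ! (\<sigma> ! i)"
  by (simp add: reindex_def)

lemma is_mapping_nth: "is_mapping m \<sigma> \<Longrightarrow> i < length \<sigma> \<Longrightarrow> \<sigma> ! i < m"
  using nth_mem[of i \<sigma>] by (auto simp: is_mapping_def subset_iff)

lemma reindex_map: "is_mapping (length xs) \<sigma> \<Longrightarrow> reindex (map f xs) \<sigma> = map f (reindex xs \<sigma>)"
  by (auto simp: reindex_def is_mapping_def)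

lemma reindex_in_lists:
  "xs \<in> lists A \<Longrightarrow> is_mapping (length xs) \<sigma> \<Longrightarrow> reindex xs \<sigma> \<in> lists A"
  by (auto simp: reindex_def is_mapping_def in_lists_conv_set subset_iff)

lemma is_mapping_upt: "is_mapping n [0..<n]"
  by (auto simp: is_mapping_def)

lemma is_mapping_reindex:
  "is_mapping m \<rho> \<Longrightarrow> is_mapping (length \<rho>) \<sigma> \<Longrightarrow> is_mapping m (reindex \<rho> \<sigma>)"
  using nth_mem[of _ \<rho>] by (fastforce simp: reindex_def is_mapping_def subset_iff)

lemma nth_in_lists: "xs \<in> lists A \<Longrightarrow> i < length xs \<Longrightarrow> xs ! i \<in> A"
  by (simp add: in_listsD)

text \<open>Names the argument list on the right of the composition law in
  \<open>is_multifunctor\<close>, so that it can be rewritten and placed in \<open>MHoms\<close> as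
  a whole.\<close>

definition map_arrows ::
  "('o, 'm, 'p, 'n) multifunctor_data \<Rightarrow> 'o list list \<Rightarrow> 'o list \<Rightarrow> 'm list \<Rightarrow> 'n list" where
  "map_arrows F \<Gamma>s As fs = map (\<lambda>i. MFArr F (\<Gamma>s ! i) (As ! i) (fs ! i)) [0..<length As]"

lemma length_map_arrows [simp]: "length (map_arrows F \<Gamma>s As fs) = length As"
  by (simp add: map_arrows_def)

lemma nth_map_arrows [simp]:
  "i < length As \<Longrightarrow> map_arrows F \<Gamma>s As fs ! i = MFArr F (\<Gamma>s ! i) (As ! i) (fs ! i)"
  by (simp add: map_arrows_def)

context
  fixes M :: "('o, 'm, 'y) multicategory_scheme" and N :: "('p, 'n, 'z) multicategory_scheme"
    and F :: "('o, 'm, 'p, 'n) multifunctor_data"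
  assumes F: "is_multifunctor M N F"
begin

lemma MFObj_closed: "A \<in> MObj M \<Longrightarrow> MFObj F A \<in> MObj N"
  using F by (simp add: is_multifunctor_def)

lemma MFObj_lists_closed: "As \<in> lists (MObj M) \<Longrightarrow> map (MFObj F) As \<in> lists (MObj N)"
  using MFObj_closed by auto

lemma MFObj_lists_lists_closed:
  "\<Gamma>s \<in> lists (lists (MObj M)) \<Longrightarrow> map (map (MFObj F)) \<Gamma>s \<in> lists (lists (MObj N))"
  using MFObj_lists_closed by (auto simp: in_lists_conv_set[of _ "lists A" for A])

lemma MFArr_closed:
  "\<lbrakk>As \<in> lists (MObj M); B \<in> MObj M; f \<in> MHom M As B\<rbrakk>
    \<Longrightarrow> MFArr F As B f \<in> MHom N (map (MFObj F) As) (MFObj F B)"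
  using F by (simp add: is_multifunctor_def)

lemma MFArr_MIdent: "A \<in> MObj M \<Longrightarrow> MFArr F [A] A (MIdent M A) = MIdent N (MFObj F A)"
  using F by (simp add: is_multifunctor_def)

lemma MFArr_MComp:
  "\<lbrakk>\<Gamma>s \<in> lists (lists (MObj M)); As \<in> lists (MObj M); B \<in> MObj M;
    f \<in> MHom M As B; fs \<in> MHoms M \<Gamma>s As\<rbrakk>
    \<Longrightarrow> MFArr F (concat \<Gamma>s) B (MComp M \<Gamma>s As B f fs) =
      MComp N (map (map (MFObj F)) \<Gamma>s) (map (MFObj F) As) (MFObj F B) (MFArr F As B f)
        (map_arrows F \<Gamma>s As fs)"
  using F by (simp add: is_multifunctor_def map_arrows_def)

lemma map_arrows_closed:
  assumes "\<Gamma>s \<in> lists (lists (MObj M))" "As \<in> lists (MObj M)" "fs \<in> MHoms M \<Gamma>s As"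
  shows "map_arrows F \<Gamma>s As fs \<in> MHoms N (map (map (MFObj F)) \<Gamma>s) (map (MFObj F) As)"
  using assms by (auto simp: MHoms_def intro!: MFArr_closed dest: nth_in_lists)

end

lemma is_multifunctorI:
  assumes "\<And>A. A \<in> MObj M \<Longrightarrow> MFObj F A \<in> MObj N"
    and "\<And>As B f. \<lbrakk>As \<in> lists (MObj M); B \<in> MObj M; f \<in> MHom M As B\<rbrakk>
      \<Longrightarrow> MFArr F As B f \<in> MHom N (map (MFObj F) As) (MFObj F B)"
    and "\<And>A. A \<in> MObj M \<Longrightarrow> MFArr F [A] A (MIdent M A) = MIdent N (MFObj F A)"
    and "\<And>\<Gamma>s As B f fs. \<lbrakk>\<Gamma>s \<in> lists (lists (MObj M)); As \<in> lists (MObj M); B \<in> MObj M;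
        f \<in> MHom M As B; fs \<in> MHoms M \<Gamma>s As\<rbrakk>
      \<Longrightarrow> MFArr F (concat \<Gamma>s) B (MComp M \<Gamma>s As B f fs) =
        MComp N (map (map (MFObj F)) \<Gamma>s) (map (MFObj F) As) (MFObj F B) (MFArr F As B f)
          (map_arrows F \<Gamma>s As fs)"
  shows "is_multifunctor M N F"
  using assms by (simp add: is_multifunctor_def map_arrows_def)

lemma is_multifunctor_cong:
  assumes M: "multicategory M" and F: "is_multifunctor M N F"
    and FF': "\<And>X. X \<in> MObj M \<Longrightarrow> MFObj F' X = MFObj F X"
      "\<And>Xs Y f. \<lbrakk>Xs \<in> lists (MObj M); Y \<in> MObj M; f \<in> MHom M Xs Y\<rbrakk>
        \<Longrightarrow> MFArr F' Xs Y f = MFArr F Xs Y f"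
  shows "is_multifunctor M N F'"
proof -
  interpret multicategory M by (rule M)
  have m: "map (MFObj F') As = map (MFObj F) As" if "As \<in> lists (MObj M)" for As
    using that FF'(1) by auto
  have mm: "map (map (MFObj F')) \<Gamma>s = map (map (MFObj F)) \<Gamma>s"
    if "\<Gamma>s \<in> lists (lists (MObj M))" for \<Gamma>s
    using that m by auto
  have ma: "map_arrows F' \<Gamma>s As fs = map_arrows F \<Gamma>s As fs"
    if "\<Gamma>s \<in> lists (lists (MObj M))" "As \<in> lists (MObj M)" "fs \<in> MHoms M \<Gamma>s As" for \<Gamma>s As fs
    using that by (auto simp: map_arrows_def MHoms_def intro!: FF' dest: nth_in_lists)
  have cl: "concat \<Gamma>s \<in> lists (MObj M)" if "\<Gamma>s \<in> lists (lists (MObj M))" for \<Gamma>s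
    using that by (auto simp: in_lists_conv_set)
  show ?thesis
  proof (rule is_multifunctorI, goal_cases)
    case (1 A)
    then show ?case using MFObj_closed[OF F] by (simp add: FF')
  next
    case (2 As B f)
    then show ?case using MFArr_closed[OF F 2] by (simp add: FF' m[OF 2(1)])
  next
    case (3 A)
    then show ?case using MFArr_MIdent[OF F 3] by (simp add: FF' MIdent_closed)
  next
    case (4 \<Gamma>s As B f fs)
    then show ?case
      using MFArr_MComp[OF F 4] MComp_closed[OF 4]
      by (simp add: FF'(1) FF'(2)[OF cl[OF 4(1)]] FF'(2)[OF 4(2)] m[OF 4(2)] mm[OF 4(1)] ma[OF 4(1,2,5)])
  qed
qed

lemma is_multifunctor_comp:
  assumes F: "is_multifunctor M N F" and G: "is_multifunctor N P G"
  shows "is_multifunctor M P (comp_multifunctor G F)"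
proof (rule is_multifunctorI, goal_cases)
  case (1 A)
  then show ?case by (simp add: MFObj_closed[OF F] MFObj_closed[OF G])
next
  case (2 As B f)
  have "map (MFObj (comp_multifunctor G F)) As = map (MFObj G) (map (MFObj F) As)"
    by simp
  then show ?case
    using MFArr_closed[OF G MFObj_lists_closed[OF F 2(1)] MFObj_closed[OF F 2(2)] MFArr_closed[OF F 2]]
    by simp
next
  case (3 A)
  then show ?case
    by (simp add: MFArr_MIdent[OF F] MFArr_MIdent[OF G] MFObj_closed[OF F])
next
  case (4 \<Gamma>s As B f fs)
  have ma: "map_arrows (comp_multifunctor G F) \<Gamma>s As fs =
      map_arrows G (map (map (MFObj F)) \<Gamma>s) (map (MFObj F) As) (map_arrows F \<Gamma>s As fs)"
    using 4 by (auto simp: map_arrows_def MHoms_def)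
  have mm: "map (map (MFObj (comp_multifunctor G F))) \<Gamma>s = map (map (MFObj G)) (map (map (MFObj F)) \<Gamma>s)"
    and m: "map (MFObj (comp_multifunctor G F)) As = map (MFObj G) (map (MFObj F) As)"
    by simp_all
  show ?case
    using MFArr_MComp[OF G MFObj_lists_lists_closed[OF F 4(1)] MFObj_lists_closed[OF F 4(2)]
        MFObj_closed[OF F 4(3)] MFArr_closed[OF F 4(2-4)] map_arrows_closed[OF F 4(1,2,5)]]
    unfolding ma mm m by (simp add: MFArr_MComp[OF F 4] map_concat)
qed

lemma is_multifunctor_id: "is_multifunctor M M id_multifunctor"
proof (rule is_multifunctorI, goal_cases)
  case (4 \<Gamma>s As B f fs)
  then have "map_arrows id_multifunctor \<Gamma>s As fs = fs"
    by (auto simp: map_arrows_def MHoms_def intro!: nth_equalityI)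
  then show ?case by (simp cong: map_cong)
qed auto

lemma cartesian_multifunctorD:
  assumes "cartesian_multifunctor M N F"
  shows "is_multifunctor M N F"
    and "\<lbrakk>Bs \<in> lists (MObj M); D \<in> MObj M; is_mapping (length Bs) \<sigma>; f \<in> MHom M (reindex Bs \<sigma>) D\<rbrakk>
      \<Longrightarrow> MFArr F Bs D (Act M Bs D \<sigma> f) =
          Act N (map (MFObj F) Bs) (MFObj F D) \<sigma> (MFArr F (reindex Bs \<sigma>) D f)"
  using assms by (auto simp: cartesian_multifunctor_def)

lemma cartesian_multifunctor_cong:
  assumes M: "cartesian_multicategory M" and F: "cartesian_multifunctor M N F"
    and FF': "\<And>X. X \<in> MObj M \<Longrightarrow> MFObj F' X = MFObj F X"
      "\<And>Xs Y f. \<lbrakk>Xs \<in> lists (MObj M); Y \<in> MObj M; f \<in> MHom M Xs Y\<rbrakk>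
        \<Longrightarrow> MFArr F' Xs Y f = MFArr F Xs Y f"
  shows "cartesian_multifunctor M N F'"
proof -
  interpret cartesian_multicategory M by (rule M)
  have m: "map (MFObj F') As = map (MFObj F) As" if "As \<in> lists (MObj M)" for As
    using that FF'(1) by auto
  note F' = cartesian_multifunctorD[OF F]
  have "MFArr F' Bs D (Act M Bs D \<sigma> f) =
      Act N (map (MFObj F') Bs) (MFObj F' D) \<sigma> (MFArr F' (reindex Bs \<sigma>) D f)"
    if *: "Bs \<in> lists (MObj M)" "D \<in> MObj M" "is_mapping (length Bs) \<sigma>"
      "f \<in> MHom M (reindex Bs \<sigma>) D" for Bs D \<sigma> f
    using F'(2)[OF *] Act_closed[OF *] 
    by (simp add: m[OF *(1)] FF'(1)[OF *(2)] FF'(2)[OF *(1,2)] FF'(2)[OF reindex_in_lists[OF *(1,3)] *(2,4)])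
  moreover have "is_multifunctor M N F'"
    by (rule is_multifunctor_cong[OF multicategory_axioms F'(1) FF'])
  ultimately show ?thesis
    by (simp add: cartesian_multifunctor_def)
qed

lemma cartesian_multifunctor_id: "cartesian_multifunctor M M id_multifunctor"
  by (auto simp: cartesian_multifunctor_def is_multifunctor_id)

lemma cartesian_multifunctor_comp:
  assumes F: "cartesian_multifunctor M N F" and G: "cartesian_multifunctor N P G"
  shows "cartesian_multifunctor M P (comp_multifunctor G F)"
proof -
  note F = cartesian_multifunctorD[OF F] and G = cartesian_multifunctorD[OF G]
  have "MFArr (comp_multifunctor G F) Bs D (Act M Bs D \<sigma> f) =
      Act P (map (MFObj (comp_multifunctor G F)) Bs) (MFObj (comp_multifunctor G F) D) \<sigma>
        (MFArr (comp_multifunctor G F) (reindex Bs \<sigma>) D f)"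
    if *: "Bs \<in> lists (MObj M)" "D \<in> MObj M" "is_mapping (length Bs) \<sigma>"
      "f \<in> MHom M (reindex Bs \<sigma>) D" for Bs D \<sigma> f
  proof -
    have m: "map (MFObj (comp_multifunctor G F)) Bs = map (MFObj G) (map (MFObj F) Bs)"
      by simp
    have "is_mapping (length (map (MFObj F) Bs)) \<sigma>"
      "MFArr F (reindex Bs \<sigma>) D f \<in> MHom N (reindex (map (MFObj F) Bs) \<sigma>) (MFObj F D)"
      using * MFArr_closed[OF F(1) reindex_in_lists[OF *(1,3)] *(2,4)] by (simp_all add: reindex_map)
    from G(2)[OF MFObj_lists_closed[OF F(1) *(1)] MFObj_closed[OF F(1) *(2)] this]
    show ?thesis using * unfolding m by (simp add: F(2) reindex_map)
  qed
  then show ?thesis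
    using is_multifunctor_comp[OF F(1) G(1)] by (simp add: cartesian_multifunctor_def)
qed

lemma cartesian_multifunctor_restrict:
  "cartesian_multicategory M \<Longrightarrow> cartesian_multifunctor M N F
    \<Longrightarrow> cartesian_multifunctor M N (restrict_multifunctor M F)"
  by (erule (1) cartesian_multifunctor_cong) auto

lemma category_fpMlt: "category fpMlt"
proof (unfold_locales, goal_cases)
  case (1 X)
  then show ?case
    by (simp add: fpMlt_def cartesian_multifunctor_restrict cartesian_multifunctor_id)
next
  case (2 X Y Z f g)
  then show ?case
    by (simp add: fpMlt_def cartesian_multifunctor_restrict cartesian_multifunctor_comp[of X Y f Z g])
next
  case (3 X Y f)
  \<comment> \<open>The identity of \<open>Y\<close> is \<open>undefined\<close> outside
    \<open>Y\<close>, so the left unit law depends on the values of \<open>f\<close> lying in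
    \<open>Y\<close>.\<close>
  then have f: "is_multifunctor X Y f"
    by (simp add: fpMlt_def cartesian_multifunctor_def)
  from 3 show ?case
    by - (rule restrict_multifunctor_eqI[of X],
        simp_all add: fpMlt_def MFObj_closed[OF f] MFObj_lists_closed[OF f] MFArr_closed[OF f])
next
  case (4 X Y f)
  then show ?case
    by - (rule restrict_multifunctor_eqI[of X], simp_all add: fpMlt_def cong: map_cong)
next
  case (5 W X Y Z f g h)
  then have f: "is_multifunctor W X f" and g: "is_multifunctor X Y g"
    by (simp_all add: fpMlt_def cartesian_multifunctor_def)
  from 5 show ?case
    by - (rule restrict_multifunctor_eqI[of W],
        simp_all add: fpMlt_def MFObj_closed[OF f] MFObj_lists_closed[OF f] MFArr_closed[OF f])
qed

lemma category_full_subcategory: "category C \<Longrightarrow> category (full_subcategory C P)"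
  unfolding category_def full_subcategory_def by simp

lemma category_fpSeq: "category fpSeq"
  by (simp add: fpSeq_def category_full_subcategory category_fpMlt)


section \<open>Blocks of concatenated lists\<close>

text \<open>With block lengths \<open>ns\<close>, the \<open>k\<close>-th place of block
  \<open>i\<close> has position \<open>sum_list (take i ns) + k\<close>. Together with
  \<open>offset_exhaust\<close> and \<open>offset_unique\<close> this makes pairs of block and place
  correspond bijectively to positions below \<open>sum_list ns\<close>.\<close>

lemma offset_less: "i < length ns \<Longrightarrow> k < ns ! i \<Longrightarrow> sum_list (take i ns) + k < sum_list (ns :: nat list)"
proof (induction ns arbitrary: i)
  case (Cons n ns)
  then show ?case by (cases i) (auto simp: add.assoc)
qed simp

lemma offset_exhaust:
  assumes "p < sum_list (ns :: nat list)"
  obtains i k where "i < length ns" "k < ns ! i" "p = sum_list (take i ns) + k"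
  using assms
proof (induction ns arbitrary: p thesis)
  case (Cons n ns)
  show ?case
  proof (cases "p < n")
    case True
    then show ?thesis using Cons.prems(1)[of 0 p] by simp
  next
    case False
    then have "p - n < sum_list ns"
      using Cons.prems(2) by simp
    then obtain i k where "i < length ns" "k < ns ! i" "p - n = sum_list (take i ns) + k"
      by (blast intro: Cons.IH)
    then show ?thesis using Cons.prems(1)[of "Suc i" k] False by simp
  qed
qed simp

lemma offset_unique:
  assumes "sum_list (take i ns) + k = sum_list (take i' ns) + (k' :: nat)"
    "i < length ns" "k < ns ! i" "i' < length ns" "k' < ns ! i'"
  shows "i = i'" "k = k'"
proof -
  have "i = i' \<and> k = k'"
    using assms
  proof (induction ns arbitrary: i i')
    case (Cons n ns)
    show ?case
    proof (cases i; cases i')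
      fix j j' assume j: "i = Suc j" "i' = Suc j'"
      then have "j = j' \<and> k = k'" using Cons.prems by (intro Cons.IH) auto
      then show ?thesis using j by simp
    qed (use Cons.prems in auto)
  qed simp
  then show "i = i'" "k = k'" by simp_all
qed

lemma nth_concat_offset:
  assumes "ns = map length xss" "i < length xss" "k < length (xss ! i)"
  shows "concat xss ! (sum_list (take i ns) + k) = xss ! i ! k"
  using assms(2,3) unfolding assms(1)
proof (induction xss arbitrary: i)
  case (Cons xs xss)
  then show ?case by (cases i) (auto simp: nth_append add.assoc)
qed simp

text \<open>Counts the entries that precede the \<open>j\<close>-th list of the \<open>i\<close>-th
  group in two ways: through the flattened list of lengths, and through the group totals followed by
  the lists inside the group. Associativity of composition compares exactly these two
  countings.\<close>

lemma offset_concat: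
  assumes "i < length nss" "j \<le> length (nss ! i)"
  shows "sum_list (take (sum_list (take i (map length nss)) + j) (concat nss)) =
    sum_list (take i (map sum_list nss)) + (sum_list (take j (nss ! i)) :: nat)"
  using assms
proof (induction nss arbitrary: i)
  case (Cons ns nss)
  then show ?case by (cases i) (auto simp: add.assoc)
qed simp

lemma eq_if_blocks_eq:
  assumes "length xs = sum_list ns" "length ys = sum_list ns"
    and "\<And>i k. \<lbrakk>i < length ns; k < ns ! i\<rbrakk>
      \<Longrightarrow> xs ! (sum_list (take i ns) + k) = ys ! (sum_list (take i ns) + k)"
  shows "xs = ys"
proof (rule nth_equalityI)
  fix p assume "p < length xs"
  then obtain i k where "i < length ns" "k < ns ! i" "p = sum_list (take i ns) + k"
    using assms(1) by (auto elim: offset_exhaust)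
  then show "xs ! p = ys ! p" using assms(3) by simp
qed (simp add: assms)

lemma map_nth_upt: "n = length xs \<Longrightarrow> map (\<lambda>i. g (xs ! i)) [0..<n] = map g xs"
  by (auto intro: nth_equalityI)


section \<open>The multicategory of lists of arrows\<close>

lemma MObj_seq [simp]: "MObj (seq_multicategory C) = Obj C"
  by (simp add: seq_multicategory_def)

lemma MHom_seq: "MHom (seq_multicategory C) Xs X =
    {fs. length fs = length Xs \<and> (\<forall>i < length Xs. fs ! i \<in> Hom C (Xs ! i) X)}"
  by (simp add: seq_multicategory_def)

lemma MIdent_seq [simp]: "MIdent (seq_multicategory C) X = [Ident C X]"
  by (simp add: seq_multicategory_def)

lemma MHoms_seq: "gss \<in> MHoms (seq_multicategory C) \<Gamma>s As \<longleftrightarrow>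
    length \<Gamma>s = length As \<and> length gss = length As \<and> (\<forall>i < length As. length (gss ! i) = length (\<Gamma>s ! i) \<and>
      (\<forall>j < length (\<Gamma>s ! i). gss ! i ! j \<in> Hom C (\<Gamma>s ! i ! j) (As ! i)))"
  by (auto simp: MHoms_def MHom_seq)

lemma length_MComp_seq:
  assumes "length \<Gamma>s = length Xs"
  shows "length (MComp (seq_multicategory C) \<Gamma>s Xs X fs gss) = sum_list (map length \<Gamma>s)"
  using assms by (simp add: seq_multicategory_def length_concat comp_def map_nth_upt)

text \<open>The block lengths enter as a variable \<open>ns\<close>, so that the rule also applies
  where they appear as another expression equal to \<open>map length \<Gamma>s\<close>.\<close>

lemma nth_MComp_seq:
  assumes "length \<Gamma>s = length Xs" "ns = map length \<Gamma>s" "i < length Xs" "j < length (\<Gamma>s ! i)"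
  shows "MComp (seq_multicategory C) \<Gamma>s Xs X fs gss ! (sum_list (take i ns) + j) =
    Comp C (\<Gamma>s ! i ! j) (Xs ! i) X (fs ! i) (gss ! i ! j)"
proof -
  have "ns = map length (map (\<lambda>i. map (\<lambda>j. Comp C (\<Gamma>s ! i ! j) (Xs ! i) X (fs ! i) (gss ! i ! j))
      [0..<length (\<Gamma>s ! i)]) [0..<length Xs])"
    using assms(1,2) by (simp add: comp_def map_nth_upt)
  from nth_concat_offset[OF this, of i j] show ?thesis
    using assms by (simp add: seq_multicategory_def)
qed

text \<open>Each entry of a composite is a single composite in \<open>C\<close>, so the laws reduce
  entry by entry to those of \<open>C\<close>; what remains is to see that both sides of
  associativity put the same entry at the same position.\<close>

lemma multicategory_seq:
  assumes "category C"
  shows "multicategory (seq_multicategory C)" (is "multicategory ?M")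
proof -
  interpret category C by (rule assms)
  show ?thesis
  proof (unfold_locales, goal_cases)
    case (1 A)
    then show ?case by (simp add: MHom_seq Ident_closed)
  next
    case (2 \<Gamma>s As B f fs)
    then have l: "length \<Gamma>s = length As" by (simp add: MHoms_seq)
    have "MComp ?M \<Gamma>s As B f fs ! p \<in> Hom C (concat \<Gamma>s ! p) B"
      if "p < sum_list (map length \<Gamma>s)" for p
    proof -
      from that obtain i k where ik: "i < length \<Gamma>s" "k < length (\<Gamma>s ! i)"
        "p = sum_list (take i (map length \<Gamma>s)) + k"
        by (auto elim: offset_exhaust)
      moreover have "\<Gamma>s ! i ! k \<in> Obj C" "As ! i \<in> Obj C"
        using 2 ik l by (auto intro!: nth_in_lists)
      ultimately show ?thesis
        using 2 l by (simp add: nth_MComp_seq nth_concat_offset MHom_seq MHoms_seq Comp_closed)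
    qed
    then show ?case
      using l by (simp add: MHom_seq length_MComp_seq length_concat)
  next
    case (3 As B f)
    then show ?case
      by (auto simp: MHom_seq seq_multicategory_def Comp_Ident_left nth_in_lists intro!: nth_equalityI)
  next
    case (4 As B f)
    have "concat (map (\<lambda>i. map (h i) [0..<length (map (\<lambda>A. [A]) As ! i)]) [0..<length As]) =
        map (\<lambda>i. h i 0) [0..<length As]" for h :: "nat \<Rightarrow> nat \<Rightarrow> 'b"
    proof -
      have "map (\<lambda>i. map (h i) [0..<length (map (\<lambda>A. [A]) As ! i)]) [0..<length As] =
          map (\<lambda>i. [h i 0]) [0..<length As]"
        by simp
      then show ?thesis
        by (simp only: concat_map_singleton)
    qed
    with 4 show ?case
      by (auto simp: MHom_seq seq_multicategory_def Comp_Ident_right nth_in_lists intro!: nth_equalityI)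
  next
    case (5 \<Gamma>ss Ass Bs D gss f fs)
    have l: "length \<Gamma>ss = length Bs" "length Ass = length Bs" "length fs = length Bs"
      "length gss = length Bs" "length f = length Bs"
      using 5 by (simp_all add: MHoms_seq MHom_seq)
    have li: "length (\<Gamma>ss ! i) = length (Ass ! i)" "length (gss ! i) = length (Ass ! i)"
        "length (fs ! i) = length (Ass ! i)" if "i < length Bs" for i
      using 5 that by (auto simp: MHoms_seq)
    have lij: "length (gss ! i ! j) = length (\<Gamma>ss ! i ! j)"
      if "i < length Bs" "j < length (Ass ! i)" for i j
      using 5(9)[OF that(1)] that by (auto simp: MHoms_seq)
    have mA: "map length Ass = map length \<Gamma>ss" "map length gss = map length \<Gamma>ss"
        "map length fs = map length Ass"
      using l li by (auto intro!: nth_equalityI)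
    have lc: "length (concat Ass) = length (concat \<Gamma>ss)"
      unfolding length_concat mA ..
    define ns where "ns = map length (map concat \<Gamma>ss)"
    have ns: "ns = map sum_list (map (map length) \<Gamma>ss)"
      by (simp add: ns_def length_concat)
    have "concat (map concat \<Gamma>ss) = concat (concat \<Gamma>ss)"
      by (induction \<Gamma>ss) auto
    then have sums: "sum_list ns = length (concat (concat \<Gamma>ss))"
      by (simp only: ns_def length_concat[symmetric])
    show ?case
    proof (rule eq_if_blocks_eq[of _ ns])
      fix i q assume i: "i < length ns" and q: "q < ns ! i"
      then have i': "i < length Bs" using l by (simp add: ns_def)
      from q i have "q < sum_list (map length (\<Gamma>ss ! i))" by (simp add: ns)
      then obtain j k where j: "j < length (\<Gamma>ss ! i)" "k < length (\<Gamma>ss ! i ! j)"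
        "q = sum_list (take j (map length (\<Gamma>ss ! i))) + k"
        by (auto elim: offset_exhaust)
      \<comment> \<open>The position of the \<open>j\<close>-th list of group \<open>i\<close> once
        the groups are flattened.\<close>
      define p where "p = sum_list (take i (map length \<Gamma>ss)) + j"
      have p: "p < length (concat \<Gamma>ss)" unfolding p_def length_concat
        using i' j l by (intro offset_less) auto
      have pp: "concat \<Gamma>ss ! p = \<Gamma>ss ! i ! j" "concat Ass ! p = Ass ! i ! j" "concat gss ! p = gss ! i ! j"
        unfolding p_def using i' j l li mA by (simp_all add: nth_concat_offset)
      \<comment> \<open>The left composite has the blocks \<open>concat (\<Gamma>ss ! i)\<close>,
        the right one the lists of \<open>concat \<Gamma>ss\<close>; the entry is at the same
        position for both divisions.\<close>
      have off: "sum_list (take i ns) + q = sum_list (take p (map length (concat \<Gamma>ss))) + k"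
        using offset_concat[of i "map (map length) \<Gamma>ss" j] i' j l
        by (simp add: ns p_def map_concat comp_def take_map)
      have "\<Gamma>ss ! i \<in> lists (lists (Obj C))" "Ass ! i \<in> lists (Obj C)"
        using 5(1,2) i' l by (simp_all only: nth_in_lists MObj_seq)
      moreover from this(1) j have "\<Gamma>ss ! i ! j \<in> lists (Obj C)"
        by (simp only: nth_in_lists)
      ultimately have obj: "\<Gamma>ss ! i ! j ! k \<in> Obj C" "Ass ! i ! j \<in> Obj C" "Bs ! i \<in> Obj C" "D \<in> Obj C"
        using 5(3,4) i' j li by (simp_all add: nth_in_lists)
      have arr: "gss ! i ! j ! k \<in> Hom C (\<Gamma>ss ! i ! j ! k) (Ass ! i ! j)"
        "fs ! i ! j \<in> Hom C (Ass ! i ! j) (Bs ! i)" "f ! i \<in> Hom C (Bs ! i) D"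
        using 5(7,8) 5(9)[OF i'] i' j li by (auto simp: MHoms_seq MHom_seq)
      show "MComp ?M (map concat \<Gamma>ss) Bs D f
           (map (\<lambda>i. MComp ?M (\<Gamma>ss ! i) (Ass ! i) (Bs ! i) (fs ! i) (gss ! i)) [0..<length Bs]) !
          (sum_list (take i ns) + q) =
         MComp ?M (concat \<Gamma>ss) (concat Ass) D (MComp ?M Ass Bs D f fs) (concat gss) !
          (sum_list (take i ns) + q)" (is "?l ! _ = ?r ! _")
      proof -
        have "?l ! (sum_list (take i ns) + q) =
            Comp C (\<Gamma>ss ! i ! j ! k) (Bs ! i) D (f ! i)
              (Comp C (\<Gamma>ss ! i ! j ! k) (Ass ! i ! j) (Bs ! i) (fs ! i ! j) (gss ! i ! j ! k))"
          using i i' q j l li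
          by (simp add: nth_MComp_seq[OF _ ns_def] ns_def nth_MComp_seq nth_concat_offset)
        also have "\<dots> = Comp C (\<Gamma>ss ! i ! j ! k) (Ass ! i ! j) D
            (Comp C (Ass ! i ! j) (Bs ! i) D (f ! i) (fs ! i ! j)) (gss ! i ! j ! k)"
          using obj arr by (intro Comp_assoc) auto
        also have "\<dots> = ?r ! (sum_list (take p (map length (concat \<Gamma>ss))) + k)"
          using i' j l li p pp lc
            nth_MComp_seq[of Ass Bs "map length \<Gamma>ss" i j C D f fs, folded p_def]
          by (simp add: nth_MComp_seq mA)
        finally show ?thesis by (simp only: off)
      qed
    qed (use l lc sums in \<open>simp_all add: length_MComp_seq ns_def length_concat\<close>)
  qed
qed


section \<open>The cartesian structure given by addition\<close>

text \<open>For monoids, membership in \<open>hom\<close> does not include preservation of the unit,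
  hence the separate hypothesis; it settles the empty product.\<close>

lemma hom_finprod:
  assumes "comm_monoid G" "comm_monoid H" "h \<in> hom G H" "h \<one>\<^bsub>G\<^esub> = \<one>\<^bsub>H\<^esub>"
    and "finite A" "f \<in> A \<rightarrow> carrier G"
  shows "h (finprod G f A) = finprod H (\<lambda>i. h (f i)) A"
proof -
  interpret G: comm_monoid G by (rule assms)
  interpret H: comm_monoid H by (rule assms)
  show ?thesis
    using assms(5,6)
  proof (induction A rule: finite_induct)
    case (insert a A)
    moreover have "(\<lambda>i. h (f i)) \<in> A \<rightarrow> carrier H" "h (f a) \<in> carrier H"
      using insert.prems assms(3) by (auto simp: hom_def)
    ultimately show ?case
      using assms(3) by (simp add: hom_mult Pi_iff)
  qed (simp add: assms)
qed

lemma carrier_hom_monoid [simp]: "carrier (hom_monoid C X Y) = Hom C X Y"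
  and mult_hom_monoid [simp]: "x \<otimes>\<^bsub>hom_monoid C X Y\<^esub> y = Add C X Y x y"
  and one_hom_monoid [simp]: "\<one>\<^bsub>hom_monoid C X Y\<^esub> = Zero C X Y"
  by (simp_all add: hom_monoid_def)

context preadditive_category
begin

lemma sum_closed:
  assumes "X \<in> Obj C" "Y \<in> Obj C" "\<And>i. i \<in> A \<Longrightarrow> f i \<in> Hom C X Y"
  shows "finprod (hom_monoid C X Y) f A \<in> Hom C X Y"
  using comm_monoid.finprod_closed[OF comm_monoid_hom[OF assms(1,2)], of f A] assms(3) by auto

lemma sum_cong:
  assumes "X \<in> Obj C" "Y \<in> Obj C" "\<And>i. i \<in> A \<Longrightarrow> g i \<in> Hom C X Y" "\<And>i. i \<in> A \<Longrightarrow> f i = g i"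
    and "A = B"
  shows "finprod (hom_monoid C X Y) f A = finprod (hom_monoid C X Y) g B"
  using comm_monoid.finprod_cong'[OF comm_monoid_hom[OF assms(1,2)], of A B g f] assms(3-) by auto

lemma Comp_sum_right:
  assumes "X \<in> Obj C" "Y \<in> Obj C" "Z \<in> Obj C" "g \<in> Hom C Y Z" "finite A"
    "\<And>i. i \<in> A \<Longrightarrow> f i \<in> Hom C X Y"
  shows "Comp C X Y Z g (finprod (hom_monoid C X Y) f A) =
    finprod (hom_monoid C X Z) (\<lambda>i. Comp C X Y Z g (f i)) A"
  using assms by (intro hom_finprod)
    (auto simp: comm_monoid_hom hom_def Comp_closed Comp_Add_right Comp_Zero_right)

lemma Comp_sum_left:
  assumes "X \<in> Obj C" "Y \<in> Obj C" "Z \<in> Obj C" "g \<in> Hom C X Y" "finite A"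
    "\<And>i. i \<in> A \<Longrightarrow> f i \<in> Hom C Y Z"
  shows "Comp C X Y Z (finprod (hom_monoid C Y Z) f A) g =
    finprod (hom_monoid C X Z) (\<lambda>i. Comp C X Y Z (f i) g) A"
  using assms by (intro hom_finprod[of _ _ "\<lambda>f. Comp C X Y Z f g"])
    (auto simp: comm_monoid_hom hom_def Comp_closed Comp_Add_left Comp_Zero_left)

lemma sum_singleton:
  assumes "X \<in> Obj C" "Y \<in> Obj C" "f i \<in> Hom C X Y"
  shows "finprod (hom_monoid C X Y) f {i} = f i"
proof -
  interpret comm_monoid "hom_monoid C X Y" by (rule comm_monoid_hom[OF assms(1,2)])
  show ?thesis using finprod_insert[of "{}" i f] r_one[of "f i"] assms(3) by simp
qed

lemma sum_reindex:
  assumes "X \<in> Obj C" "Y \<in> Obj C" "inj_on h A" "\<And>i. i \<in> A \<Longrightarrow> f (h i) \<in> Hom C X Y"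
  shows "finprod (hom_monoid C X Y) f (h ` A) = finprod (hom_monoid C X Y) (\<lambda>i. f (h i)) A"
  using comm_monoid.finprod_reindex[OF comm_monoid_hom[OF assms(1,2)] _ assms(3), of f] assms(4)
  by auto

lemma sum_UN:
  assumes "X \<in> Obj C" "Y \<in> Obj C" "finite I" "\<And>i. i \<in> I \<Longrightarrow> finite (A i)"
    "\<And>i j. i \<in> I \<Longrightarrow> j \<in> I \<Longrightarrow> i \<noteq> j \<Longrightarrow> A i \<inter> A j = {}"
    "\<And>i x. i \<in> I \<Longrightarrow> x \<in> A i \<Longrightarrow> f x \<in> Hom C X Y"
  shows "finprod (hom_monoid C X Y) f (\<Union>(A ` I)) =
    finprod (hom_monoid C X Y) (\<lambda>i. finprod (hom_monoid C X Y) f (A i)) I"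
  using comm_monoid.finprod_UN_disjoint[OF comm_monoid_hom[OF assms(1,2)], of I A f] assms(3-)
  by (auto simp: pairwise_def disjnt_def Pi_iff)

end

definition with_action ::
  "('o, 'm) multicategory \<Rightarrow> ('o list \<Rightarrow> 'o \<Rightarrow> nat list \<Rightarrow> 'm \<Rightarrow> 'm)
    \<Rightarrow> ('o, 'm) cartesian_multicategory" where
  "with_action M act = multicategory.extend M (cartesian_multicategory.fields act)"

lemma with_action_simps [simp]:
  "MObj (with_action M act) = MObj M"
  "MHom (with_action M act) = MHom M"
  "MIdent (with_action M act) = MIdent M"
  "MComp (with_action M act) = MComp M"
  "Act (with_action M act) = act"
  by (simp_all add: with_action_def multicategory.defs cartesian_multicategory.defs)

lemma MHoms_with_action [simp]: "MHoms (with_action M act) = MHoms M"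
  by (simp add: MHoms_def fun_eq_iff)

lemma multicategory_with_action: "multicategory M \<Longrightarrow> multicategory (with_action M act)"
  by (simp add: multicategory_def)

text \<open>The sums are written as \<open>finprod\<close> because \<open>hom_monoid\<close> is a
  multiplicative record. A place \<open>j\<close> outside the image of \<open>\<sigma>\<close> has
  an empty fibre and receives \<open>Zero\<close>.\<close>

definition sum_action ::
  "('o, 'a, 'z) preadditive_category_scheme \<Rightarrow> 'o list \<Rightarrow> 'o \<Rightarrow> nat list \<Rightarrow> 'a list \<Rightarrow> 'a list" where
  "sum_action C Bs D \<sigma> fs =
    map (\<lambda>j. finprod (hom_monoid C (Bs ! j) D) ((!) fs) {i. i < length \<sigma> \<and> \<sigma> ! i = j})
      [0..<length Bs]"

definition seq_cartesian ::
  "('o, 'a, 'z) preadditive_category_scheme \<Rightarrow> ('o, 'a list) cartesian_multicategory" where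
  "seq_cartesian C = with_action (seq_multicategory C) (sum_action C)"

lemma length_sum_action [simp]: "length (sum_action C Bs D \<sigma> fs) = length Bs"
  by (simp add: sum_action_def)

lemma nth_sum_action [simp]:
  "j < length Bs \<Longrightarrow> sum_action C Bs D \<sigma> fs ! j =
    finprod (hom_monoid C (Bs ! j) D) ((!) fs) {i. i < length \<sigma> \<and> \<sigma> ! i = j}"
  by (simp add: sum_action_def)

text \<open>Offsets in the domain are taken with respect to the reindexed lengths, those in the
  codomain with respect to \<open>ks\<close>; block \<open>i\<close> is carried identically onto
  block \<open>\<sigma> ! i\<close>.\<close>

lemma block_mapping_shape:
  assumes "is_mapping (length ks) \<sigma>"
  shows "length (block_mapping ks \<sigma>) = sum_list (reindex ks \<sigma>)"
    and "\<lbrakk>i < length \<sigma>; k < ks ! (\<sigma> ! i)\<rbrakk>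
      \<Longrightarrow> block_mapping ks \<sigma> ! (sum_list (take i (reindex ks \<sigma>)) + k) =
        sum_list (take (\<sigma> ! i) ks) + k"
proof -
  show "length (block_mapping ks \<sigma>) = sum_list (reindex ks \<sigma>)"
    by (simp add: block_mapping_def length_concat reindex_def comp_def)
  have "reindex ks \<sigma> = map length (map (\<lambda>j. map (\<lambda>k. sum_list (take j ks) + k) [0..<ks ! j]) \<sigma>)"
    by (simp add: reindex_def comp_def)
  from nth_concat_offset[OF this, of i k]
  show "\<lbrakk>i < length \<sigma>; k < ks ! (\<sigma> ! i)\<rbrakk>
      \<Longrightarrow> block_mapping ks \<sigma> ! (sum_list (take i (reindex ks \<sigma>)) + k) =
        sum_list (take (\<sigma> ! i) ks) + k"
    by (simp add: block_mapping_def)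
qed

lemma juxtapose_shape:
  shows "length (juxtapose ms \<sigma>s) = sum_list (map length \<sigma>s)"
    and "\<lbrakk>i < length \<sigma>s; k < length (\<sigma>s ! i)\<rbrakk>
      \<Longrightarrow> juxtapose ms \<sigma>s ! (sum_list (take i (map length \<sigma>s)) + k) =
        sum_list (take i ms) + \<sigma>s ! i ! k"
proof -
  let ?f = "\<lambda>i. map (\<lambda>k. sum_list (take i ms) + k) (\<sigma>s ! i)"
  show "length (juxtapose ms \<sigma>s) = sum_list (map length \<sigma>s)"
    by (simp add: juxtapose_def length_concat comp_def map_nth_upt)
  have "map length \<sigma>s = map length (map ?f [0..<length \<sigma>s])"
    by (simp add: comp_def map_nth_upt)
  from nth_concat_offset[OF this, of i k]
  show "\<lbrakk>i < length \<sigma>s; k < length (\<sigma>s ! i)\<rbrakk>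
      \<Longrightarrow> juxtapose ms \<sigma>s ! (sum_list (take i (map length \<sigma>s)) + k) =
        sum_list (take i ms) + \<sigma>s ! i ! k"
    by (simp add: juxtapose_def)
qed

text \<open>Functoriality amounts to summing fibre by fibre. The law for actions on the inner arrows
  is additivity of composition in its inner argument, the law for an action on the outer arrow
  additivity in its outer argument. In both, a fibre of the large mapping is an injective image,
  under a map \<open>h\<close>, of a fibre of a given mapping.\<close>

lemma cartesian_multicategory_seq_cartesian:
  assumes "preadditive_category C"
  shows "cartesian_multicategory (seq_cartesian C)"
proof -
  interpret preadditive_category C by (rule assms)
  let ?M = "seq_multicategory C"
  interpret M: multicategory ?M by (rule multicategory_seq[OF category_axioms])
  show ?thesis
    unfolding seq_cartesian_def
  proof ((intro cartesian_multicategory.intro multicategory_with_action M.multicategory_axioms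
      cartesian_multicategory_axioms.intro; unfold with_action_simps MHoms_with_action), goal_cases)
    case (1 Bs D \<sigma> f)
    then show ?case
      by (auto simp: MHom_seq nth_in_lists intro!: sum_closed)
  next
    case (2 As D f)
    have "{i. i < length [0..<length As] \<and> [0..<length As] ! i = j} = {j}" if "j < length As" for j
      using that by auto
    with 2 show ?case
      by (auto simp: MHom_seq nth_in_lists sum_singleton intro!: nth_equalityI)
  next
    case (3 Cs D \<rho> \<sigma> f)
    show ?case
    proof (rule nth_equalityI)
      fix k assume "k < length (sum_action C Cs D \<rho> (sum_action C (reindex Cs \<rho>) D \<sigma> f))"
      then have k: "k < length Cs" "Cs ! k \<in> Obj C" using 3 by (auto simp: nth_in_lists)
      define J where "J = {j. j < length \<rho> \<and> \<rho> ! j = k}"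
      define I where "I j = {i. i < length \<sigma> \<and> \<sigma> ! i = j}" for j
      have f: "f ! i \<in> Hom C (Cs ! k) D" if "j \<in> J" "i \<in> I j" for i j
        using 3 that by (auto simp: MHom_seq J_def I_def)
      have "sum_action C Cs D \<rho> (sum_action C (reindex Cs \<rho>) D \<sigma> f) ! k =
          finprod (hom_monoid C (Cs ! k) D) (\<lambda>j. finprod (hom_monoid C (Cs ! k) D) ((!) f) (I j)) J"
        using k 3 f by (auto simp flip: J_def I_def intro!: sum_cong sum_closed) (auto simp: J_def I_def)
      also have "\<dots> = finprod (hom_monoid C (Cs ! k) D) ((!) f) (\<Union>(I ` J))"
        using k 3 f by (intro sum_UN[symmetric]) (auto simp: J_def I_def)
      \<comment> \<open>The fibre of the composite over \<open>k\<close> is the disjoint union of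
        the fibres of \<open>\<sigma>\<close> over the members of the fibre of \<open>\<rho>\<close>
        over \<open>k\<close>.\<close>
      also have "\<Union>(I ` J) = {i. i < length (reindex \<rho> \<sigma>) \<and> reindex \<rho> \<sigma> ! i = k}"
        using 3 by (auto simp: J_def I_def is_mapping_nth)
      finally show "sum_action C Cs D \<rho> (sum_action C (reindex Cs \<rho>) D \<sigma> f) ! k =
          sum_action C Cs D (reindex \<rho> \<sigma>) f ! k"
        using k by simp
    qed simp
  next
    case (4 \<Delta>s As D \<sigma>s f fs)
    define \<Gamma>s where "\<Gamma>s = map2 reindex \<Delta>s \<sigma>s"
    have \<Gamma>: "length \<Gamma>s = length As" "\<And>i. i < length As \<Longrightarrow> \<Gamma>s ! i = reindex (\<Delta>s ! i) (\<sigma>s ! i)"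
      using 4 by (simp_all add: \<Gamma>s_def)
    have ml: "map length \<Gamma>s = map length \<sigma>s"
      using 4 \<Gamma> by (auto intro!: nth_equalityI)
    show ?case
      unfolding \<Gamma>s_def[symmetric]
    proof (rule eq_if_blocks_eq[of _ "map length \<Delta>s"])
      fix i j assume i: "i < length (map length \<Delta>s)" and j: "j < map length \<Delta>s ! i"
      let ?X = "\<Delta>s ! i ! j"
      define p where "p = sum_list (take i (map length \<Delta>s)) + j"
      define h where "h = (\<lambda>k. sum_list (take i (map length \<sigma>s)) + k)"
      define K where "K = {k. k < length (\<sigma>s ! i) \<and> \<sigma>s ! i ! k = j}"
      have i': "i < length As" and j': "j < length (\<Delta>s ! i)" using i j 4 by auto
      have obj: "?X \<in> Obj C" "As ! i \<in> Obj C" "D \<in> Obj C"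
        using 4 i' j' by (auto intro!: nth_in_lists)
      have p: "p < length (concat \<Delta>s)" "concat \<Delta>s ! p = ?X"
        unfolding p_def length_concat using i' j' 4 by (auto intro!: offset_less simp: nth_concat_offset)
      have arr: "f ! i \<in> Hom C (As ! i) D" "\<And>k. k \<in> K \<Longrightarrow> fs ! i ! k \<in> Hom C ?X (As ! i)"
        using 4 i' \<Gamma> by (auto simp: MHom_seq MHoms_seq K_def simp flip: \<Gamma>s_def)
      \<comment> \<open>A juxtaposition sends block \<open>i\<close> into block \<open>i\<close>, so
        the fibre over place \<open>j\<close> of block \<open>i\<close> is the fibre of
        \<open>\<sigma>s ! i\<close> over \<open>j\<close>, shifted to the start of block
        \<open>i\<close> of the domain.\<close>
      have set: "{q. q < length (juxtapose (map length \<Delta>s) \<sigma>s) \<and>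
          juxtapose (map length \<Delta>s) \<sigma>s ! q = p} = h ` K" (is "?L = _")
      proof (intro equalityI subsetI)
        fix q assume q: "q \<in> ?L"
        then obtain i2 k where q2: "i2 < length \<sigma>s" "k < length (\<sigma>s ! i2)"
          "q = sum_list (take i2 (map length \<sigma>s)) + k"
          by (auto simp: juxtapose_shape elim: offset_exhaust)
        with q have "sum_list (take i2 (map length \<Delta>s)) + \<sigma>s ! i2 ! k =
            sum_list (take i (map length \<Delta>s)) + j"
          by (simp add: juxtapose_shape p_def)
        then have "i2 = i \<and> \<sigma>s ! i2 ! k = j"
          using q2 i' j' 4 is_mapping_nth[OF 4(6), of i2 k]
            offset_unique[of i2 "map length \<Delta>s" "\<sigma>s ! i2 ! k" i j]
          by simp
        then show "q \<in> h ` K" using q2 by (auto simp: K_def h_def)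
      next
        fix q assume "q \<in> h ` K"
        then obtain k where k: "k < length (\<sigma>s ! i)" "\<sigma>s ! i ! k = j" "q = h k"
          by (auto simp: K_def)
        moreover have "h k < sum_list (map length \<sigma>s)"
          unfolding h_def using k i' 4 by (intro offset_less) auto
        ultimately show "q \<in> ?L"
          using i' 4 by (simp add: juxtapose_shape h_def p_def)
      qed
      have entry: "MComp ?M \<Gamma>s As D f fs ! h k = Comp C ?X (As ! i) D (f ! i) (fs ! i ! k)"
        if "k \<in> K" for k
        using that \<Gamma> i' 4 unfolding h_def
        by (subst nth_MComp_seq) (auto simp: ml K_def)
      have "MComp ?M \<Delta>s As D f
           (map (\<lambda>i. sum_action C (\<Delta>s ! i) (As ! i) (\<sigma>s ! i) (fs ! i)) [0..<length As]) ! p =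
          Comp C ?X (As ! i) D (f ! i) (finprod (hom_monoid C ?X (As ! i)) ((!) (fs ! i)) K)"
        unfolding p_def using i' j' 4 by (simp add: nth_MComp_seq K_def)
      also have "\<dots> = finprod (hom_monoid C ?X D) (\<lambda>k. Comp C ?X (As ! i) D (f ! i) (fs ! i ! k)) K"
        using obj arr by (intro Comp_sum_right) (auto simp: K_def)
      also have "\<dots> = finprod (hom_monoid C ?X D) (\<lambda>k. MComp ?M \<Gamma>s As D f fs ! h k) K"
        using obj arr entry by (intro sum_cong) (auto intro!: Comp_closed)
      also have "\<dots> = finprod (hom_monoid C ?X D) ((!) (MComp ?M \<Gamma>s As D f fs)) (h ` K)"
        using obj arr entry
        by (intro sum_reindex[symmetric]) (auto intro!: Comp_closed simp: h_def inj_on_def)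
      also have "\<dots> = sum_action C (concat \<Delta>s) D (juxtapose (map length \<Delta>s) \<sigma>s)
          (MComp ?M \<Gamma>s As D f fs) ! p"
        using p set by simp
      finally show "MComp ?M \<Delta>s As D f
           (map (\<lambda>i. sum_action C (\<Delta>s ! i) (As ! i) (\<sigma>s ! i) (fs ! i)) [0..<length As]) !
           (sum_list (take i (map length \<Delta>s)) + j) =
         sum_action C (concat \<Delta>s) D (juxtapose (map length \<Delta>s) \<sigma>s) (MComp ?M \<Gamma>s As D f fs) !
           (sum_list (take i (map length \<Delta>s)) + j)"
        by (simp add: p_def)
    qed (use 4 in \<open>simp_all add: length_MComp_seq length_concat\<close>)
  next
    case (5 \<Gamma>s Bs D \<sigma> f fs)
    define ks where "ks = map length \<Gamma>s"
    have l: "length \<Gamma>s = length Bs" "length fs = length Bs" "length ks = length Bs"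
      using 5 by (auto simp: MHoms_seq ks_def)
    have m: "is_mapping (length ks) \<sigma>" using 5 l by simp
    have mr: "map length (reindex \<Gamma>s \<sigma>) = reindex ks \<sigma>"
      using m by (simp add: ks_def reindex_map)
    let ?g = "MComp ?M (reindex \<Gamma>s \<sigma>) (reindex Bs \<sigma>) D f (reindex fs \<sigma>)"
    show ?case
      unfolding ks_def[symmetric]
    proof (rule eq_if_blocks_eq[of _ ks])
      fix j k assume j: "j < length ks" and k: "k < ks ! j"
      let ?X = "\<Gamma>s ! j ! k"
      define p where "p = sum_list (take j ks) + k"
      define h where "h = (\<lambda>i. sum_list (take i (reindex ks \<sigma>)) + k)"
      define I where "I = {i. i < length \<sigma> \<and> \<sigma> ! i = j}"
      have j': "j < length Bs" "j < length \<Gamma>s" and k': "k < length (\<Gamma>s ! j)" using j k l by (auto simp: ks_def)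
      have obj: "?X \<in> Obj C" "Bs ! j \<in> Obj C" "D \<in> Obj C"
        using 5 j' k' by (auto intro!: nth_in_lists)
      have p: "p < length (concat \<Gamma>s)" "concat \<Gamma>s ! p = ?X"
        unfolding p_def length_concat using j k j' k'
        by (auto intro!: offset_less nth_concat_offset simp flip: ks_def)
      have arr: "\<And>i. i \<in> I \<Longrightarrow> f ! i \<in> Hom C (Bs ! j) D" "fs ! j ! k \<in> Hom C ?X (Bs ! j)"
        using 5 j' k' by (auto simp: MHom_seq MHoms_seq I_def)
      have inj: "inj_on h I"
      proof (rule inj_onI)
        fix a b assume "a \<in> I" "b \<in> I" "h a = h b"
        then show "a = b" using offset_unique(1)[of a "reindex ks \<sigma>" k b k] k
          by (simp add: h_def I_def)
      qed
      \<comment> \<open>Place \<open>k\<close> of block \<open>j\<close> is reached exactly once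
        from each block \<open>i\<close> with \<open>\<sigma> ! i = j\<close>, namely from its place
        \<open>k\<close>; the fibre is thus a copy of the fibre of \<open>\<sigma>\<close> over
        \<open>j\<close>.\<close>
      have set: "{q. q < length (block_mapping ks \<sigma>) \<and> block_mapping ks \<sigma> ! q = p} = h ` I"
        (is "?L = _")
      proof (intro equalityI subsetI)
        fix q assume q: "q \<in> ?L"
        then obtain i k2 where q2: "i < length \<sigma>" "k2 < ks ! (\<sigma> ! i)"
          "q = sum_list (take i (reindex ks \<sigma>)) + k2"
          by (auto simp: block_mapping_shape[OF m] elim: offset_exhaust)
        with q have "sum_list (take (\<sigma> ! i) ks) + k2 = sum_list (take j ks) + k"
          by (simp add: block_mapping_shape[OF m] p_def)
        then have "\<sigma> ! i = j \<and> k2 = k"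
          using q2 j k is_mapping_nth[OF m q2(1)] offset_unique[of "\<sigma> ! i" ks k2 j k] by simp
        then show "q \<in> h ` I" using q2 by (auto simp: I_def h_def)
      next
        fix q assume "q \<in> h ` I"
        then obtain i where i: "i < length \<sigma>" "\<sigma> ! i = j" "q = h i"
          by (auto simp: I_def)
        moreover have "h i < sum_list (reindex ks \<sigma>)"
          unfolding h_def using i k by (intro offset_less) auto
        ultimately show "q \<in> ?L"
          using k by (simp add: block_mapping_shape[OF m] h_def p_def)
      qed
      have entry: "?g ! h i = Comp C ?X (Bs ! j) D (f ! i) (fs ! j ! k)" if "i \<in> I" for i
        using that k' unfolding h_def by (subst nth_MComp_seq) (auto simp: mr I_def)
      have "MComp ?M \<Gamma>s Bs D (sum_action C Bs D \<sigma> f) fs ! p =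
          Comp C ?X (Bs ! j) D (finprod (hom_monoid C (Bs ! j) D) ((!) f) I) (fs ! j ! k)"
        unfolding p_def using j' k' l by (simp add: nth_MComp_seq I_def ks_def)
      also have "\<dots> = finprod (hom_monoid C ?X D) (\<lambda>i. Comp C ?X (Bs ! j) D (f ! i) (fs ! j ! k)) I"
        using obj arr by (intro Comp_sum_left) (auto simp: I_def)
      also have "\<dots> = finprod (hom_monoid C ?X D) (\<lambda>i. ?g ! h i) I"
        using obj arr entry by (intro sum_cong) (auto intro!: Comp_closed)
      also have "\<dots> = finprod (hom_monoid C ?X D) ((!) ?g) (h ` I)"
        using obj arr entry inj by (intro sum_reindex[symmetric]) (auto intro!: Comp_closed)
      also have "\<dots> = sum_action C (concat \<Gamma>s) D (block_mapping ks \<sigma>) ?g ! p"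
        using p set by simp
      finally show "MComp ?M \<Gamma>s Bs D (sum_action C Bs D \<sigma> f) fs ! (sum_list (take j ks) + k) =
          sum_action C (concat \<Gamma>s) D (block_mapping ks \<sigma>) ?g ! (sum_list (take j ks) + k)"
        by (simp add: p_def)
    qed (use l in \<open>simp_all add: length_MComp_seq length_concat ks_def\<close>)
  qed
qed

section \<open>Juxtapositions and block mappings as mappings between lists of objects\<close>

lemma is_mapping_juxtapose:
  assumes "length ms = length \<sigma>s" "\<And>i. i < length \<sigma>s \<Longrightarrow> is_mapping (ms ! i) (\<sigma>s ! i)"
  shows "is_mapping (sum_list ms) (juxtapose ms \<sigma>s)"
  using assms by (auto simp: is_mapping_def juxtapose_def subset_iff intro!: offset_less)

lemma is_mapping_block_mapping:
  assumes "is_mapping (length ks) \<sigma>"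
  shows "is_mapping (sum_list ks) (block_mapping ks \<sigma>)"
proof -
  have "t < sum_list ks"
    if "j < length ks" "sum_list (take j ks) \<le> t" "t < ks ! j + sum_list (take j ks)" for j t
    using offset_less[of j ks "t - sum_list (take j ks)"] that by simp
  then show ?thesis
    using assms by (auto simp: is_mapping_def block_mapping_def subset_iff)
qed

text \<open>Identifies the domain of a composite with a reindexing of the concatenated lists, which
  is what it takes for the juxtaposed mapping to act on that composite. The next lemma does the same
  for \<open>block_mapping\<close>.\<close>

lemma reindex_juxtapose:
  assumes "length xss = length \<sigma>s" "\<And>i. i < length \<sigma>s \<Longrightarrow> is_mapping (length (xss ! i)) (\<sigma>s ! i)"
  shows "reindex (concat xss) (juxtapose (map length xss) \<sigma>s) = concat (map2 reindex xss \<sigma>s)"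
proof -
  have "map2 reindex xss \<sigma>s = map (\<lambda>i. reindex (xss ! i) (\<sigma>s ! i)) [0..<length \<sigma>s]"
    using assms(1) by (auto intro!: nth_equalityI)
  then show ?thesis
    using assms
    by (auto simp: reindex_def[of "concat _"] juxtapose_def map_concat is_mapping_def subset_iff
        reindex_def nth_concat_offset intro!: arg_cong[of _ _ concat])
qed

lemma reindex_block_mapping:
  assumes "is_mapping (length xss) \<sigma>"
  shows "reindex (concat xss) (block_mapping (map length xss) \<sigma>) = concat (reindex xss \<sigma>)"
proof -
  have "map ((!) (concat xss)) (map (\<lambda>k. sum_list (take j (map length xss)) + k) [0..<map length xss ! j]) =
      xss ! j" if "j \<in> set \<sigma>" for j
    using that assms by (auto simp: is_mapping_def nth_concat_offset intro!: nth_equalityI)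
  then show ?thesis
    by (auto simp: reindex_def block_mapping_def map_concat intro!: arg_cong[of _ _ concat])
qed


section \<open>Transfer of cartesian structures\<close>

text \<open>Here \<open>N\<close> is raw data, since the multifunctor predicates presuppose no laws.
  As \<open>G\<close> undoes \<open>F\<close>, the latter is injective on hom-sets, so every
  equation in \<open>N\<close> follows from its image under \<open>F\<close>, where it is a law of
  \<open>M\<close>. Closure is not an equation: for it, an identity, composite or action in
  \<open>N\<close> is exhibited as the image under \<open>G\<close> of the corresponding one in
  \<open>M\<close>.\<close>

lemma cartesian_multicategory_retract:
  assumes M: "cartesian_multicategory M"
    and F: "cartesian_multifunctor N M F" and G: "cartesian_multifunctor M N G"
    and GF: "restrict_multifunctor N (comp_multifunctor G F) = restrict_multifunctor N id_multifunctor"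
  shows "cartesian_multicategory N"
proof -
  interpret M: cartesian_multicategory M by (rule M)
  note mF = cartesian_multifunctorD(1)[OF F] and mG = cartesian_multifunctorD(1)[OF G]
  note aF = cartesian_multifunctorD(2)[OF F] and aG = cartesian_multifunctorD(2)[OF G]
  note O = MFObj_closed[OF mF] and m = MFObj_lists_closed[OF mF]
    and mm = MFObj_lists_lists_closed[OF mF] and A = MFArr_closed[OF mF]
    and As = map_arrows_closed[OF mF]
  have GO: "MFObj G (MFObj F A) = A" if "A \<in> MObj N" for A
    using GF that by (simp add: restrict_multifunctor_cong_iff)
  have Gm: "map (MFObj G) (map (MFObj F) As) = As" if "As \<in> lists (MObj N)" for As
    using that GO by (auto intro!: map_idI)
  have Gmm: "map (map (MFObj G)) (map (map (MFObj F)) \<Gamma>s) = \<Gamma>s"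
    if "\<Gamma>s \<in> lists (lists (MObj N))" for \<Gamma>s
  proof -
    have "map (map (MFObj G) \<circ> map (MFObj F)) \<Gamma>s = \<Gamma>s"
      using that Gm by (intro map_idI) (simp add: in_lists_conv_set)
    then show ?thesis by simp
  qed
  have GA: "MFArr G (map (MFObj F) As) (MFObj F B) (MFArr F As B f) = f"
    if "As \<in> lists (MObj N)" "B \<in> MObj N" "f \<in> MHom N As B" for As B f
    using GF that by (simp add: restrict_multifunctor_cong_iff)
  have inj: "f = f'" if "As \<in> lists (MObj N)" "B \<in> MObj N" "f \<in> MHom N As B" "f' \<in> MHom N As B"
    "MFArr F As B f = MFArr F As B f'" for As B f f'
    using GA that by metis
  have GAs: "map_arrows G (map (map (MFObj F)) \<Gamma>s) (map (MFObj F) As) (map_arrows F \<Gamma>s As fs) = fs"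
    if "\<Gamma>s \<in> lists (lists (MObj N))" "As \<in> lists (MObj N)" "fs \<in> MHoms N \<Gamma>s As" for \<Gamma>s As fs
    using that by (intro nth_equalityI) (simp_all add: MHoms_def nth_in_lists GA)
  have GHom: "MFArr G (map (MFObj F) As) (MFObj F B) f \<in> MHom N As B"
    if "As \<in> lists (MObj N)" "B \<in> MObj N" "f \<in> MHom M (map (MFObj F) As) (MFObj F B)" for As B f
    using MFArr_closed[OF mG m[OF that(1)] O[OF that(2)] that(3)] unfolding Gm[OF that(1)] GO[OF that(2)] .
  have concat_lists: "concat \<Gamma>s \<in> lists Z" if "\<Gamma>s \<in> lists (lists Z)" for \<Gamma>s and Z :: "'z set"
    using that by (auto simp: in_lists_conv_set)
  have closed: "MComp N \<Gamma>s As B f fs \<in> MHom N (concat \<Gamma>s) B"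
    if *: "\<Gamma>s \<in> lists (lists (MObj N))" "As \<in> lists (MObj N)" "B \<in> MObj N" "f \<in> MHom N As B"
      "fs \<in> MHoms N \<Gamma>s As" for \<Gamma>s As B f fs
  proof -
    have "MComp N \<Gamma>s As B f fs = MFArr G (concat (map (map (MFObj F)) \<Gamma>s)) (MFObj F B)
        (MComp M (map (map (MFObj F)) \<Gamma>s) (map (MFObj F) As) (MFObj F B) (MFArr F As B f)
          (map_arrows F \<Gamma>s As fs))"
      using MFArr_MComp[OF mG mm[OF *(1)] m[OF *(2)] O[OF *(3)] A[OF *(2-4)] As[OF *(1,2,5)]]
      unfolding Gmm[OF *(1)] Gm[OF *(2)] GO[OF *(3)] GA[OF *(2-4)] GAs[OF *(1,2,5)] by simp
    also have "\<dots> \<in> MHom N (concat \<Gamma>s) B"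
      using M.MComp_closed[OF mm[OF *(1)] m[OF *(2)] O[OF *(3)] A[OF *(2-4)] As[OF *(1,2,5)]]
      unfolding map_concat[symmetric] by (rule GHom[OF concat_lists[OF *(1)] *(3)])
    finally show ?thesis .
  qed
  have reA: "MFArr F (reindex Bs \<sigma>) D f \<in> MHom M (reindex (map (MFObj F) Bs) \<sigma>) (MFObj F D)"
    if "Bs \<in> lists (MObj N)" "D \<in> MObj N" "is_mapping (length Bs) \<sigma>"
      "f \<in> MHom N (reindex Bs \<sigma>) D" for Bs D \<sigma> f
    using A[OF reindex_in_lists[OF that(1,3)] that(2,4)] that(3) by (simp add: reindex_map)
  have act_closed: "Act N Bs D \<sigma> f \<in> MHom N Bs D"
    if *: "Bs \<in> lists (MObj N)" "D \<in> MObj N" "is_mapping (length Bs) \<sigma>"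
      "f \<in> MHom N (reindex Bs \<sigma>) D" for Bs D \<sigma> f
  proof -
    have l: "is_mapping (length (map (MFObj F) Bs)) \<sigma>" using *(3) by simp
    have "Act N Bs D \<sigma> f = MFArr G (map (MFObj F) Bs) (MFObj F D)
        (Act M (map (MFObj F) Bs) (MFObj F D) \<sigma> (MFArr F (reindex Bs \<sigma>) D f))"
      unfolding aG[OF m[OF *(1)] O[OF *(2)] l reA[OF *]] Gm[OF *(1)] GO[OF *(2)]
      unfolding reindex_map[OF *(3)] GA[OF reindex_in_lists[OF *(1,3)] *(2,4)] ..
    also have "\<dots> \<in> MHom N Bs D"
      by (rule GHom[OF *(1,2) M.Act_closed[OF m[OF *(1)] O[OF *(2)] l reA[OF *]]])
    finally show ?thesis .
  qed
  have ident_closed: "MIdent N B \<in> MHom N [B] B" if B: "B \<in> MObj N" for B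
  proof -
    have "MIdent N B = MFArr G [MFObj F B] (MFObj F B) (MIdent M (MFObj F B))"
      using MFArr_MIdent[OF mG O[OF B]] GO[OF B] by simp
    also have "\<dots> \<in> MHom N [B] B"
      using GHom[of "[B]" B] B M.MIdent_closed[OF O[OF B]] by simp
    finally show ?thesis .
  qed
  show ?thesis
  proof (unfold_locales, goal_cases)
    case (1 B)
    then show ?case by (rule ident_closed)
  next
    case (2 \<Gamma>s As B f fs)
    then show ?case by (rule closed)
  next
    case (3 As B f)
    note id = ident_closed[OF 3(2)]
    have *: "[As] \<in> lists (lists (MObj N))" "[B] \<in> lists (MObj N)" "[f] \<in> MHoms N [As] [B]"
      using 3 by (simp_all add: MHoms_def)
    have "MFArr F As B (MComp N [As] [B] B (MIdent N B) [f]) = MFArr F As B f"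
      using MFArr_MComp[OF mF *(1,2) 3(2) id *(3)] M.MComp_MIdent_left[OF m[OF 3(1)] O[OF 3(2)] A[OF 3]]
      by (simp add: map_arrows_def MFArr_MIdent[OF mF 3(2)])
    then show ?case
      using inj[OF 3(1,2) _ 3(3)] closed[OF *(1,2) 3(2) id *(3)] by simp
  next
    case (4 As B f)
    have *: "map (\<lambda>A. [A]) As \<in> lists (lists (MObj N))"
      "map (MIdent N) As \<in> MHoms N (map (\<lambda>A. [A]) As) As"
      using 4(1) by (auto simp: MHoms_def nth_in_lists intro!: ident_closed)
    have c: "concat (map (\<lambda>A. [A]) As) = As"
      by simp
    have "map_arrows F (map (\<lambda>A. [A]) As) As (map (MIdent N) As) = map (MIdent M) (map (MFObj F) As)"
      using 4(1) by (auto simp: map_arrows_def nth_in_lists MFArr_MIdent[OF mF] intro!: nth_equalityI)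
    then have "MFArr F As B (MComp N (map (\<lambda>A. [A]) As) As B f (map (MIdent N) As)) = MFArr F As B f"
      using MFArr_MComp[OF mF *(1) 4 *(2)] M.MComp_MIdent_right[OF m[OF 4(1)] O[OF 4(2)] A[OF 4]]
      by (simp add: comp_def)
    then show ?case
      using inj[OF 4(1,2) _ 4(3)] closed[OF *(1) 4 *(2)] by simp
  next
    case (5 \<Gamma>ss Ass Bs D gss f fs)
    let ?hs = "map (\<lambda>i. MComp N (\<Gamma>ss ! i) (Ass ! i) (Bs ! i) (fs ! i) (gss ! i)) [0..<length Bs]"
    let ?gss = "map (\<lambda>i. map_arrows F (\<Gamma>ss ! i) (Ass ! i) (gss ! i)) [0..<length Bs]"
    let ?m = "map (MFObj F)"
    have l: "length \<Gamma>ss = length Bs" "length Ass = length Bs" "length fs = length Bs" "length gss = length Bs"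
      using 5 by (simp_all add: MHoms_def)
    have li: "length (\<Gamma>ss ! i) = length (Ass ! i)" "length (gss ! i) = length (Ass ! i)"
      if "i < length Bs" for i
      using 5(9)[OF that] by (simp_all add: MHoms_def)
    have ml: "map length gss = map length Ass" "map length \<Gamma>ss = map length Ass"
      using l li by (auto intro!: nth_equalityI)
    have lc: "length (concat \<Gamma>ss) = length (concat Ass)" "length (concat gss) = length (concat Ass)"
      unfolding length_concat ml by simp_all
    have obj: "\<Gamma>ss ! i \<in> lists (lists (MObj N))" "Ass ! i \<in> lists (MObj N)" "Bs ! i \<in> MObj N"
      "fs ! i \<in> MHom N (Ass ! i) (Bs ! i)" if "i < length Bs" for i
      using nth_in_lists[OF 5(1), of i] nth_in_lists[OF 5(2), of i] nth_in_lists[OF 5(3), of i] 5(8) that l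
      by (simp_all add: MHoms_def)
    have c1: "map concat \<Gamma>ss \<in> lists (lists (MObj N))"
      using 5(1) concat_lists by (simp add: in_lists_conv_set)
    have hs: "?hs \<in> MHoms N (map concat \<Gamma>ss) Bs"
      using l closed[OF obj 5(9)] by (simp add: MHoms_def)
    have gs: "concat gss \<in> MHoms N (concat \<Gamma>ss) (concat Ass)"
      unfolding MHoms_def
    proof (intro CollectI conjI allI impI lc)
      fix p assume "p < length (concat Ass)"
      then obtain i k where ik: "i < length Ass" "k < length (Ass ! i)"
        "p = sum_list (take i (map length Ass)) + k"
        by (auto simp: length_concat elim: offset_exhaust)
      then show "concat gss ! p \<in> MHom N (concat \<Gamma>ss ! p) (concat Ass ! p)"
        using 5(9)[of i] l li by (simp add: nth_concat_offset ml MHoms_def)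
    qed
    \<comment> \<open>\<open>map_arrows\<close> works by position, so its compatibility with
      flattening has to be checked block by block.\<close>
    have cg: "map_arrows F (concat \<Gamma>ss) (concat Ass) (concat gss) = concat ?gss"
    proof (rule eq_if_blocks_eq[of _ "map length Ass"])
      have mlg: "map length ?gss = map length Ass"
        using l by (auto intro!: nth_equalityI)
      then show "length (concat ?gss) = sum_list (map length Ass)"
        by (simp only: length_concat)
      fix i k assume "i < length (map length Ass)" "k < map length Ass ! i"
      then have ik: "i < length Ass" "i < length Bs" "k < length (Ass ! i)" using l by simp_all
      then have "sum_list (take i (map length Ass)) + k < length (concat Ass)"
        unfolding length_concat by (intro offset_less) simp_all
      then show "map_arrows F (concat \<Gamma>ss) (concat Ass) (concat gss) !
           (sum_list (take i (map length Ass)) + k) =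
          concat ?gss ! (sum_list (take i (map length Ass)) + k)"
        using ik l li mlg by (simp add: nth_concat_offset ml)
    qed (simp add: length_concat)
    have "MFArr F (concat (map concat \<Gamma>ss)) D (MComp N (map concat \<Gamma>ss) Bs D f ?hs) =
        MComp M (map ?m (map concat \<Gamma>ss)) (?m Bs) (MFObj F D) (MFArr F Bs D f)
          (map_arrows F (map concat \<Gamma>ss) Bs ?hs)"
      by (rule MFArr_MComp[OF mF c1 5(3,4,7) hs])
    also have "map ?m (map concat \<Gamma>ss) = map concat (map (map ?m) \<Gamma>ss)"
      by (simp add: map_concat)
    also have "map_arrows F (map concat \<Gamma>ss) Bs ?hs =
        map (\<lambda>i. MComp M (map (map ?m) \<Gamma>ss ! i) (map ?m Ass ! i) (?m Bs ! i)
          (map_arrows F Ass Bs fs ! i) (?gss ! i)) [0..<length (?m Bs)]"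
      using l MFArr_MComp[OF mF obj 5(9)] by (auto intro!: nth_equalityI)
    also have "MComp M (map concat (map (map ?m) \<Gamma>ss)) (?m Bs) (MFObj F D) (MFArr F Bs D f) \<dots> =
        MComp M (concat (map (map ?m) \<Gamma>ss)) (concat (map ?m Ass)) (MFObj F D)
          (MComp M (map ?m Ass) (?m Bs) (MFObj F D) (MFArr F Bs D f) (map_arrows F Ass Bs fs)) (concat ?gss)"
    proof (rule M.MComp_assoc)
      show "map (map ?m) \<Gamma>ss \<in> lists (lists (lists (MObj M)))"
        using 5(1) O by (simp add: in_lists_conv_set)
      fix i assume "i < length (?m Bs)"
      then show "?gss ! i \<in> MHoms M (map (map ?m) \<Gamma>ss ! i) (map ?m Ass ! i)"
        using l As[OF obj(1,2) 5(9)] by simp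
    qed (use 5 l m mm O A As in simp_all)
    also have "\<dots> = MComp M (map ?m (concat \<Gamma>ss)) (?m (concat Ass)) (MFObj F D)
        (MFArr F (concat Ass) D (MComp N Ass Bs D f fs)) (map_arrows F (concat \<Gamma>ss) (concat Ass) (concat gss))"
      unfolding cg MFArr_MComp[OF mF 5(2,3,4,7,8)] by (simp add: map_concat)
    also have "\<dots> = MFArr F (concat (concat \<Gamma>ss)) D
        (MComp N (concat \<Gamma>ss) (concat Ass) D (MComp N Ass Bs D f fs) (concat gss))"
      by (rule MFArr_MComp[OF mF concat_lists[OF 5(1)] concat_lists[OF 5(2)] 5(4)
            closed[OF 5(2,3,4,7,8)] gs, symmetric])
    finally have eq: "MFArr F (concat (map concat \<Gamma>ss)) D (MComp N (map concat \<Gamma>ss) Bs D f ?hs) = \<dots>"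
      .
    have cc: "concat (map concat \<Gamma>ss) = concat (concat \<Gamma>ss)"
      by (induction \<Gamma>ss) auto
    show ?case
      by (rule inj[OF concat_lists[OF concat_lists[OF 5(1)]] 5(4) closed[OF c1 5(3,4,7) hs, unfolded cc]
            closed[OF concat_lists[OF 5(1)] concat_lists[OF 5(2)] 5(4) closed[OF 5(2,3,4,7,8)] gs] eq[unfolded cc]])
  next
    case (6 Bs D \<sigma> f)
    then show ?case by (rule act_closed)
  next
    case (7 As D f)
    have mp: "is_mapping (length As) [0..<length As]" by (rule is_mapping_upt)
    have r: "reindex As [0..<length As] = As" by (simp add: reindex_def map_nth)
    have "MFArr F As D (Act N As D [0..<length As] f) = MFArr F As D f"
      using aF[OF 7(1,2) mp, unfolded r, OF 7(3)] M.Act_id[OF m[OF 7(1)] O[OF 7(2)] A[OF 7]] by simp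
    then show ?case
      using inj[OF 7(1,2) act_closed[OF 7(1,2) mp, unfolded r, OF 7(3)] 7(3)] by simp
  next
    case (8 Cs D \<rho> \<sigma> f)
    have r: "reindex Cs \<rho> \<in> lists (MObj N)" by (rule reindex_in_lists[OF 8(1,3)])
    have s: "is_mapping (length (reindex Cs \<rho>)) \<sigma>" using 8(4) by simp
    have rr: "reindex (reindex Cs \<rho>) \<sigma> = reindex Cs (reindex \<rho> \<sigma>)"
      using 8(4) by (auto simp: reindex_def is_mapping_def)
    have rs: "is_mapping (length Cs) (reindex \<rho> \<sigma>)" by (rule is_mapping_reindex[OF 8(3,4)])
    note f' = 8(5)[unfolded rr]
    have "MFArr F Cs D (Act N Cs D \<rho> (Act N (reindex Cs \<rho>) D \<sigma> f)) =
        Act M (map (MFObj F) Cs) (MFObj F D) \<rho> (Act M (reindex (map (MFObj F) Cs) \<rho>) (MFObj F D) \<sigma>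
          (MFArr F (reindex Cs (reindex \<rho> \<sigma>)) D f))"
      using 8(3) aF[OF r 8(2) s 8(5)]
      by (simp add: aF[OF 8(1,2,3) act_closed[OF r 8(2) s 8(5)]] reindex_map rr)
    also have "\<dots> = MFArr F Cs D (Act N Cs D (reindex \<rho> \<sigma>) f)"
      unfolding aF[OF 8(1,2) rs f']
      using 8 A[OF reindex_in_lists[OF r s] 8(2,5)] m[OF 8(1)] O[OF 8(2)]
      by (intro M.Act_comp) (simp_all add: reindex_map rr)
    finally show ?case
      by (rule inj[OF 8(1,2) act_closed[OF 8(1,2,3) act_closed[OF r 8(2) s 8(5)]] act_closed[OF 8(1,2) rs f']])
  next
    case (9 \<Delta>s As D \<sigma>s f fs)
    let ?m = "map (MFObj F)"
    define \<Gamma>s where "\<Gamma>s = map2 reindex \<Delta>s \<sigma>s"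
    have \<Gamma>: "length \<Gamma>s = length As" "\<And>i. i < length As \<Longrightarrow> \<Gamma>s ! i = reindex (\<Delta>s ! i) (\<sigma>s ! i)"
      using 9 by (simp_all add: \<Gamma>s_def)
    let ?as = "map (\<lambda>i. Act N (\<Delta>s ! i) (As ! i) (\<sigma>s ! i) (fs ! i)) [0..<length As]"
    have \<Delta>: "\<Delta>s ! i \<in> lists (MObj N)" "As ! i \<in> MObj N" "is_mapping (length (\<Delta>s ! i)) (\<sigma>s ! i)"
      "fs ! i \<in> MHom N (reindex (\<Delta>s ! i) (\<sigma>s ! i)) (As ! i)" if "i < length As" for i
      using 9 that by (simp_all only: nth_in_lists) (simp_all add: MHoms_def)
    have \<Gamma>l: "\<Gamma>s \<in> lists (lists (MObj N))"
      unfolding in_lists_conv_set[of _ "lists (MObj N)"]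
      using reindex_in_lists[OF \<Delta>(1,3)] \<Gamma> by (simp add: all_set_conv_all_nth)
    have mm\<Gamma>: "map ?m \<Gamma>s = map2 reindex (map ?m \<Delta>s) \<sigma>s"
      using 9 \<Gamma> \<Delta>(3) by (auto simp: reindex_map intro!: nth_equalityI)
    have as: "?as \<in> MHoms N \<Delta>s As"
      using 9(4) act_closed[OF \<Delta>] by (simp add: MHoms_def)
    have jx: "is_mapping (length (concat \<Delta>s)) (juxtapose (map length \<Delta>s) \<sigma>s)"
      unfolding length_concat
      using 9 by (intro is_mapping_juxtapose) auto
    have rj: "reindex (concat \<Delta>s) (juxtapose (map length \<Delta>s) \<sigma>s) = concat \<Gamma>s"
      unfolding \<Gamma>s_def using 9 by (intro reindex_juxtapose) auto
    note fs = 9(8)[folded \<Gamma>s_def]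
    note comp = closed[OF \<Gamma>l 9(2,3,7) fs]
    have "MFArr F (concat \<Delta>s) D (MComp N \<Delta>s As D f ?as) =
        MComp M (map ?m \<Delta>s) (?m As) (MFObj F D) (MFArr F As D f) (map_arrows F \<Delta>s As ?as)"
      by (rule MFArr_MComp[OF mF 9(1,2,3,7) as])
    also have "map_arrows F \<Delta>s As ?as = map (\<lambda>i. Act M (map ?m \<Delta>s ! i) (?m As ! i) (\<sigma>s ! i)
        (map_arrows F \<Gamma>s As fs ! i)) [0..<length (?m As)]"
      using 9(4) \<Gamma> aF[OF \<Delta>] by (auto intro!: nth_equalityI)
    also have "MComp M (map ?m \<Delta>s) (?m As) (MFObj F D) (MFArr F As D f) \<dots> =
        Act M (concat (map ?m \<Delta>s)) (MFObj F D) (juxtapose (map length (map ?m \<Delta>s)) \<sigma>s)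
          (MComp M (map2 reindex (map ?m \<Delta>s) \<sigma>s) (?m As) (MFObj F D) (MFArr F As D f)
            (map_arrows F \<Gamma>s As fs))"
      by (rule M.MComp_Act_inner)
        (use 9 m[OF 9(2)] mm[OF 9(1)] O A[OF 9(2,3,7)] As[OF \<Gamma>l 9(2) fs] in
          \<open>simp_all add: mm\<Gamma>[symmetric] del: map_map\<close>)
    also have "\<dots> = MFArr F (concat \<Delta>s) D (Act N (concat \<Delta>s) D (juxtapose (map length \<Delta>s) \<sigma>s)
        (MComp N \<Gamma>s As D f fs))"
      unfolding aF[OF concat_lists[OF 9(1)] 9(3) jx, unfolded rj, OF comp]
        MFArr_MComp[OF mF \<Gamma>l 9(2,3,7) fs] mm\<Gamma>[symmetric]
      by (simp add: map_concat comp_def)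
    finally show ?case
      unfolding \<Gamma>s_def[symmetric]
      by (rule inj[OF concat_lists[OF 9(1)] 9(3) closed[OF 9(1,2,3,7) as]
            act_closed[OF concat_lists[OF 9(1)] 9(3) jx, unfolded rj, OF comp]])
  next
    case (10 \<Gamma>s Bs D \<sigma> f fs)
    let ?m = "map (MFObj F)"
    have l: "length \<Gamma>s = length Bs" "length fs = length Bs"
      using 10 by (simp_all add: MHoms_def)
    have \<sigma>: "is_mapping (length \<Gamma>s) \<sigma>" "is_mapping (length fs) \<sigma>"
      using 10(4) l by simp_all
    note r\<Gamma> = reindex_in_lists[OF 10(1) \<sigma>(1)] and rB = reindex_in_lists[OF 10(2,4)]
    have rfs: "reindex fs \<sigma> \<in> MHoms N (reindex \<Gamma>s \<sigma>) (reindex Bs \<sigma>)"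
      using 10(4,6) by (simp add: MHoms_def is_mapping_nth)
    have b: "is_mapping (length (concat \<Gamma>s)) (block_mapping (map length \<Gamma>s) \<sigma>)"
      unfolding length_concat using \<sigma> by (intro is_mapping_block_mapping) simp
    have rb: "reindex (concat \<Gamma>s) (block_mapping (map length \<Gamma>s) \<sigma>) = concat (reindex \<Gamma>s \<sigma>)"
      by (rule reindex_block_mapping[OF \<sigma>(1)])
    note act = act_closed[OF 10(2,3,4,5)] and comp = closed[OF r\<Gamma> rB 10(3,5) rfs]
    have "MFArr F (concat \<Gamma>s) D (MComp N \<Gamma>s Bs D (Act N Bs D \<sigma> f) fs) =
        MComp M (map ?m \<Gamma>s) (?m Bs) (MFObj F D)
          (Act M (?m Bs) (MFObj F D) \<sigma> (MFArr F (reindex Bs \<sigma>) D f)) (map_arrows F \<Gamma>s Bs fs)"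
      unfolding MFArr_MComp[OF mF 10(1,2,3) act 10(6)] aF[OF 10(2,3,4,5)] ..
    also have "\<dots> = Act M (concat (map ?m \<Gamma>s)) (MFObj F D) (block_mapping (map length (map ?m \<Gamma>s)) \<sigma>)
        (MComp M (reindex (map ?m \<Gamma>s) \<sigma>) (reindex (?m Bs) \<sigma>) (MFObj F D) (MFArr F (reindex Bs \<sigma>) D f)
          (reindex (map_arrows F \<Gamma>s Bs fs) \<sigma>))"
      by (rule M.MComp_Act_outer)
        (use 10 m[OF 10(2)] mm[OF 10(1)] O reA[OF 10(2,3,4,5)] As[OF 10(1,2,6)] in simp_all)
    also have "reindex (map_arrows F \<Gamma>s Bs fs) \<sigma> =
        map_arrows F (reindex \<Gamma>s \<sigma>) (reindex Bs \<sigma>) (reindex fs \<sigma>)"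
      using 10(4) by (auto intro!: nth_equalityI simp: is_mapping_nth)
    also have "reindex (map ?m \<Gamma>s) \<sigma> = map ?m (reindex \<Gamma>s \<sigma>)"
      by (rule reindex_map[OF \<sigma>(1)])
    also have "reindex (?m Bs) \<sigma> = ?m (reindex Bs \<sigma>)"
      by (rule reindex_map[OF 10(4)])
    also have "Act M (concat (map ?m \<Gamma>s)) (MFObj F D) (block_mapping (map length (map ?m \<Gamma>s)) \<sigma>)
        (MComp M (map ?m (reindex \<Gamma>s \<sigma>)) (?m (reindex Bs \<sigma>)) (MFObj F D) (MFArr F (reindex Bs \<sigma>) D f)
          (map_arrows F (reindex \<Gamma>s \<sigma>) (reindex Bs \<sigma>) (reindex fs \<sigma>))) =
        MFArr F (concat \<Gamma>s) D (Act N (concat \<Gamma>s) D (block_mapping (map length \<Gamma>s) \<sigma>)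
          (MComp N (reindex \<Gamma>s \<sigma>) (reindex Bs \<sigma>) D f (reindex fs \<sigma>)))"
      unfolding aF[OF concat_lists[OF 10(1)] 10(3) b, unfolded rb, OF comp]
        MFArr_MComp[OF mF r\<Gamma> rB 10(3,5) rfs]
      by (simp add: map_concat comp_def)
    finally show ?case
      by (rule inj[OF concat_lists[OF 10(1)] 10(3) closed[OF 10(1,2,3) act 10(6)]
            act_closed[OF concat_lists[OF 10(1)] 10(3) b, unfolded rb, OF comp]])
  qed
qed


section \<open>Isomorphisms of cartesian multicategories\<close>

definition cartesian_iso ::
  "('o, 'm, 'y) cartesian_multicategory_scheme \<Rightarrow> ('p, 'n, 'z) cartesian_multicategory_scheme
    \<Rightarrow> ('o, 'm, 'p, 'n) multifunctor_data \<Rightarrow> ('p, 'n, 'o, 'm) multifunctor_data \<Rightarrow> bool" where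
  "cartesian_iso M N F G \<longleftrightarrow> cartesian_multifunctor M N F \<and> cartesian_multifunctor N M G \<and>
    restrict_multifunctor M (comp_multifunctor G F) = restrict_multifunctor M id_multifunctor \<and>
    restrict_multifunctor N (comp_multifunctor F G) = restrict_multifunctor N id_multifunctor"

text \<open>The inner pair \<open>G'\<close>, \<open>F'\<close> cancels on the values of
  \<open>F\<close>, which lie in \<open>N\<close>; after that \<open>G\<close> cancels
  \<open>F\<close>. Both halves of the transitivity of \<open>cartesian_iso\<close> are
  instances.\<close>

lemma retract_trans:
  assumes F: "is_multifunctor M N F"
    and 1: "restrict_multifunctor M (comp_multifunctor G F) = restrict_multifunctor M id_multifunctor"
    and 2: "restrict_multifunctor N (comp_multifunctor G' F') = restrict_multifunctor N id_multifunctor"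
  shows "restrict_multifunctor M (comp_multifunctor (comp_multifunctor G G') (comp_multifunctor F' F)) =
    restrict_multifunctor M id_multifunctor"
proof -
  have *: "MFObj G' (MFObj F' (MFObj F X)) = MFObj F X" if "X \<in> MObj M" for X
    using 2 MFObj_closed[OF F that] by (simp add: restrict_multifunctor_cong_iff)
  have m: "map (MFObj G' \<circ> (MFObj F' \<circ> MFObj F)) Xs = map (MFObj F) Xs" if "Xs \<in> lists (MObj M)" for Xs
    using that * by auto
  have a: "MFArr G' (map (MFObj F') (map (MFObj F) Xs)) (MFObj F' (MFObj F Y)) (MFArr F' (map (MFObj F) Xs) (MFObj F Y) (MFArr F Xs Y f)) =
      MFArr F Xs Y f" if "Xs \<in> lists (MObj M)" "Y \<in> MObj M" "f \<in> MHom M Xs Y" for Xs Y f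
    using 2 MFObj_lists_closed[OF F that(1)] MFObj_closed[OF F that(2)] MFArr_closed[OF F that]
    by (simp add: restrict_multifunctor_cong_iff del: map_map)
  show ?thesis
    using 1 m a * by (simp add: restrict_multifunctor_cong_iff comp_def del: map_eq_conv)
qed

lemma cartesian_iso_trans:
  assumes "cartesian_iso M N F G" "cartesian_iso N P F' G'"
  shows "cartesian_iso M P (comp_multifunctor F' F) (comp_multifunctor G G')"
  using assms unfolding cartesian_iso_def
  by (auto intro: cartesian_multifunctor_comp retract_trans cartesian_multifunctorD(1))

text \<open>Transport of structure along an injection \<open>e\<close>: the operations decode their
  arguments, act in \<open>M\<close> and encode the result. The arrows are only those in the image
  of \<open>e\<close>, where \<open>inv_into UNIV e\<close> is a genuine inverse.\<close>

definition relabel :: "('m \<Rightarrow> 'n) \<Rightarrow> ('o, 'm) cartesian_multicategory \<Rightarrow> ('o, 'n) cartesian_multicategory" where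
  "relabel e M =
    \<lparr>MObj = MObj M,
     MHom = (\<lambda>As B. e ` MHom M As B),
     MIdent = (\<lambda>A. e (MIdent M A)),
     MComp = (\<lambda>\<Gamma>s As B f fs. e (MComp M \<Gamma>s As B (inv_into UNIV e f) (map (inv_into UNIV e) fs))),
     Act = (\<lambda>Bs D \<sigma> f. e (Act M Bs D \<sigma> (inv_into UNIV e f)))\<rparr>"

definition relabel_arrows :: "('m \<Rightarrow> 'n) \<Rightarrow> ('o, 'm, 'o, 'n) multifunctor_data" where
  "relabel_arrows e = \<lparr>MFObj = (\<lambda>A. A), MFArr = (\<lambda>As B f. e f)\<rparr>"

lemma relabel_arrows_simps [simp]:
  "MFObj (relabel_arrows e) = (\<lambda>A. A)"
  "MFArr (relabel_arrows e) As B f = e f"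
  by (simp_all add: relabel_arrows_def)

lemma MObj_relabel [simp]: "MObj (relabel e M) = MObj M"
  and MHom_relabel [simp]: "MHom (relabel e M) As B = e ` MHom M As B"
  by (simp_all add: relabel_def)

lemma map_arrows_relabel:
  "length fs = length As \<Longrightarrow> map_arrows (relabel_arrows e) \<Gamma>s As fs = map e fs"
  by (auto intro!: nth_equalityI)

lemma cartesian_iso_relabel:
  assumes "inj e"
  shows "cartesian_iso M (relabel e M) (relabel_arrows e) (relabel_arrows (inv_into UNIV e))"
proof -
  have [simp]: "map (inv_into UNIV e) (map e fs) = fs" for fs
    using assms by (simp add: comp_def)
  have 1: "is_multifunctor M (relabel e M) (relabel_arrows e)"
  proof (rule is_multifunctorI, goal_cases)
    case (4 \<Gamma>s As B f fs)
    then have "length fs = length As" by (simp add: MHoms_def)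
    then show ?case using assms by (simp add: map_arrows_relabel relabel_def comp_def)
  qed (auto simp: relabel_def)
  have 2: "is_multifunctor (relabel e M) M (relabel_arrows (inv_into UNIV e))"
  proof (rule is_multifunctorI, goal_cases)
    case (4 \<Gamma>s As B f fs)
    then have "length fs = length As" by (simp add: MHoms_def)
    then show ?case using assms by (simp add: map_arrows_relabel relabel_def comp_def)
  qed (use assms in \<open>auto simp: relabel_def\<close>)
  show ?thesis
    using 1 2 assms
    by (auto simp: cartesian_iso_def cartesian_multifunctor_def restrict_multifunctor_cong_iff relabel_def)
qed

lemma cartesian_multicategory_iso:
  "cartesian_multicategory M \<Longrightarrow> cartesian_iso M N F G \<Longrightarrow> cartesian_multicategory N"
  by (rule cartesian_multicategory_retract[of M N G F]) (auto simp: cartesian_iso_def)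

lemma is_iso_fpSeq:
  assumes M: "M \<in> Obj fpSeq" and N: "N \<in> Obj fpSeq" and FG: "cartesian_iso M N F G"
  shows "is_iso fpSeq M N (restrict_multifunctor M F)"
proof -
  have mF: "is_multifunctor M N F" and mG: "is_multifunctor N M G"
    using FG by (auto simp: cartesian_iso_def cartesian_multifunctor_def)
  have cM: "cartesian_multicategory M" and cN: "cartesian_multicategory N"
    using M N by (auto simp: fpSeq_def full_subcategory_def fpMlt_def)
  have "restrict_multifunctor M (comp_multifunctor (restrict_multifunctor N G) (restrict_multifunctor M F)) =
      restrict_multifunctor M id_multifunctor"
    using FG MFObj_closed[OF mF] MFObj_lists_closed[OF mF] MFArr_closed[OF mF]
    by (simp add: cartesian_iso_def restrict_multifunctor_cong_iff)
  moreover have "restrict_multifunctor N (comp_multifunctor (restrict_multifunctor M F) (restrict_multifunctor N G)) =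
      restrict_multifunctor N id_multifunctor"
    using FG MFObj_closed[OF mG] MFObj_lists_closed[OF mG] MFArr_closed[OF mG]
    by (simp add: cartesian_iso_def restrict_multifunctor_cong_iff)
  ultimately show ?thesis
    using FG cartesian_multifunctor_restrict[OF cM] cartesian_multifunctor_restrict[OF cN]
    unfolding is_iso_def fpSeq_def full_subcategory_def fpMlt_def
    by (auto simp: cartesian_iso_def intro!: exI[of _ "restrict_multifunctor N G"])
qed


section \<open>The functor from preadditive categories\<close>

text \<open>The domains of the composition that isolates place \<open>j\<close>. At every other
  place stands the empty list, from which the empty tuple is an arrow to any object;
  \<open>pick_arrows\<close> lists the arrows.\<close>

definition pick_objects :: "nat \<Rightarrow> 'o list \<Rightarrow> 'o list list" where
  "pick_objects j Xs = map (\<lambda>i. if i = j then [Xs ! i] else []) [0..<length Xs]"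

definition pick_arrows :: "('o, 'a, 'z) category_scheme \<Rightarrow> nat \<Rightarrow> 'o list \<Rightarrow> 'a list list" where
  "pick_arrows C j Xs = map (\<lambda>i. if i = j then [Ident C (Xs ! i)] else []) [0..<length Xs]"

lemma concat_map_if: "concat (map (\<lambda>i. if P i then [g i] else []) xs) = map g (filter P xs)"
  by (induction xs) auto

lemma filter_eq_upt: "j < n \<Longrightarrow> filter (\<lambda>i. i = j) [0..<n] = [j]"
  by (induction n) (auto simp: less_Suc_eq filter_empty_conv)

lemma concat_pick_objects: "j < length Xs \<Longrightarrow> concat (pick_objects j Xs) = [Xs ! j]"
  by (simp add: pick_objects_def concat_map_if filter_eq_upt)

lemma pick_objects_in_lists:
  "Xs \<in> lists A \<Longrightarrow> pick_objects j Xs \<in> lists (lists A)"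
  by (auto simp: pick_objects_def in_lists_conv_set)

lemma length_pick_objects [simp]: "length (pick_objects j Xs) = length Xs"
  by (simp add: pick_objects_def)

lemma nth_pick_objects [simp]:
  "i < length Xs \<Longrightarrow> pick_objects j Xs ! i = (if i = j then [Xs ! i] else [])"
  by (simp add: pick_objects_def)

lemma map_pick_objects: "map (map h) (pick_objects j Xs) = pick_objects j (map h Xs)"
  by (auto simp: pick_objects_def)

lemma pick_arrows_closed:
  "category C \<Longrightarrow> Xs \<in> lists (Obj C)
    \<Longrightarrow> pick_arrows C j Xs \<in> MHoms (seq_multicategory C) (pick_objects j Xs) Xs"
  by (auto simp: MHoms_seq pick_arrows_def nth_in_lists category.Ident_closed)

lemma MComp_pick:
  assumes C: "category C" and "Xs \<in> lists (Obj C)" "D \<in> Obj C" "j < length Xs"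
    "f \<in> MHom (seq_multicategory C) Xs D"
  shows "MComp (seq_multicategory C) (pick_objects j Xs) Xs D f (pick_arrows C j Xs) = [f ! j]"
proof -
  have "MComp (seq_multicategory C) (pick_objects j Xs) Xs D f (pick_arrows C j Xs) =
      concat (map (\<lambda>i. if i = j then [Comp C (Xs ! i) (Xs ! i) D (f ! i) (Ident C (Xs ! i))] else [])
        [0..<length Xs])"
    by (auto simp: seq_multicategory_def pick_arrows_def intro!: arg_cong[of _ _ concat])
  also have "\<dots> = [f ! j]"
    using assms by (simp add: concat_map_if filter_eq_upt MHom_seq nth_in_lists category.Comp_Ident_right)
  finally show ?thesis .
qed

definition seq_multifunctor :: "('o, 'a, 'p, 'b) functor_data \<Rightarrow> ('o, 'a list, 'p, 'b list) multifunctor_data" where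
  "seq_multifunctor F =
    \<lparr>MFObj = FObj F, MFArr = (\<lambda>As B f. map (\<lambda>i. FArr F (As ! i) B (f ! i)) [0..<length As])\<rparr>"

lemma seq_multifunctor_simps [simp]:
  "MFObj (seq_multifunctor F) = FObj F"
  "length (MFArr (seq_multifunctor F) As B f) = length As"
  "i < length As \<Longrightarrow> MFArr (seq_multifunctor F) As B f ! i = FArr F (As ! i) B (f ! i)"
  by (simp_all add: seq_multifunctor_def)

lemma seq_cartesian_simps [simp]:
  "MObj (seq_cartesian C) = Obj C"
  "MHom (seq_cartesian C) = MHom (seq_multicategory C)"
  "MHoms (seq_cartesian C) = MHoms (seq_multicategory C)"
  "MIdent (seq_cartesian C) X = [Ident C X]"
  "MComp (seq_cartesian C) = MComp (seq_multicategory C)"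
  "Act (seq_cartesian C) = sum_action C"
  by (simp_all add: seq_cartesian_def)

lemma is_multifunctor_with_action [simp]:
  "is_multifunctor (with_action M act) N F = is_multifunctor M N F"
  "is_multifunctor M' (with_action N' act') F = is_multifunctor M' N' F"
  by (simp_all add: is_multifunctor_def)

lemma is_multifunctor_seq_multifunctor:
  assumes "category C" "is_functor C D F"
  shows "is_multifunctor (seq_multicategory C) (seq_multicategory D) (seq_multifunctor F)"
proof (rule is_multifunctorI, goal_cases)
  case (1 A)
  then show ?case using assms by (simp add: is_functor_def)
next
  case (2 As B f)
  then show ?case using assms by (simp add: is_functor_def MHom_seq nth_in_lists)
next
  case (3 A)
  then show ?case using assms by (simp add: is_functor_def seq_multifunctor_def)
next
  case (4 \<Gamma>s As B f fs)
  then have l: "length \<Gamma>s = length As" "length fs = length As" by (simp_all add: MHoms_seq)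
  have ml: "map length (map (map (FObj F)) \<Gamma>s) = map length \<Gamma>s" by (simp add: comp_def)
  show ?case
  proof (rule eq_if_blocks_eq[of _ "map length \<Gamma>s"])
    fix i k assume "i < length (map length \<Gamma>s)" "k < map length \<Gamma>s ! i"
    then have i: "i < length As" "i < length \<Gamma>s" and k: "k < length (\<Gamma>s ! i)" using l by simp_all
    then have p: "sum_list (take i (map length \<Gamma>s)) + k < length (concat \<Gamma>s)"
      unfolding length_concat by (intro offset_less) simp_all
    have "\<Gamma>s ! i \<in> lists (Obj C)" using 4(1) i by (simp only: nth_in_lists MObj_seq)
    then have "\<Gamma>s ! i ! k \<in> Obj C" "As ! i \<in> Obj C" "B \<in> Obj C" "fs ! i ! k \<in> Hom C (\<Gamma>s ! i ! k) (As ! i)"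
      "f ! i \<in> Hom C (As ! i) B"
      using 4 i k by (simp_all add: nth_in_lists MHoms_seq MHom_seq)
    then show "MFArr (seq_multifunctor F) (concat \<Gamma>s) B (MComp (seq_multicategory C) \<Gamma>s As B f fs) !
          (sum_list (take i (map length \<Gamma>s)) + k) =
        MComp (seq_multicategory D) (map (map (MFObj (seq_multifunctor F))) \<Gamma>s)
          (map (MFObj (seq_multifunctor F)) As) (MFObj (seq_multifunctor F) B)
          (MFArr (seq_multifunctor F) As B f) (map_arrows (seq_multifunctor F) \<Gamma>s As fs) !
          (sum_list (take i (map length \<Gamma>s)) + k)"
      using assms p i k l
      by (simp add: nth_concat_offset nth_MComp_seq nth_MComp_seq[OF _ ml[symmetric]] is_functor_def)
  qed (use l in \<open>simp_all add: length_concat length_MComp_seq comp_def\<close>)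
qed

text \<open>The entries of an acted-on tuple are sums over fibres, and an additive functor preserves
  finite sums, including the empty one.\<close>

lemma cartesian_multifunctor_seq_multifunctor:
  assumes C: "preadditive_category C" and D: "preadditive_category D" and F: "additive_functor C D F"
  shows "cartesian_multifunctor (seq_cartesian C) (seq_cartesian D) (seq_multifunctor F)"
proof -
  interpret C: preadditive_category C by (rule C)
  interpret D: preadditive_category D by (rule D)
  have F': "is_functor C D F" using F by (simp add: additive_functor_def)
  have "MFArr (seq_multifunctor F) Bs Y (sum_action C Bs Y \<sigma> f) =
      sum_action D (map (FObj F) Bs) (FObj F Y) \<sigma> (MFArr (seq_multifunctor F) (reindex Bs \<sigma>) Y f)"
    if *: "Bs \<in> lists (Obj C)" "Y \<in> Obj C" "is_mapping (length Bs) \<sigma>"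
      "f \<in> MHom (seq_multicategory C) (reindex Bs \<sigma>) Y" for Bs Y \<sigma> f
  proof (rule nth_equalityI)
    fix j assume "j < length (MFArr (seq_multifunctor F) Bs Y (sum_action C Bs Y \<sigma> f))"
    then have j: "j < length Bs" and X: "Bs ! j \<in> Obj C" using * by (simp_all add: nth_in_lists)
    let ?I = "{i. i < length \<sigma> \<and> \<sigma> ! i = j}"
    have f: "f ! i \<in> Hom C (Bs ! j) Y" if "i \<in> ?I" for i
      using *(4) that by (auto simp: MHom_seq)
    have FY: "FObj F (Bs ! j) \<in> Obj D" "FObj F Y \<in> Obj D"
      using F' X *(2) by (simp_all add: is_functor_def)
    have "FArr F (Bs ! j) Y (finprod (hom_monoid C (Bs ! j) Y) ((!) f) ?I) =
        finprod (hom_monoid D (FObj F (Bs ! j)) (FObj F Y)) (\<lambda>i. FArr F (Bs ! j) Y (f ! i)) ?I"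
      using X *(2) F FY f
      by (intro hom_finprod) (auto simp: C.comm_monoid_hom D.comm_monoid_hom hom_def additive_functor_def is_functor_def)
    also have "\<dots> = finprod (hom_monoid D (FObj F (Bs ! j)) (FObj F Y))
        ((!) (MFArr (seq_multifunctor F) (reindex Bs \<sigma>) Y f)) ?I"
      using X *(2) F' f FY by (intro D.sum_cong) (auto simp: is_functor_def)
    finally show "MFArr (seq_multifunctor F) Bs Y (sum_action C Bs Y \<sigma> f) ! j =
        sum_action D (map (FObj F) Bs) (FObj F Y) \<sigma> (MFArr (seq_multifunctor F) (reindex Bs \<sigma>) Y f) ! j"
      using j by simp
  qed simp
  then show ?thesis
    using is_multifunctor_seq_multifunctor[OF C.category_axioms F']
    by (simp add: cartesian_multifunctor_def) (simp add: seq_cartesian_def)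
qed

section \<open>Recovering an additive functor from a multifunctor on tuples\<close>

context preadditive_category
begin

text \<open>Zero is the action of the mapping from no place to one place, and addition, in the next
  lemma, that of the mapping from two places to one. Whatever preserves the action thus preserves
  both.\<close>

lemma sum_action_nil:
  assumes "X \<in> Obj C" "Y \<in> Obj C"
  shows "sum_action C [X] Y [] fs = [Zero C X Y]"
proof -
  interpret comm_monoid "hom_monoid C X Y" by (rule comm_monoid_hom[OF assms])
  show ?thesis by (simp add: sum_action_def)
qed

lemma sum_action_pair:
  assumes "X \<in> Obj C" "Y \<in> Obj C" "f \<in> Hom C X Y" "g \<in> Hom C X Y"
  shows "sum_action C [X] Y [0, 0] [f, g] = [Add C X Y f g]"
proof -
  interpret comm_monoid "hom_monoid C X Y" by (rule comm_monoid_hom[OF assms(1,2)])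
  have "{i. i < length [0 :: nat, 0] \<and> [0 :: nat, 0] ! i = 0} = {0, Suc 0}"
    by (auto simp: less_Suc_eq)
  then show ?thesis
    using assms r_one[of g] by (simp add: sum_action_def Pi_iff)
qed

end

text \<open>A unary arrow of the multicategory of tuples is a list of length one; \<open>hd\<close>
  removes this wrapping.\<close>

definition unary_functor :: "('o, 'a list, 'p, 'b list) multifunctor_data \<Rightarrow> ('o, 'a, 'p, 'b) functor_data" where
  "unary_functor H = \<lparr>FObj = MFObj H, FArr = (\<lambda>X Y f. hd (MFArr H [X] Y [f]))\<rparr>"

lemma unary_functor_simps [simp]:
  "FObj (unary_functor H) = MFObj H"
  "FArr (unary_functor H) X Y f = hd (MFArr H [X] Y [f])"
  by (simp_all add: unary_functor_def)

text \<open>Apply \<open>H\<close> to the composition that isolates entry \<open>j\<close>.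
  Identities are preserved, and an empty tuple goes to an arrow from \<open>[]\<close>, hence to the
  empty tuple, so the result isolates entry \<open>j\<close> of the image.\<close>

lemma multifunctor_eq_seq_multifunctor_unary_functor:
  assumes C: "category C" and D: "category D"
    and H: "is_multifunctor (seq_multicategory C) (seq_multicategory D) H"
    and *: "Xs \<in> lists (Obj C)" "Y \<in> Obj C" "f \<in> MHom (seq_multicategory C) Xs Y"
  shows "MFArr H Xs Y f = MFArr (seq_multifunctor (unary_functor H)) Xs Y f"
proof (rule nth_equalityI)
  let ?C = "seq_multicategory C" and ?D = "seq_multicategory D" and ?m = "map (MFObj H)"
  have Hf: "MFArr H Xs Y f \<in> MHom ?D (?m Xs) (MFObj H Y)"
    using MFArr_closed[OF H, of Xs Y f] * by simp
  then show "length (MFArr H Xs Y f) = length (MFArr (seq_multifunctor (unary_functor H)) Xs Y f)"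
    by (simp add: MHom_seq)
  fix j assume "j < length (MFArr H Xs Y f)"
  then have j: "j < length Xs" using Hf by (simp add: MHom_seq)
  have nil: "MFArr H [] X [] = []" if "X \<in> Obj C" for X
    using MFArr_closed[OF H, of "[]" X "[]"] that by (simp add: MHom_seq)
  have pk: "map_arrows H (pick_objects j Xs) Xs (pick_arrows C j Xs) = pick_arrows D j (?m Xs)"
    using MFArr_MIdent[OF H] nil *(1) by (auto simp: pick_arrows_def nth_in_lists intro!: nth_equalityI)
  have "MFArr H [Xs ! j] Y [f ! j] =
      MFArr H (concat (pick_objects j Xs)) Y (MComp ?C (pick_objects j Xs) Xs Y f (pick_arrows C j Xs))"
    using j * by (simp add: MComp_pick[OF C] concat_pick_objects)
  also have "\<dots> = MComp ?D (pick_objects j (?m Xs)) (?m Xs) (MFObj H Y) (MFArr H Xs Y f)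
      (pick_arrows D j (?m Xs))"
    using MFArr_MComp[OF H, of "pick_objects j Xs" Xs Y f "pick_arrows C j Xs"] *
      pick_arrows_closed[OF C *(1)] pick_objects_in_lists[OF *(1)]
    by (simp add: pk map_pick_objects)
  also have "\<dots> = [MFArr H Xs Y f ! j]"
    using MFObj_lists_closed[OF H] MFObj_closed[OF H] * Hf j by (intro MComp_pick[OF D]) simp_all
  finally show "MFArr H Xs Y f ! j = MFArr (seq_multifunctor (unary_functor H)) Xs Y f ! j"
    using j by simp
qed

text \<open>For sums, \<open>H\<close> is applied to the action of \<open>[0, 0]\<close> on
  \<open>[f, g]\<close>; since \<open>H\<close> works entrywise on \<open>[f, g]\<close>, the action
  on the other side has the images of \<open>f\<close> and \<open>g\<close> as its arguments. For
  zero, the empty tuple plays this part.\<close>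

lemma additive_functor_unary_functor:
  assumes C: "preadditive_category C" and D: "preadditive_category D"
    and H: "cartesian_multifunctor (seq_cartesian C) (seq_cartesian D) H"
  shows "additive_functor C D (unary_functor H)"
proof -
  interpret C: preadditive_category C by (rule C)
  interpret D: preadditive_category D by (rule D)
  have mH: "is_multifunctor (seq_multicategory C) (seq_multicategory D) H"
    using cartesian_multifunctorD(1)[OF H] by (simp add: seq_cartesian_def)
  note act = cartesian_multifunctorD(2)[OF H, unfolded seq_cartesian_simps]
  have O: "MFObj H X \<in> Obj D" if "X \<in> Obj C" for X
    using MFObj_closed[OF mH] that by simp
  have u: "MFArr H [X] Y [f] = [hd (MFArr H [X] Y [f])]" "hd (MFArr H [X] Y [f]) \<in> Hom D (MFObj H X) (MFObj H Y)"
    if "X \<in> Obj C" "Y \<in> Obj C" "f \<in> Hom C X Y" for X Y f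
    using MFArr_closed[OF mH, of "[X]" Y "[f]"] that
    by (auto simp: MHom_seq length_Suc_conv)
  have u0: "MFArr H [X] Y [f] ! 0 = hd (MFArr H [X] Y [f])"
    if "X \<in> Obj C" "Y \<in> Obj C" "f \<in> Hom C X Y" for X Y f
    using u(1)[OF that] by (metis nth_Cons_0)
  have eq: "MFArr H Xs Y f = MFArr (seq_multifunctor (unary_functor H)) Xs Y f"
    if "Xs \<in> lists (Obj C)" "Y \<in> Obj C" "f \<in> MHom (seq_multicategory C) Xs Y" for Xs Y f
    by (rule multifunctor_eq_seq_multifunctor_unary_functor[OF C.category_axioms D.category_axioms mH that])
  have comp: "MFArr H [X] Z [Comp C X Y Z g f] =
      [Comp D (MFObj H X) (MFObj H Y) (MFObj H Z) (hd (MFArr H [Y] Z [g])) (hd (MFArr H [X] Y [f]))]"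
    if *: "X \<in> Obj C" "Y \<in> Obj C" "Z \<in> Obj C" "f \<in> Hom C X Y" "g \<in> Hom C Y Z" for X Y Z f g
  proof -
    have "MFArr H (concat [[X]]) Z (MComp (seq_multicategory C) [[X]] [Y] Z [g] [[f]]) =
        MComp (seq_multicategory D) [[MFObj H X]] [MFObj H Y] (MFObj H Z) (MFArr H [Y] Z [g]) [MFArr H [X] Y [f]]"
      using MFArr_MComp[OF mH, of "[[X]]" "[Y]" Z "[g]" "[[f]]"] *
      by (simp add: MHom_seq MHoms_seq map_arrows_def)
    then show ?thesis
      using u0[OF *(1,2,4)] u0[OF *(2,3,5)] by (simp add: seq_multicategory_def)
  qed
  have zero: "MFArr H [X] Y [Zero C X Y] = [Zero D (MFObj H X) (MFObj H Y)]"
    if *: "X \<in> Obj C" "Y \<in> Obj C" for X Y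
  proof -
    show ?thesis
      using act[of "[X]" Y "[]" "[]"] eq[of "[]" Y "[]"] * O
      by (simp add: is_mapping_def MHom_seq reindex_def C.sum_action_nil D.sum_action_nil)
  qed
  have add: "MFArr H [X] Y [Add C X Y f g] =
      [Add D (MFObj H X) (MFObj H Y) (hd (MFArr H [X] Y [f])) (hd (MFArr H [X] Y [g]))]"
    if *: "X \<in> Obj C" "Y \<in> Obj C" "f \<in> Hom C X Y" "g \<in> Hom C X Y" for X Y f g
  proof -
    have "[f, g] \<in> MHom (seq_multicategory C) (reindex [X] [0, 0]) Y"
      using * by (simp add: MHom_seq reindex_def less_Suc_eq)
    then have "MFArr H [X] Y (sum_action C [X] Y [0, 0] [f, g]) =
        sum_action D [MFObj H X] (MFObj H Y) [0, 0] [hd (MFArr H [X] Y [f]), hd (MFArr H [X] Y [g])]"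
      using act[of "[X]" Y "[0, 0]" "[f, g]"] eq[of "[X, X]" Y "[f, g]"] *
      by (simp add: is_mapping_def reindex_def seq_multifunctor_def)
    then show ?thesis
      using * O u(2) by (simp add: C.sum_action_pair D.sum_action_pair)
  qed
  show ?thesis
    unfolding additive_functor_def is_functor_def unary_functor_simps
    using O u MFArr_MIdent[OF mH] by (simp add: comp zero add)
qed


section \<open>Cartesian structures on lists of arrows\<close>

text \<open>A list in the order of the indices: for an arbitrary action, the sum of a fibre is not
  yet known to be independent of the order.\<close>

definition fibre :: "nat \<Rightarrow> nat list \<Rightarrow> 'a list \<Rightarrow> 'a list" where
  "fibre j \<sigma> fs = map ((!) fs) (filter (\<lambda>i. \<sigma> ! i = j) [0..<length \<sigma>])"

text \<open>A form that the simplifier can evaluate on explicit lists.\<close>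

lemma fibre_zip:
  assumes "length \<sigma> = length fs"
  shows "fibre j \<sigma> fs = map snd (filter (\<lambda>p. fst p = j) (zip \<sigma> fs))"
proof -
  have "zip \<sigma> fs = map (\<lambda>i. (\<sigma> ! i, fs ! i)) [0..<length \<sigma>]"
    using assms by (auto intro!: nth_equalityI)
  then show ?thesis
    by (simp add: fibre_def filter_map comp_def)
qed

lemma length_filter_fibre: "length (filter (\<lambda>i. i = j) \<sigma>) = length (fibre j \<sigma> fs)"
proof -
  have "filter (\<lambda>i. i = j) (map ((!) \<sigma>) [0..<length \<sigma>]) = map ((!) \<sigma>) (filter (\<lambda>i. \<sigma> ! i = j) [0..<length \<sigma>])"
    by (simp add: filter_map comp_def)
  then show ?thesis by (simp add: fibre_def map_nth)
qed

locale sequential_action = category C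
  for C :: "('o, 'a) category" and act :: "'o list \<Rightarrow> 'o \<Rightarrow> nat list \<Rightarrow> 'a list \<Rightarrow> 'a list" +
  assumes cartesian: "cartesian_multicategory (with_action (seq_multicategory C) act)"
begin

abbreviation "M \<equiv> seq_multicategory C"

sublocale M: cartesian_multicategory "with_action M act"
  rewrites "MObj (with_action M act) = Obj C" and "MHom (with_action M act) = MHom M"
    and "MHoms (with_action M act) = MHoms M" and "MComp (with_action M act) = MComp M"
    and "Act (with_action M act) = act"
  by (simp_all add: cartesian)

text \<open>The list \<open>replicate n 0\<close> is the unique mapping from \<open>n\<close> places
  to one. The value on \<open>[]\<close> will be the zero, the value on a list of length two the sum
  of its entries.\<close>

definition hom_total :: "'o \<Rightarrow> 'o \<Rightarrow> 'a list \<Rightarrow> 'a" where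
  "hom_total X Y fs = hd (act [X] Y (replicate (length fs) 0) fs)"

lemma MHom_replicate:
  "fs \<in> MHom M (replicate n X) Y \<longleftrightarrow> length fs = n \<and> set fs \<subseteq> Hom C X Y"
  by (auto simp: MHom_seq subset_iff in_set_conv_nth)

lemma is_mapping_replicate: "k < m \<Longrightarrow> is_mapping m (replicate n k)"
  by (auto simp: is_mapping_def)

lemma reindex_replicate: "reindex [X] (replicate n 0) = replicate n X"
  by (simp add: reindex_def)

lemma
  assumes "X \<in> Obj C" "Y \<in> Obj C" "set fs \<subseteq> Hom C X Y"
  shows act_replicate: "act [X] Y (replicate (length fs) 0) fs = [hom_total X Y fs]"
    and hom_total_closed: "hom_total X Y fs \<in> Hom C X Y"
proof -
  have "act [X] Y (replicate (length fs) 0) fs \<in> MHom M [X] Y"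
    using assms by (intro M.Act_closed) (simp_all add: is_mapping_replicate reindex_replicate MHom_replicate)
  then show "act [X] Y (replicate (length fs) 0) fs = [hom_total X Y fs]" "hom_total X Y fs \<in> Hom C X Y"
    by (auto simp: hom_total_def MHom_seq length_Suc_conv)
qed

text \<open>Compatibility with composition in the outer arrow, applied to the composition that
  isolates place \<open>j\<close>. One side is entry \<open>j\<close> of the acted-on tuple. On the
  other side only the blocks over \<open>j\<close> are nonempty, with one place each, which leaves
  the mapping to a single place acting on the fibre.\<close>

lemma act_eq:
  assumes Bs: "Bs \<in> lists (Obj C)" and D: "D \<in> Obj C" and \<sigma>: "is_mapping (length Bs) \<sigma>"
    and f: "f \<in> MHom M (reindex Bs \<sigma>) D"
  shows "act Bs D \<sigma> f = map (\<lambda>j. hom_total (Bs ! j) D (fibre j \<sigma> f)) [0..<length Bs]"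
proof (rule nth_equalityI)
  have a: "act Bs D \<sigma> f \<in> MHom M Bs D" by (rule M.Act_closed[OF assms])
  then show "length (act Bs D \<sigma> f) = length (map (\<lambda>j. hom_total (Bs ! j) D (fibre j \<sigma> f)) [0..<length Bs])"
    by (simp add: MHom_seq)
  fix j assume "j < length (act Bs D \<sigma> f)"
  then have j: "j < length Bs" using a by (simp add: MHom_seq)
  have X: "Bs ! j \<in> Obj C" using j Bs by (simp add: nth_in_lists)
  define ks where "ks = map length (pick_objects j Bs)"
  have ks: "ks ! i = (if i = j then 1 else 0)" if "i < length Bs" for i
    using that by (simp add: ks_def)
  \<comment> \<open>The blocks before \<open>j\<close> are empty, so the one place of block
    \<open>j\<close> has position 0 in the concatenation.\<close>
  have "take j ks = replicate j 0"
    using j by (auto simp: ks_def intro!: nth_equalityI)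
  then have off: "sum_list (take j ks) = 0" by simp
  have "block_mapping ks \<sigma> = concat (map (\<lambda>i. if i = j then [0] else []) \<sigma>)"
    unfolding block_mapping_def using \<sigma> by (auto simp: ks off is_mapping_def subset_iff intro!: arg_cong[of _ _ concat])
  also have "\<dots> = replicate (length (fibre j \<sigma> f)) 0"
    by (simp add: concat_map_if map_replicate_const length_filter_fibre[of _ _ f])
  finally have bm: "block_mapping ks \<sigma> = replicate (length (fibre j \<sigma> f)) 0" .
  have "MComp M (reindex (pick_objects j Bs) \<sigma>) (reindex Bs \<sigma>) D f (reindex (pick_arrows C j Bs) \<sigma>) =
      concat (map (\<lambda>i. if \<sigma> ! i = j then [f ! i] else []) [0..<length \<sigma>])"
    using f D X is_mapping_nth[OF \<sigma>]
    by (auto simp: seq_multicategory_def pick_arrows_def MHom_seq Comp_Ident_right intro!: arg_cong[of _ _ concat])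
  also have "\<dots> = fibre j \<sigma> f"
    by (simp add: concat_map_if fibre_def)
  finally have comp: "MComp M (reindex (pick_objects j Bs) \<sigma>) (reindex Bs \<sigma>) D f
      (reindex (pick_arrows C j Bs) \<sigma>) = fibre j \<sigma> f" .
  have fib: "set (fibre j \<sigma> f) \<subseteq> Hom C (Bs ! j) D"
    using f by (auto simp: fibre_def MHom_seq)
  have "[act Bs D \<sigma> f ! j] = MComp M (pick_objects j Bs) Bs D (act Bs D \<sigma> f) (pick_arrows C j Bs)"
    using MComp_pick[OF category_axioms Bs D j a] by simp
  also have "\<dots> = act (concat (pick_objects j Bs)) D (block_mapping ks \<sigma>) (fibre j \<sigma> f)"
    using M.MComp_Act_outer[OF pick_objects_in_lists[OF Bs] Bs D \<sigma> f pick_arrows_closed[OF category_axioms Bs]]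
    by (simp add: comp ks_def)
  also have "\<dots> = [hom_total (Bs ! j) D (fibre j \<sigma> f)]"
    using act_replicate[OF X D fib] j by (simp add: concat_pick_objects bm)
  finally show "act Bs D \<sigma> f ! j = map (\<lambda>j. hom_total (Bs ! j) D (fibre j \<sigma> f)) [0..<length Bs] ! j"
    using j by simp
qed

section \<open>The laws of the sums on hom-sets\<close>

lemma hom_total_single:
  assumes "X \<in> Obj C" "Y \<in> Obj C" "f \<in> Hom C X Y"
  shows "hom_total X Y [f] = f"
  using M.Act_id[of "[X]" Y "[f]"] assms by (simp add: hom_total_def MHom_seq)

text \<open>Functoriality of the action for \<open>\<sigma>\<close> followed by the mapping from
  \<open>m\<close> places to one; the composite is again the mapping to one place. The monoid laws
  are obtained from the case of two fibres.\<close>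

lemma hom_total_partition:
  assumes "X \<in> Obj C" "Y \<in> Obj C" "set fs \<subseteq> Hom C X Y" "is_mapping m \<sigma>" "length \<sigma> = length fs"
  shows "hom_total X Y fs = hom_total X Y (map (\<lambda>j. hom_total X Y (fibre j \<sigma> fs)) [0..<m])"
proof -
  have r': "reindex (replicate m c) \<sigma> = replicate (length fs) c" for c :: nat
    using assms(4,5) by (auto intro!: nth_equalityI simp: is_mapping_nth)
  have r'': "reindex (replicate m c) \<sigma> = replicate (length fs) c" for c :: 'o
    using assms(4,5) by (auto intro!: nth_equalityI simp: is_mapping_nth)
  have fs: "fs \<in> MHom M (reindex (replicate m X) \<sigma>) Y"
    using assms by (simp add: r'' MHom_replicate)
  have "act (replicate m X) Y \<sigma> fs = map (\<lambda>j. hom_total X Y (fibre j \<sigma> fs)) [0..<m]" (is "_ = ?ts")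
    using act_eq[of "replicate m X" Y \<sigma> fs] assms fs by (simp add: in_lists_conv_set)
  moreover have "act [X] Y (replicate m 0) (act (reindex [X] (replicate m 0)) Y \<sigma> fs) =
      act [X] Y (reindex (replicate m 0) \<sigma>) fs"
    using assms fs by (intro M.Act_comp) (simp_all add: is_mapping_replicate reindex_replicate)
  ultimately show ?thesis
    by (simp add: reindex_replicate r' hom_total_def)
qed

text \<open>Partition into the leading place and all others. For empty \<open>fs\<close> the second
  fibre is empty, which yields the unit law.\<close>

lemma hom_total_Cons:
  assumes "X \<in> Obj C" "Y \<in> Obj C" "f \<in> Hom C X Y" "set fs \<subseteq> Hom C X Y"
  shows "hom_total X Y (f # fs) = hom_total X Y [f, hom_total X Y fs]"
proof -
  have "fibre 0 (0 # replicate (length fs) 1) (f # fs) = [f]"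
    "fibre 1 (0 # replicate (length fs) 1) (f # fs) = fs"
    by (simp_all add: fibre_zip zip_replicate1 filter_map comp_def)
  then show ?thesis
    using hom_total_partition[of X Y "f # fs" 2 "0 # replicate (length fs) 1"] assms
    by (simp add: is_mapping_def numeral_2_eq_2 hom_total_single set_replicate_conv_if)
qed

text \<open>Both sides equal the ternary sum, split once by \<open>[0, 0, 1]\<close> and once into
  head and tail.\<close>

lemma hom_total_assoc:
  assumes "X \<in> Obj C" "Y \<in> Obj C" "f \<in> Hom C X Y" "g \<in> Hom C X Y" "h \<in> Hom C X Y"
  shows "hom_total X Y [hom_total X Y [f, g], h] = hom_total X Y [f, hom_total X Y [g, h]]"
  using hom_total_partition[of X Y "[f, g, h]" 2 "[0, 0, 1]"] hom_total_Cons[of X Y f "[g, h]"] assms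
  by (simp add: is_mapping_def numeral_2_eq_2 hom_total_single fibre_zip)

text \<open>The transposition \<open>[1, 0]\<close> has one entry in each fibre, in exchanged
  order.\<close>

lemma hom_total_commute:
  assumes "X \<in> Obj C" "Y \<in> Obj C" "f \<in> Hom C X Y" "g \<in> Hom C X Y"
  shows "hom_total X Y [f, g] = hom_total X Y [g, f]"
  using hom_total_partition[of X Y "[f, g]" 2 "[1, 0]"] assms
  by (simp add: is_mapping_def numeral_2_eq_2 hom_total_single fibre_zip)

lemma hom_total_unit:
  assumes "X \<in> Obj C" "Y \<in> Obj C" "f \<in> Hom C X Y"
  shows "hom_total X Y [f, hom_total X Y []] = f"
  using hom_total_Cons[of X Y f "[]"] assms by (simp add: hom_total_single)

lemma hom_total_unit_left:
  assumes "X \<in> Obj C" "Y \<in> Obj C" "f \<in> Hom C X Y"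
  shows "hom_total X Y [hom_total X Y [], f] = f"
  using hom_total_unit[OF assms] hom_total_commute[of X Y "hom_total X Y []" f] assms by (simp add: hom_total_closed)

text \<open>Compatibility with composition in the outer arrow, for a single unary \<open>g\<close>
  inside. The only block has one place, so the block mapping is the given mapping again. Lists of
  length zero and two give the two bilinearity laws in this argument.\<close>

lemma Comp_hom_total_left:
  assumes "W \<in> Obj C" "X \<in> Obj C" "Y \<in> Obj C" "set fs \<subseteq> Hom C X Y" "g \<in> Hom C W X"
  shows "Comp C W X Y (hom_total X Y fs) g = hom_total W Y (map (\<lambda>f. Comp C W X Y f g) fs)" (is "?l = _")
proof -
  let ?\<sigma> = "replicate (length fs) 0 :: nat list"
  have "MComp M [[W]] [X] Y (act [X] Y ?\<sigma> fs) [[g]] =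
      act (concat [[W]]) Y (block_mapping (map length [[W]]) ?\<sigma>)
        (MComp M (reindex [[W]] ?\<sigma>) (reindex [X] ?\<sigma>) Y fs (reindex [[g]] ?\<sigma>))"
    using assms
    by (intro M.MComp_Act_outer) (simp_all add: is_mapping_replicate reindex_replicate MHom_replicate MHoms_seq)
  also have "block_mapping (map length [[W]]) ?\<sigma> = ?\<sigma>"
    by (simp add: block_mapping_def)
  also have "MComp M (reindex [[W]] ?\<sigma>) (reindex [X] ?\<sigma>) Y fs (reindex [[g]] ?\<sigma>) =
      concat (map (\<lambda>i. [Comp C W X Y (fs ! i) g]) [0..<length fs])"
    by (auto simp: seq_multicategory_def reindex_replicate simp del: concat_map_singleton
        intro!: arg_cong[of _ _ concat])
  also have "\<dots> = map (\<lambda>f. Comp C W X Y f g) fs"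
    by (simp add: map_nth_upt[of _ fs "\<lambda>f. Comp C W X Y f g"])
  finally have "[?l] = act [W] Y ?\<sigma> (map (\<lambda>f. Comp C W X Y f g) fs)"
    using act_replicate[of X Y fs] assms by (simp add: seq_multicategory_def)
  moreover have "set (map (\<lambda>f. Comp C W X Y f g) fs) \<subseteq> Hom C W Y"
    using assms by (auto intro!: Comp_closed)
  ultimately show ?thesis
    using act_replicate[of W Y "map (\<lambda>f. Comp C W X Y f g) fs"] assms by simp
qed

text \<open>Compatibility with composition in the inner arrows, for a unary outer arrow
  \<open>g\<close>; juxtaposing a single mapping leaves it unchanged.\<close>

lemma Comp_hom_total_right:
  assumes "X \<in> Obj C" "Y \<in> Obj C" "Z \<in> Obj C" "set fs \<subseteq> Hom C X Y" "g \<in> Hom C Y Z"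
  shows "Comp C X Y Z g (hom_total X Y fs) = hom_total X Z (map (Comp C X Y Z g) fs)" (is "?l = _")
proof -
  let ?\<sigma> = "replicate (length fs) 0 :: nat list"
  have "MComp M [[X]] [Y] Z [g]
      (map (\<lambda>i. act ([[X]] ! i) ([Y] ! i) ([?\<sigma>] ! i) ([fs] ! i)) [0..<length [Y]]) =
      act (concat [[X]]) Z (juxtapose (map length [[X]]) [?\<sigma>])
        (MComp M (map2 reindex [[X]] [?\<sigma>]) [Y] Z [g] [fs])"
    using assms
    by (intro M.MComp_Act_inner)
      (simp_all add: is_mapping_replicate reindex_replicate MHom_seq MHoms_seq subset_iff)
  also have "juxtapose (map length [[X]]) [?\<sigma>] = ?\<sigma>"
    by (simp add: juxtapose_def)
  also have "MComp M (map2 reindex [[X]] [?\<sigma>]) [Y] Z [g] [fs] = map (Comp C X Y Z g) fs"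
    by (auto simp: seq_multicategory_def reindex_replicate intro!: nth_equalityI)
  finally have "[?l] = act [X] Z ?\<sigma> (map (Comp C X Y Z g) fs)"
    using act_replicate[of X Y fs] assms by (simp add: seq_multicategory_def)
  moreover have "set (map (Comp C X Y Z g) fs) \<subseteq> Hom C X Z"
    using assms by (auto intro!: Comp_closed)
  ultimately show ?thesis
    using act_replicate[of X Z "map (Comp C X Y Z g) fs"] assms by simp
qed

section \<open>The preadditive category induced by an action\<close>

definition induced :: "('o, 'a) preadditive_category" where
  "induced = category.extend C (preadditive_category.fields (\<lambda>X Y f g. hom_total X Y [f, g]) (\<lambda>X Y. hom_total X Y []))"

lemma induced_simps [simp]:
  "Obj induced = Obj C" "Hom induced = Hom C" "Ident induced = Ident C" "Comp induced = Comp C"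
  "Add induced X Y f g = hom_total X Y [f, g]" "Zero induced X Y = hom_total X Y []"
  by (simp_all add: induced_def category.defs preadditive_category.defs)

lemma seq_multicategory_induced: "seq_multicategory induced = M"
  by (simp add: seq_multicategory_def)

lemma preadditive_category_induced: "preadditive_category induced"
proof (intro preadditive_category.intro preadditive_category_axioms.intro, goal_cases)
  case 1
  show ?case using category_axioms by (simp add: category_def)
next
  case (2 X Y)
  then show ?case
    by (intro comm_monoidI)
      (auto simp: hom_total_closed hom_total_unit_left intro: hom_total_assoc hom_total_commute)
next
  case (3 X Y Z f g g')
  then show ?case by (simp add: Comp_hom_total_left)
next
  case (4 X Y Z f)
  then show ?case by (simp add: Comp_hom_total_left)
next
  case (5 X Y Z f f' g)
  then show ?case by (simp add: Comp_hom_total_right)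
next
  case (6 X Y Z g)
  then show ?case by (simp add: Comp_hom_total_right)
qed

text \<open>Passes from sums of lists to sums over index sets, once the hom-sets are known to be
  commutative monoids. Distinctness is asked of the indices, so equal summands at different indices
  are still counted separately.\<close>

lemma hom_total_eq_finprod:
  assumes X: "X \<in> Obj C" "Y \<in> Obj C" and "distinct is" "\<And>i. i \<in> set is \<Longrightarrow> h i \<in> Hom C X Y"
  shows "hom_total X Y (map h is) = finprod (hom_monoid induced X Y) h (set is)"
  using assms(3,4)
proof (induction "is")
  case Nil
  interpret comm_monoid "hom_monoid induced X Y"
    using preadditive_category.comm_monoid_hom[OF preadditive_category_induced] X by simp
  show ?case by simp
next
  case (Cons i "is")
  interpret comm_monoid "hom_monoid induced X Y"
    using preadditive_category.comm_monoid_hom[OF preadditive_category_induced] X by simp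
  have "hom_total X Y (map h (i # is)) = hom_total X Y [h i, hom_total X Y (map h is)]"
    using hom_total_Cons[OF X, of "h i" "map h is"] Cons.prems by auto
  then show ?case using Cons by (simp add: Pi_iff)
qed

lemma act_eq_sum_action:
  assumes "Bs \<in> lists (Obj C)" "D \<in> Obj C" "is_mapping (length Bs) \<sigma>" "f \<in> MHom M (reindex Bs \<sigma>) D"
  shows "act Bs D \<sigma> f = sum_action induced Bs D \<sigma> f"
  unfolding act_eq[OF assms] sum_action_def
proof (rule map_cong[OF refl])
  fix j assume "j \<in> set [0..<length Bs]"
  then have "Bs ! j \<in> Obj C" using assms(1) by (simp add: nth_in_lists)
  moreover have "{i. i < length \<sigma> \<and> \<sigma> ! i = j} = set (filter (\<lambda>i. \<sigma> ! i = j) [0..<length \<sigma>])"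
    by auto
  ultimately show "hom_total (Bs ! j) D (fibre j \<sigma> f) =
      finprod (hom_monoid induced (Bs ! j) D) ((!) f) {i. i < length \<sigma> \<and> \<sigma> ! i = j}"
    using assms(2,4) by (simp only: fibre_def) (intro hom_total_eq_finprod; auto simp: MHom_seq)
qed

lemma cartesian_iso_induced:
  "cartesian_iso (with_action M act) (seq_cartesian induced) id_multifunctor id_multifunctor"
  by (auto simp: cartesian_iso_def cartesian_multifunctor_def seq_cartesian_def seq_multicategory_induced
      is_multifunctor_id restrict_multifunctor_cong_iff act_eq_sum_action comp_def)

end


section \<open>The equivalence\<close>

text \<open>An infinite type is equinumerous with its square, which gives a pairing
  \<open>p\<close>. Folding a list with \<open>p\<close> from a fixed start is injective on lists of
  the same length, so the length is coded alongside through an injection \<open>n\<close> of the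
  natural numbers.\<close>

lemma obtain_inj_list:
  assumes "infinite (UNIV :: 'a set)"
  obtains e :: "'a list \<Rightarrow> 'a" where "inj e"
proof -
  obtain n :: "nat \<Rightarrow> 'a" where n: "inj n"
    using assms infinite_countable_subset by blast
  obtain p :: "'a \<times> 'a \<Rightarrow> 'a" where p: "inj p"
    using card_of_ordIso[THEN iffD2, OF card_of_Times_same_infinite[OF assms]]
    by (auto simp: bij_betw_def)
  define code where "code = (\<lambda>xs. foldr (\<lambda>x y. p (x, y)) xs (n 0))"
  have code: "xs = ys" if "length xs = length ys" "code xs = code ys" for xs ys
    using that by (induction rule: list_induct2) (auto simp: code_def dest: injD[OF p])
  have "inj (\<lambda>xs. p (n (length xs), code xs))"
  proof (rule injI)
    fix xs ys assume "p (n (length xs), code xs) = p (n (length ys), code ys)"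
    from injD[OF p this] have "n (length xs) = n (length ys)" "code xs = code ys"
      by simp_all
    then show "xs = ys" using code injD[OF n] by blast
  qed
  then show thesis by (rule that)
qed

section \<open>Objects of \<open>fpSeq\<close> and tuples over preadditive categories\<close>

lemma isomorphic_seq_multicategory_if_cartesian_iso:
  "cartesian_iso M (seq_cartesian C) F G \<Longrightarrow> isomorphic_multicategories M (seq_multicategory C)"
  unfolding isomorphic_multicategories_def cartesian_iso_def cartesian_multifunctor_def
  by (intro exI[of _ F] exI[of _ G]) (auto simp: seq_cartesian_def restrict_multifunctor_cong_iff)

lemma cartesian_iso_sym: "cartesian_iso M N F G \<Longrightarrow> cartesian_iso N M G F"
  by (auto simp: cartesian_iso_def)

lemma Obj_fpSeq: "M \<in> Obj fpSeq \<longleftrightarrow> cartesian_multicategory M \<and> sequential M"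
  by (simp add: fpSeq_def full_subcategory_def fpMlt_def)

lemma Hom_fpSeq: "F \<in> Hom fpSeq M N \<longleftrightarrow> cartesian_multifunctor M N F \<and> restrict_multifunctor M F = F"
  by (simp add: fpSeq_def full_subcategory_def fpMlt_def)

lemma relabel_seq_cartesian_in_fpSeq:
  fixes e :: "'a list \<Rightarrow> 'a" and C :: "('o, 'a) preadditive_category"
  assumes e: "inj e" and C: "preadditive_category C"
  shows "relabel e (seq_cartesian C) \<in> Obj fpSeq"
proof -
  note iso = cartesian_iso_relabel[OF e, of "seq_cartesian C"]
  \<comment> \<open>The definition of \<open>sequential\<close> asks for a plain category record, so
    the additive fields are dropped; tuples and their composition do not change.\<close>
  have "category (category.truncate C)"
    using preadditive_category.axioms(1)[OF C] by (simp add: category_def category.defs)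
  moreover have "seq_multicategory (category.truncate C) = seq_multicategory C"
    by (simp add: seq_multicategory_def category.defs)
  ultimately show ?thesis
    unfolding Obj_fpSeq sequential_def
    using cartesian_multicategory_iso[OF cartesian_multicategory_seq_cartesian[OF C] iso]
      isomorphic_seq_multicategory_if_cartesian_iso[OF cartesian_iso_sym[OF iso]]
    by auto
qed

text \<open>The isomorphism \<open>P\<close>, \<open>Q\<close> supplied by \<open>sequential\<close>
  ignores the action. Conjugating the action of \<open>M\<close> with it gives \<open>act\<close> on
  tuples, chosen so that \<open>P\<close> and \<open>Q\<close> become cartesian; the laws for
  \<open>act\<close> then follow by transport, and \<open>sequential_action\<close> extracts the
  addition.\<close>

lemma fpSeq_iso_seq_cartesian:
  fixes M :: "('o, 'a) cartesian_multicategory"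
  assumes "M \<in> Obj fpSeq"
  obtains C :: "('o, 'a) preadditive_category" and F G
  where "preadditive_category C" "cartesian_iso M (seq_cartesian C) F G"
proof -
  have M: "cartesian_multicategory M" using assms by (simp add: Obj_fpSeq)
  obtain C :: "('o, 'a) category" and P Q where C: "category C"
    and P: "is_multifunctor M (seq_multicategory C) P" and Q: "is_multifunctor (seq_multicategory C) M Q"
    and QP: "restrict_multifunctor M (comp_multifunctor Q P) = restrict_multifunctor M id_multifunctor"
    and PQ: "restrict_multifunctor (seq_multicategory C) (comp_multifunctor P Q) =
      restrict_multifunctor (seq_multicategory C) id_multifunctor"
    using assms unfolding Obj_fpSeq sequential_def isomorphic_multicategories_def by blast
  interpret M: cartesian_multicategory M by (rule M)
  define act where "act = (\<lambda>Bs D \<sigma> f. MFArr P (map (MFObj Q) Bs) (MFObj Q D)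
    (Act M (map (MFObj Q) Bs) (MFObj Q D) \<sigma> (MFArr Q (reindex Bs \<sigma>) D f)))"
  let ?N = "with_action (seq_multicategory C) act"
  have cP: "cartesian_multifunctor M ?N P"
    unfolding cartesian_multifunctor_def with_action_simps is_multifunctor_with_action
  proof (intro conjI P ballI allI impI)
    fix Bs D \<sigma> f assume *: "Bs \<in> lists (MObj M)" "D \<in> MObj M" "is_mapping (length Bs) \<sigma>"
      "f \<in> MHom M (reindex Bs \<sigma>) D"
    have O: "MFObj Q (MFObj P A) = A" if "A \<in> MObj M" for A
      using QP that by (simp add: restrict_multifunctor_cong_iff)
    then have m: "map (MFObj Q) (map (MFObj P) Bs) = Bs"
      using *(1) by (auto intro!: map_idI)
    have A: "MFArr Q (map (MFObj P) (reindex Bs \<sigma>)) (MFObj P D) (MFArr P (reindex Bs \<sigma>) D f) = f"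
      using QP reindex_in_lists[OF *(1,3)] *(2,4) by (simp add: restrict_multifunctor_cong_iff)
    show "MFArr P Bs D (Act M Bs D \<sigma> f) =
        act (map (MFObj P) Bs) (MFObj P D) \<sigma> (MFArr P (reindex Bs \<sigma>) D f)"
      unfolding act_def m O[OF *(2)] reindex_map[OF *(3)] A ..
  qed
  have cQ: "cartesian_multifunctor ?N M Q"
    unfolding cartesian_multifunctor_def with_action_simps is_multifunctor_with_action
  proof (intro conjI Q ballI allI impI)
    fix Bs D \<sigma> f assume *: "Bs \<in> lists (MObj (seq_multicategory C))" "D \<in> MObj (seq_multicategory C)"
      "is_mapping (length Bs) \<sigma>" "f \<in> MHom (seq_multicategory C) (reindex Bs \<sigma>) D"
    have O: "MFObj P (MFObj Q A) = A" if "A \<in> Obj C" for A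
      using PQ that by (simp add: restrict_multifunctor_cong_iff)
    have QA: "MFObj Q D \<in> MObj M" "map (MFObj Q) Bs \<in> lists (MObj M)"
      by (rule MFObj_closed[OF Q *(2)], rule MFObj_lists_closed[OF Q *(1)])
    have "MFArr Q (reindex Bs \<sigma>) D f \<in> MHom M (reindex (map (MFObj Q) Bs) \<sigma>) (MFObj Q D)"
      using MFArr_closed[OF Q reindex_in_lists[OF *(1,3)] *(2,4)] by (simp add: reindex_map[OF *(3)])
    then have "Act M (map (MFObj Q) Bs) (MFObj Q D) \<sigma> (MFArr Q (reindex Bs \<sigma>) D f)
        \<in> MHom M (map (MFObj Q) Bs) (MFObj Q D)" (is "?a \<in> _")
      using QA *(3) by (intro M.Act_closed) simp_all
    then have "MFArr Q (map (MFObj P) (map (MFObj Q) Bs)) (MFObj P (MFObj Q D))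
        (MFArr P (map (MFObj Q) Bs) (MFObj Q D) ?a) = ?a"
      using QP QA by (simp add: restrict_multifunctor_cong_iff del: map_map)
    moreover have "map (MFObj P) (map (MFObj Q) Bs) = Bs"
      using *(1) O by (auto intro!: map_idI)
    ultimately show "MFArr Q Bs D (act Bs D \<sigma> f) =
        Act M (map (MFObj Q) Bs) (MFObj Q D) \<sigma> (MFArr Q (reindex Bs \<sigma>) D f)"
      using O *(2) by (simp add: act_def del: map_map)
  qed
  have iso: "cartesian_iso M ?N P Q"
    using cP cQ QP PQ by (simp add: cartesian_iso_def restrict_multifunctor_cong_iff)
  interpret sequential_action C act
    using C cartesian_multicategory_iso[OF M iso]
    by (simp add: sequential_action_def sequential_action_axioms_def)
  show thesis
    by (rule that[OF preadditive_category_induced cartesian_iso_trans[OF iso cartesian_iso_induced]])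
qed

section \<open>The functor from \<open>preAdd\<close> to \<open>fpSeq\<close> and its full
  faithfulness\<close>

context
  fixes e :: "'a list \<Rightarrow> 'a"
  assumes e: "inj e"
begin

abbreviation cart :: "('o, 'a) preadditive_category \<Rightarrow> ('o, 'a) cartesian_multicategory" where
  "cart C \<equiv> relabel e (seq_cartesian C)"

text \<open>Carries a multifunctor between tuples to one between coded tuples: decode, apply
  \<open>H\<close>, encode.\<close>

definition conj_multifunctor :: "('o, 'a list, 'p, 'a list) multifunctor_data \<Rightarrow> ('o, 'a, 'p, 'a) multifunctor_data" where
  "conj_multifunctor H = comp_multifunctor (relabel_arrows e)
    (comp_multifunctor H (relabel_arrows (inv_into UNIV e)))"

lemma conj_multifunctor_simps [simp]:
  "MFObj (conj_multifunctor H) = MFObj H"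
  "MFArr (conj_multifunctor H) Xs Y (e f) = e (MFArr H Xs Y f)"
  using e by (simp_all add: conj_multifunctor_def comp_def)

lemma cartesian_multifunctor_relabel:
  "cartesian_multifunctor M (relabel e M) (relabel_arrows e)"
  "cartesian_multifunctor (relabel e M) M (relabel_arrows (inv_into UNIV e))"
  using cartesian_iso_relabel[OF e] by (auto simp: cartesian_iso_def)

lemma cartesian_multifunctor_conj:
  assumes "cartesian_multifunctor (seq_cartesian C) (seq_cartesian D) H"
  shows "cartesian_multifunctor (cart C) (cart D) (conj_multifunctor H)"
  unfolding conj_multifunctor_def
  by (rule cartesian_multifunctor_comp[OF cartesian_multifunctor_comp[OF cartesian_multifunctor_relabel(2) assms]
      cartesian_multifunctor_relabel(1)])

definition fpSeq_of_preAdd ::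
  "(('o, 'a) preadditive_category, ('o, 'a, 'o, 'a) functor_data,
    ('o, 'a) cartesian_multicategory, ('o, 'a, 'o, 'a) multifunctor_data) functor_data" where
  "fpSeq_of_preAdd = \<lparr>FObj = cart,
    FArr = (\<lambda>C D F. restrict_multifunctor (cart C) (conj_multifunctor (seq_multifunctor F)))\<rparr>"

lemma is_functor_fpSeq_of_preAdd:
  "is_functor (preAdd :: (('o, 'a) preadditive_category, _) category) fpSeq fpSeq_of_preAdd"
  unfolding is_functor_def
proof (intro conjI ballI)
  fix C :: "('o, 'a) preadditive_category" assume "C \<in> Obj preAdd"
  then have C: "preadditive_category C" by (simp add: preAdd_def)
  then show "FObj fpSeq_of_preAdd C \<in> Obj fpSeq"
    by (simp add: fpSeq_of_preAdd_def relabel_seq_cartesian_in_fpSeq[OF e])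
  have "MFArr (seq_multifunctor (restrict_functor C id_functor)) Xs Y f = f"
    if "Xs \<in> lists (Obj C)" "Y \<in> Obj C" "f \<in> MHom (seq_multicategory C) Xs Y" for Xs Y f
    using that by (intro nth_equalityI) (simp_all add: MHom_seq nth_in_lists)
  then show "FArr fpSeq_of_preAdd C C (Ident preAdd C) = Ident fpSeq (FObj fpSeq_of_preAdd C)"
    by (simp add: fpSeq_of_preAdd_def fpSeq_def full_subcategory_def fpMlt_def preAdd_def
        restrict_multifunctor_cong_iff)
next
  fix C D :: "('o, 'a) preadditive_category" and F
  assume "C \<in> Obj preAdd" "D \<in> Obj preAdd" "F \<in> Hom preAdd C D"
  then show "FArr fpSeq_of_preAdd C D F \<in> Hom fpSeq (FObj fpSeq_of_preAdd C) (FObj fpSeq_of_preAdd D)"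
    using relabel_seq_cartesian_in_fpSeq[OF e, of C]
    by (simp add: fpSeq_of_preAdd_def Hom_fpSeq Obj_fpSeq preAdd_def cartesian_multifunctor_restrict
        cartesian_multifunctor_conj cartesian_multifunctor_seq_multifunctor)
next
  fix C D E :: "('o, 'a) preadditive_category" and F G
  assume *: "C \<in> Obj preAdd" "D \<in> Obj preAdd" "E \<in> Obj preAdd" "F \<in> Hom preAdd C D" "G \<in> Hom preAdd D E"
  then have F: "additive_functor C D F" by (simp add: preAdd_def)
  have FO: "FObj F X \<in> Obj D" if "X \<in> Obj C" for X
    using F that by (simp add: additive_functor_def is_functor_def)
  have FA: "MFArr (seq_multifunctor F) Xs Y f \<in> MHom (seq_multicategory D) (map (FObj F) Xs) (FObj F Y)"
    if "Xs \<in> lists (Obj C)" "Y \<in> Obj C" "f \<in> MHom (seq_multicategory C) Xs Y" for Xs Y f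
    using F that by (simp add: additive_functor_def is_functor_def MHom_seq nth_in_lists)
  have FL: "map (FObj F) Xs \<in> lists (Obj D)" if "Xs \<in> lists (Obj C)" for Xs
    using that FO by auto
  have eq: "MFArr (seq_multifunctor (restrict_functor C (comp_functor G F))) Xs Y f =
      MFArr (seq_multifunctor G) (map (FObj F) Xs) (FObj F Y) (MFArr (seq_multifunctor F) Xs Y f)"
    if "Xs \<in> lists (Obj C)" "Y \<in> Obj C" "f \<in> MHom (seq_multicategory C) Xs Y" for Xs Y f
    using that by (intro nth_equalityI) (simp_all add: MHom_seq nth_in_lists)
  have "restrict_multifunctor (cart C) (conj_multifunctor (seq_multifunctor (restrict_functor C (comp_functor G F)))) =
      restrict_multifunctor (cart C) (comp_multifunctor
        (restrict_multifunctor (cart D) (conj_multifunctor (seq_multifunctor G)))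
        (restrict_multifunctor (cart C) (conj_multifunctor (seq_multifunctor F))))"
    unfolding restrict_multifunctor_cong_iff
  proof (intro conjI ballI)
    fix X assume "X \<in> MObj (cart C)"
    then show "MFObj (conj_multifunctor (seq_multifunctor (restrict_functor C (comp_functor G F)))) X =
        MFObj (comp_multifunctor (restrict_multifunctor (cart D) (conj_multifunctor (seq_multifunctor G)))
          (restrict_multifunctor (cart C) (conj_multifunctor (seq_multifunctor F)))) X"
      using FO by simp
  next
    fix Xs Y k assume k: "Xs \<in> lists (MObj (cart C))" "Y \<in> MObj (cart C)" "k \<in> MHom (cart C) Xs Y"
    then obtain f where f: "k = e f" "f \<in> MHom (seq_multicategory C) Xs Y" by auto
    have "e (MFArr (seq_multifunctor F) Xs Y f) \<in> MHom (cart D) (map (FObj F) Xs) (FObj F Y)"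
      using FA k f by simp
    then show "MFArr (conj_multifunctor (seq_multifunctor (restrict_functor C (comp_functor G F)))) Xs Y k =
        MFArr (comp_multifunctor (restrict_multifunctor (cart D) (conj_multifunctor (seq_multifunctor G)))
          (restrict_multifunctor (cart C) (conj_multifunctor (seq_multifunctor F)))) Xs Y k"
      using k FO FL eq[of Xs Y f] f by simp
  qed
  then show "FArr fpSeq_of_preAdd C E (Comp preAdd C D E G F) =
      Comp fpSeq (FObj fpSeq_of_preAdd C) (FObj fpSeq_of_preAdd D) (FObj fpSeq_of_preAdd E)
        (FArr fpSeq_of_preAdd D E G) (FArr fpSeq_of_preAdd C D F)"
    by (simp add: fpSeq_of_preAdd_def fpSeq_def full_subcategory_def fpMlt_def preAdd_def)
qed

text \<open>One-entry tuples recover the action of a functor on arrows, which gives injectivity. For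
  surjectivity, conjugating \<open>K\<close> back gives a multifunctor \<open>H\<close> on uncoded
  tuples; being entrywise, it is determined by its unary part, an additive functor.\<close>

lemma fully_faithful_fpSeq_of_preAdd:
  fixes C D :: "('o, 'a) preadditive_category"
  assumes C: "preadditive_category C" and D: "preadditive_category D"
  shows "bij_betw (FArr fpSeq_of_preAdd C D) (Hom preAdd C D) (Hom fpSeq (cart C) (cart D))"
  unfolding bij_betw_def
proof (intro conjI inj_onI equalityI subsetI)
  interpret C: preadditive_category C by (rule C)
  interpret D: preadditive_category D by (rule D)
  have cC: "cartesian_multicategory (cart C)"
    using relabel_seq_cartesian_in_fpSeq[OF e C] by (simp add: Obj_fpSeq)
  {
    fix F F' assume *: "F \<in> Hom preAdd C D" "F' \<in> Hom preAdd C D"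
      "FArr fpSeq_of_preAdd C D F = FArr fpSeq_of_preAdd C D F'"
    then have eq: "restrict_multifunctor (cart C) (conj_multifunctor (seq_multifunctor F)) =
        restrict_multifunctor (cart C) (conj_multifunctor (seq_multifunctor F'))"
      by (simp add: fpSeq_of_preAdd_def)
    show "F = F'"
    proof (rule restrict_functor_eqI[of C])
      show "restrict_functor C F = F" "restrict_functor C F' = F'"
        using * by (simp_all add: preAdd_def)
      show "FObj F X = FObj F' X" if "X \<in> Obj C" for X
        using eq that by (simp add: restrict_multifunctor_cong_iff)
      fix X Y f assume f: "X \<in> Obj C" "Y \<in> Obj C" "f \<in> Hom C X Y"
      then have "[X] \<in> lists (Obj C)" "[f] \<in> MHom (seq_multicategory C) [X] Y"
        by (simp_all add: MHom_seq)
      with eq f have "MFArr (seq_multifunctor F) [X] Y [f] = MFArr (seq_multifunctor F') [X] Y [f]"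
        using injD[OF e] by (fastforce simp: restrict_multifunctor_cong_iff)
      then show "FArr F X Y f = FArr F' X Y f"
        by (simp add: seq_multifunctor_def)
    qed
  next
    fix K assume "K \<in> FArr fpSeq_of_preAdd C D ` Hom preAdd C D"
    then show "K \<in> Hom fpSeq (cart C) (cart D)"
      using is_functor_fpSeq_of_preAdd C D
      by (auto simp: is_functor_def fpSeq_of_preAdd_def preAdd_def)
  next
    fix K assume "K \<in> Hom fpSeq (cart C) (cart D)"
    then have K: "cartesian_multifunctor (cart C) (cart D) K" "restrict_multifunctor (cart C) K = K"
      by (simp_all add: Hom_fpSeq)
    define H where "H = comp_multifunctor (relabel_arrows (inv_into UNIV e))
      (comp_multifunctor K (relabel_arrows e :: ('o, 'a list, 'o, 'a) multifunctor_data))"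
    have H: "cartesian_multifunctor (seq_cartesian C) (seq_cartesian D) H"
      unfolding H_def
      by (rule cartesian_multifunctor_comp[OF cartesian_multifunctor_comp[OF cartesian_multifunctor_relabel(1) K(1)]
            cartesian_multifunctor_relabel(2)])
    have mH: "is_multifunctor (seq_multicategory C) (seq_multicategory D) H"
      using cartesian_multifunctorD(1)[OF H] by (simp add: seq_cartesian_def)
    define F where "F = unary_functor H"
    have F: "additive_functor C D F"
      unfolding F_def by (rule additive_functor_unary_functor[OF C D H])
    have "restrict_multifunctor (cart C) (conj_multifunctor (seq_multifunctor (restrict_functor C F))) = K"
    proof (rule restrict_multifunctor_eqI[OF restrict_multifunctor_idem K(2)])
      show "MFObj (restrict_multifunctor (cart C) (conj_multifunctor (seq_multifunctor (restrict_functor C F)))) X =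
          MFObj K X" if "X \<in> MObj (cart C)" for X
        using that by (simp add: F_def H_def)
      fix Xs Y k assume *: "Xs \<in> lists (MObj (cart C))" "Y \<in> MObj (cart C)" "k \<in> MHom (cart C) Xs Y"
      then obtain f where f: "k = e f" "f \<in> MHom (seq_multicategory C) Xs Y" by auto
      \<comment> \<open>Encoding undoes decoding only on the range of \<open>e\<close>, so the value
        of \<open>K\<close> must be known to be a code.\<close>
      have Kk: "MFArr K Xs Y k \<in> range e"
        using MFArr_closed[OF cartesian_multifunctorD(1)[OF K(1)] *] by auto
      have "MFArr (seq_multifunctor (restrict_functor C F)) Xs Y f = MFArr (seq_multifunctor F) Xs Y f"
        using * f by (intro nth_equalityI) (simp_all add: MHom_seq nth_in_lists)
      also have "\<dots> = MFArr H Xs Y f"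
        unfolding F_def using * f
        by (intro multifunctor_eq_seq_multifunctor_unary_functor[OF C.category_axioms D.category_axioms mH, symmetric])
          simp_all
      also have "e \<dots> = MFArr K Xs Y k"
        using Kk f by (simp add: H_def comp_def f_inv_into_f)
      finally show "MFArr (restrict_multifunctor (cart C)
          (conj_multifunctor (seq_multifunctor (restrict_functor C F)))) Xs Y k = MFArr K Xs Y k"
        using * f by simp
    qed
    then show "K \<in> FArr fpSeq_of_preAdd C D ` Hom preAdd C D"
      using additive_functor_restrict[OF C F]
      by (auto simp: fpSeq_of_preAdd_def preAdd_def intro!: rev_image_eqI[of "restrict_functor C F"])
  }
qed

end

theorem proposition4p12:
  assumes "infinite (UNIV :: 'a set)"
  shows "equivalent_categories
    (fpSeq :: (('o, 'a) cartesian_multicategory, ('o, 'a, 'o, 'a) multifunctor_data) category)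
    (preAdd :: (('o, 'a) preadditive_category, ('o, 'a, 'o, 'a) functor_data) category)"
proof -
  obtain e :: "'a list \<Rightarrow> 'a" where e: "inj e"
    using obtain_inj_list[OF assms] .
  show ?thesis
  proof (rule equivalent_categories_if_fully_faithful[OF category_fpSeq category_preAdd
        is_functor_fpSeq_of_preAdd[OF e]])
    fix C D :: "('o, 'a) preadditive_category"
    assume "C \<in> Obj preAdd" "D \<in> Obj preAdd"
    then show "bij_betw (FArr (fpSeq_of_preAdd e) C D) (Hom preAdd C D)
        (Hom fpSeq (FObj (fpSeq_of_preAdd e) C) (FObj (fpSeq_of_preAdd e) D))"
      using fully_faithful_fpSeq_of_preAdd[OF e, of C D]
      by (simp add: preAdd_def fpSeq_of_preAdd_def[OF e])
  next
    fix M :: "('o, 'a) cartesian_multicategory"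
    assume M: "M \<in> Obj fpSeq"
    obtain C :: "('o, 'a) preadditive_category" and F G
      where C: "preadditive_category C" and iso: "cartesian_iso M (seq_cartesian C) F G"
      by (rule fpSeq_iso_seq_cartesian[OF M])
    have "\<exists>f. is_iso fpSeq M (relabel e (seq_cartesian C)) f"
      using is_iso_fpSeq[OF M relabel_seq_cartesian_in_fpSeq[OF e C]
          cartesian_iso_trans[OF iso cartesian_iso_relabel[OF e]]] by blast
    then show "\<exists>C \<in> Obj preAdd. \<exists>f. is_iso fpSeq M (FObj (fpSeq_of_preAdd e) C) f"
      using C by (auto simp: preAdd_def fpSeq_of_preAdd_def[OF e] intro!: exI[of _ C])
  qed
qed

end
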